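(* Let $\mathbb G$ be the connected simply connected Lie group with Lie algebra $\mathfrak h^n_{\mathbb K}=\mathfrak h_1\oplus\mathfrak h_2$, where $\mathbb K\in\{\mathbb R,\mathbb C,\mathbb Q\}$ (real, complex or quaternionic Heisenberg algebra), let $m_1=\dim_{\mathbb R}\mathfrak h_1$, and let $Q$ be the homogeneous dimension of $\mathbb G$. (1) Let $\Sigma\subset\Sigma^{(\mathbf d_t,\mathbf d_m)}$ be a collection of intrinsic $(\mathbf d_t,\mathbf d_m)$-Lipschitz graphs on $\mathbb G$ such that all the graphs $S\in\Sigma$ contain a common point $g_0\in\mathbb G$. Then for $\mathbf d_m p\le Q$, $p>1$, we have $M_p(\Sigma)=0$. (2) In the case $\mathbf d_t=\mathbf d_m$, if $p\,\mathbf d_t>m_1$, then there is a family $\Sigma$ of intrinsic $(\mathbf d_t,\mathbf d_m)$-Lipschitz graphs on $\mathbb G$ such that $M_p(\Sigma)\neq0$.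
   Context: The algebras $\mathfrak h^n_{\mathbb K}$ ($n>1$) have the form $\mathfrak h_1\oplus\mathfrak h_2$, orthogonal with respect to an inner product, with centre $\mathfrak h_2$ and the following orthonormal bases and nonzero brackets (up to antisymmetry), $k=1,\dots,n$. $\mathfrak h^n_{\mathbb R}$: $\mathfrak h_1=\mathrm{span}\{X_k,Y_k\}$, $\mathfrak h_2=\mathrm{span}\{\epsilon\}$, $[X_k,Y_k]=\epsilon$. $\mathfrak h^n_{\mathbb C}$: $\mathfrak h_1=\mathrm{span}\{X_{1k},\dots,X_{4k}\}$, $\mathfrak h_2=\mathrm{span}\{\epsilon_1,\epsilon_2\}$, $[X_{1k},X_{2k}]=-[X_{3k},X_{4k}]=\epsilon_1$, $[X_{1k},X_{3k}]=[X_{2k},X_{4k}]=\epsilon_2$. $\mathfrak h^n_{\mathbb Q}$: $\mathfrak h_1=\mathrm{span}\{X_{1k},\dots,X_{4k}\}$, $\mathfrak h_2=\mathrm{span}\{\epsilon_1,\epsilon_2,\epsilon_3\}$, the same brackets as for $\mathfrak h^n_{\mathbb C}$ and in addition $[X_{1k},X_{4k}]=-[X_{2k},X_{3k}]=\epsilon_3$. With $m_1=\dim\mathfrak h_1$, $m_2=\dim\mathfrak h_2$: $N=m_1+m_2$ is the topological dimension, $Q=m_1+2m_2$. These are 2-step Carnot groups, with dilations $\delta_\lambda$ induced by $(x,t)\mapsto(\lambda x,\lambda^2t)$. $\mathbf g_{\mathbb G}$ is the Haar measure. A homogeneous norm is a continuous $\|\cdot\|:\mathbb G\to[0,\infty)$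 with $\|p\|=0$ iff $p=e$, $\|p^{-1}\|=\|p\|$, $\|\delta_\lambda p\|=\lambda\|p\|$, $\|pq\|\le\|p\|+\|q\|$; it induces the distance $d(p,q)=\|q^{-1}p\|$. $d_\rho$ denotes any of the following (mutually bi-Lipschitz equivalent) left-invariant homogeneous distances: one induced by a homogeneous norm smooth away from the identity; the one induced by $\max\{\epsilon_1'\|x\|_E,\epsilon_2'\|t\|_E^{1/2}\}$ (suitable constants $\epsilon_1',\epsilon_2'>0$); the Carnot–Carathéodory distance. $\|\cdot\|$ is the associated homogeneous norm. $\mathcal S^m_{d_\rho}(E)=\lim_{\delta\to0}\inf\{\sum_i\mathrm{diam}(B_i)^m: E\subset\cup_iB_i,\ B_i \text{ closed } d_\rho\text{-balls},\ \mathrm{diam}(B_i)\le\delta\}$. A decomposition $\mathbb G=\mathbb M\cdot\mathbb H$ means that $\mathbb M,\mathbb H$ are homogeneous (dilation-invariant) subgroups with $\mathbb M\cap\mathbb H=\{e\}$ and every $q\in\mathbb G$ is $q=\mathbf P_{\mathbb M}q\cdot\mathbf P_{\mathbb H}q$ with $\mathbf P_{\mathbb M}q\in\mathbb M$, $\mathbf P_{\mathbb H}q\in\mathbb H$. A $(\mathbf d_t,\mathbf d_m)$-subgroup is a homogeneous subgroup with topological dimension $\mathbf d_t$ and metric (Hausdorff, with respect to $d_\rho$) dimension $\mathbf d_m$. For $\Omega\subset\mathbb M$ open and $f:\Omega\to\mathbb H$, $\mathrm{graph}(f)=\{m\cdot f(m):m\in\Omega\}$. With $C_{\mathbb M,\mathbb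 H}(e,\beta)=\{p:\|\mathbf P_{\mathbb M}p\|\le\beta\|\mathbf P_{\mathbb H}p\|\}$ and $C_{\mathbb M,\mathbb H}(q,\beta)=q\cdot C_{\mathbb M,\mathbb H}(e,\beta)$, $f$ is intrinsic Lipschitz if for some $L>0$, $C_{\mathbb M,\mathbb H}(p,1/L)\cap\mathrm{graph}(f)=\{p\}$ for all $p\in\mathrm{graph}(f)$. An intrinsic $(\mathbf d_t,\mathbf d_m)$-Lipschitz graph is the graph of an intrinsic Lipschitz $f:\Omega\to\mathbb H$ for some decomposition $\mathbb G=\mathbb M\cdot\mathbb H$ with $\mathbb M$ a $(\mathbf d_t,\mathbf d_m)$-subgroup. $\Sigma^{(\mathbf d_t,\mathbf d_m)}$ is the family of nonempty sets (surfaces) that near each of their points coincide with an intrinsic $(\mathbf d_t,\mathbf d_m)$-Lipschitz graph, where $1\le\mathbf d_t\le N-1$, $1\le\mathbf d_m\le Q-1$. Module: for a system $\mathbf E$ of (Borel) measures on $\mathbb G$ and $0<p<\infty$, $M_p(\mathbf E)=\inf\int_{\mathbb G}f^p\,d\mathbf g_{\mathbb G}$, the infimum over measurable $f\ge0$ with $\int_{\mathbb G} f\,d\mu\ge1$ for all $\mu\in\mathbf E$ ($+\infty$ if there is no such $f$); $M_p(\Sigma):=M_p(\{\mathcal S^{\mathbf d_m}_{d_\rho}\llcorner S:S\in\Sigma\})$.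
   Formalization: Part (2) additionally assumes that intrinsic (d_t,d_m)-Lipschitz surfaces exist; otherwise (e.g. K=R, n=2, d_t=d_m=3, p=2, where no isotropic 3-dimensional subspace exists) the only family is empty and its module is 0, so the claim fails. *)

theory Defs
  imports "HOL-Analysis.Analysis" "HOL-Algebra.Coset"
begin

section \<open>The Heisenberg algebras\<close>

definition orthonormal_basis :: "'i set \<Rightarrow> ('i \<Rightarrow> 'a::euclidean_space) \<Rightarrow> bool" where
  "orthonormal_basis I X \<longleftrightarrow>
     (\<forall>i\<in>I. \<forall>j\<in>I. X i \<bullet> X j = (if i = j then 1 else 0)) \<and> span (X ` I) = UNIV"

text \<open>
  The Lie algebra is \<open>'a \<times> 'b\<close> with the product inner product, where the type \<open>'a\<close> is the
  horizontal layer and \<open>'b\<close> is the centre. As \<open>[(x, t), (y, s)] = (0, br x y)\<close>, the Lie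
  algebra structure is given by a skew-symmetric bilinear map \<open>br :: 'a \<Rightarrow> 'a \<Rightarrow> 'b\<close>.
\<close>

definition skew_bilinear :: "('a::euclidean_space \<Rightarrow> 'a \<Rightarrow> 'b::euclidean_space) \<Rightarrow> bool" where
  "skew_bilinear br \<longleftrightarrow> bilinear br \<and> (\<forall>x y. br x y = - br y x)"

datatype scalars = Real_Numbers | Complex_Numbers | Quaternions

definition real_heisenberg ::
    "nat \<Rightarrow> ('a::euclidean_space \<Rightarrow> 'a \<Rightarrow> 'b::euclidean_space) \<Rightarrow> bool" where
  "real_heisenberg n br \<longleftrightarrow> skew_bilinear br \<and>
     (\<exists>X Y (e::nat \<Rightarrow> 'b).
        orthonormal_basis ({1..n} <+> {1..n}) (case_sum X Y) \<and> orthonormal_basis {1} e \<and>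
        (\<forall>k\<in>{1..n}. br (X k) (Y k) = e 1) \<and>
        (\<forall>j\<in>{1..n}. \<forall>k\<in>{1..n}. br (X j) (X k) = 0 \<and> br (Y j) (Y k) = 0 \<and>
           (j \<noteq> k \<longrightarrow> br (X j) (Y k) = 0)))"

definition complex_heisenberg ::
    "nat \<Rightarrow> ('a::euclidean_space \<Rightarrow> 'a \<Rightarrow> 'b::euclidean_space) \<Rightarrow> bool" where
  "complex_heisenberg n br \<longleftrightarrow> skew_bilinear br \<and>
     (\<exists>(X::nat \<times> nat \<Rightarrow> 'a) (e::nat \<Rightarrow> 'b).
        orthonormal_basis ({1..4} \<times> {1..n}) X \<and> orthonormal_basis {1..2} e \<and>
        (\<forall>k\<in>{1..n}.
           br (X (1, k)) (X (2, k)) = e 1 \<and> br (X (3, k)) (X (4, k)) = - e 1 \<and>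
           br (X (1, k)) (X (3, k)) = e 2 \<and> br (X (2, k)) (X (4, k)) = e 2 \<and>
           br (X (1, k)) (X (4, k)) = 0 \<and> br (X (2, k)) (X (3, k)) = 0) \<and>
        (\<forall>i\<in>{1..4}. \<forall>l\<in>{1..4}. \<forall>j\<in>{1..n}. \<forall>k\<in>{1..n}.
           j \<noteq> k \<longrightarrow> br (X (i, j)) (X (l, k)) = 0))"

definition quaternionic_heisenberg ::
    "nat \<Rightarrow> ('a::euclidean_space \<Rightarrow> 'a \<Rightarrow> 'b::euclidean_space) \<Rightarrow> bool" where
  "quaternionic_heisenberg n br \<longleftrightarrow> skew_bilinear br \<and>
     (\<exists>(X::nat \<times> nat \<Rightarrow> 'a) (e::nat \<Rightarrow> 'b).
        orthonormal_basis ({1..4} \<times> {1..n}) X \<and> orthonormal_basis {1..3} e \<and>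
        (\<forall>k\<in>{1..n}.
           br (X (1, k)) (X (2, k)) = e 1 \<and> br (X (3, k)) (X (4, k)) = - e 1 \<and>
           br (X (1, k)) (X (3, k)) = e 2 \<and> br (X (2, k)) (X (4, k)) = e 2 \<and>
           br (X (1, k)) (X (4, k)) = e 3 \<and> br (X (2, k)) (X (3, k)) = - e 3) \<and>
        (\<forall>i\<in>{1..4}. \<forall>l\<in>{1..4}. \<forall>j\<in>{1..n}. \<forall>k\<in>{1..n}.
           j \<noteq> k \<longrightarrow> br (X (i, j)) (X (l, k)) = 0))"

fun heisenberg_algebra ::
    "scalars \<Rightarrow> nat \<Rightarrow> ('a::euclidean_space \<Rightarrow> 'a \<Rightarrow> 'b::euclidean_space) \<Rightarrow> bool" where
  "heisenberg_algebra Real_Numbers n br = real_heisenberg n br"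
| "heisenberg_algebra Complex_Numbers n br = complex_heisenberg n br"
| "heisenberg_algebra Quaternions n br = quaternionic_heisenberg n br"


section \<open>The group, its dilations and its Haar measure\<close>

text \<open>
  The connected simply connected group in exponential coordinates: the exponential map
  identifies it with the vector space \<open>'a \<times> 'b\<close>, and in step 2 the Baker--Campbell--Hausdorff
  product is \<open>p + q + [p, q] / 2\<close>. Its topology and smooth structure are those of the type
  \<open>'a \<times> 'b\<close>.
\<close>

definition carnot_group ::
    "('a::euclidean_space \<Rightarrow> 'a \<Rightarrow> 'b::euclidean_space) \<Rightarrow> ('a \<times> 'b) monoid" where
  "carnot_group br =
     \<lparr>carrier = UNIV, monoid.mult = (\<lambda>p q. p + q + (0, (1/2) *\<^sub>R br (fst p) (fst q))), one = 0\<rparr>"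

lemma carnot_group_group:
  assumes "skew_bilinear br"
  shows "group (carnot_group br)"
proof -
  interpret bl: bounded_bilinear br
    using assms by (simp add: skew_bilinear_def bilinear_conv_bounded_bilinear)
  have sk: "br x y = - br y x" for x y
    using assms unfolding skew_bilinear_def by blast
  have "br x x + br x x = 0" for x
    using sk[of x x] by (metis add.right_inverse)
  then have "2 *\<^sub>R br x x = 0" for x
    by (simp add: scaleR_2)
  then have self: "br x x = 0" for x
    by simp
  show ?thesis
  proof (rule groupI)
    fix x
    show "\<exists>y\<in>carrier (carnot_group br). y \<otimes>\<^bsub>carnot_group br\<^esub> x = \<one>\<^bsub>carnot_group br\<^esub>"
      by (rule bexI[of _ "- x"])
        (auto simp: carnot_group_def zero_prod_def bl.minus_left self prod_eq_iff)
  qed (auto simp: carnot_group_def bl.zero_left bl.add_left bl.add_right algebra_simps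
      scaleR_add_right zero_prod_def[symmetric] prod_eq_iff)
qed

definition dilation :: "real \<Rightarrow> 'a::euclidean_space \<times> 'b::euclidean_space \<Rightarrow> 'a \<times> 'b" where
  "dilation l p = (l *\<^sub>R fst p, l\<^sup>2 *\<^sub>R snd p)"

definition haar_measure :: "('g::topological_space, 'm) monoid_scheme \<Rightarrow> 'g measure \<Rightarrow> bool" where
  "haar_measure G \<mu> \<longleftrightarrow> sets \<mu> = sets borel \<and>
     (\<forall>g\<in>carrier G. \<forall>A\<in>sets borel. emeasure \<mu> ((\<lambda>x. g \<otimes>\<^bsub>G\<^esub> x) ` A) = emeasure \<mu> A) \<and>
     (\<forall>K. compact K \<longrightarrow> emeasure \<mu> K < \<infinity>) \<and>
     (\<forall>U. open U \<and> U \<noteq> {} \<longrightarrow> 0 < emeasure \<mu> U)"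


lemma haar_measure_lborel:
  fixes br :: "'a::euclidean_space \<Rightarrow> 'a \<Rightarrow> 'b::euclidean_space"
  assumes "skew_bilinear br"
  shows "haar_measure (carnot_group br) lborel"
proof -
  interpret bl: bounded_bilinear br
    using assms by (simp add: skew_bilinear_def bilinear_conv_bounded_bilinear)
  have inv: "emeasure lborel ((\<lambda>x. g \<otimes>\<^bsub>carnot_group br\<^esub> x) ` A) = emeasure lborel A"
    if A: "A \<in> sets borel" for g :: "'a \<times> 'b" and A
  proof -
    obtain a c where g: "g = (a, c)"
      by (cases g)
    define h where
      "h = (\<lambda>p::'a \<times> 'b. (fst p - a, snd p - c - (1/2) *\<^sub>R br a (fst p - a)))"
    have "continuous_on UNIV h"
      unfolding h_def by (intro continuous_intros bl.continuous_on)
    then have hm: "h \<in> borel_measurable borel"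
      by (rule borel_measurable_continuous_onI)
    have im: "(\<lambda>x. g \<otimes>\<^bsub>carnot_group br\<^esub> x) ` A = h -` A"
    proof (intro subset_antisym subsetI)
      fix p assume "p \<in> h -` A"
      moreover have "p = g \<otimes>\<^bsub>carnot_group br\<^esub> h p"
        by (simp add: carnot_group_def g h_def prod_eq_iff)
      ultimately show "p \<in> (\<lambda>x. g \<otimes>\<^bsub>carnot_group br\<^esub> x) ` A"
        by blast
    qed (auto simp: carnot_group_def g h_def)
    have B: "h -` A \<in> sets borel"
      using measurable_sets[OF hm A] by simp
    have sect: "emeasure lborel (Pair x -` (h -` A)) = emeasure lborel (Pair (x - a) -` A)" for x
    proof -
      define v where "v = - (c + (1/2) *\<^sub>R br a (x - a))"
      have "Pair (x - a) -` A \<in> sets borel"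
        using A sets_Pair1[of A "borel :: 'a measure" "borel :: 'b measure" "x - a"] by (metis borel_prod)
      then have "emeasure lborel ((+) v -` (Pair (x - a) -` A)) = emeasure lborel (Pair (x - a) -` A)"
        by (subst lborel_distr_plus[of v, symmetric], subst emeasure_distr) auto
      moreover have "Pair x -` (h -` A) = (+) v -` (Pair (x - a) -` A)"
        by (auto simp: h_def v_def algebra_simps)
      ultimately show ?thesis
        by simp
    qed
    have m: "(\<lambda>x. emeasure lborel (Pair x -` A)) \<in> borel_measurable (lborel :: 'a measure)"
      using A by (intro lborel.measurable_emeasure_Pair) (metis lborel_prod sets_lborel)
    have fub: "emeasure lborel C = (\<integral>\<^sup>+x. emeasure lborel (Pair x -` C) \<partial>lborel)"
      if "C \<in> sets borel" for C :: "('a \<times> 'b) set"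
      using that lborel.emeasure_pair_measure_alt[of C "lborel :: 'a measure"]
      by (metis lborel_prod sets_lborel)
    have "(\<integral>\<^sup>+x. emeasure lborel (Pair (x - a) -` A) \<partial>lborel)
        = (\<integral>\<^sup>+x. emeasure lborel (Pair x -` A) \<partial>distr lborel borel ((+) (- a)))"
      using m by (subst nn_integral_distr) auto
    then show ?thesis
      by (simp add: im fub[OF A] fub[OF B] sect lborel_distr_plus)
  qed
  have pos: "0 < emeasure lborel U" if "open U" "U \<noteq> {}" for U :: "('a \<times> 'b) set"
  proof (rule gr_zeroI)
    assume "emeasure lborel U = 0"
    then have "negligible U"
      using that by (auto simp: negligible_iff_null_sets intro: null_sets_completionI)
    then show False
      using open_not_negligible that by blast
  qed
  show ?thesis
    unfolding haar_measure_def
    by (auto simp: inv emeasure_compact_finite[unfolded infinity_ennreal_def] pos)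
qed


section \<open>Left-invariant homogeneous distances\<close>

definition homogeneous_norm ::
    "('a::euclidean_space \<times> 'b::euclidean_space) monoid \<Rightarrow> ('a \<times> 'b \<Rightarrow> real) \<Rightarrow> bool" where
  "homogeneous_norm G N \<longleftrightarrow> continuous_on UNIV N \<and> (\<forall>p. 0 \<le> N p) \<and>
     (\<forall>p. N p = 0 \<longleftrightarrow> p = \<one>\<^bsub>G\<^esub>) \<and> (\<forall>p. N (inv\<^bsub>G\<^esub> p) = N p) \<and>
     (\<forall>l>0. \<forall>p. N (dilation l p) = l * N p) \<and>
     (\<forall>p q. N (p \<otimes>\<^bsub>G\<^esub> q) \<le> N p + N q)"

definition norm_dist :: "'g monoid \<Rightarrow> ('g \<Rightarrow> real) \<Rightarrow> 'g \<Rightarrow> 'g \<Rightarrow> real" where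
  "norm_dist G N p q = N (inv\<^bsub>G\<^esub> q \<otimes>\<^bsub>G\<^esub> p)"

primrec Ck_on :: "nat \<Rightarrow> 'a::euclidean_space set \<Rightarrow> ('a \<Rightarrow> real) \<Rightarrow> bool" where
  "Ck_on 0 S f = continuous_on S f"
| "Ck_on (Suc k) S f =
     (\<exists>f'. (\<forall>x\<in>S. (f has_derivative f' x) (at x)) \<and> (\<forall>v. Ck_on k S (\<lambda>x. f' x v)))"

definition smooth_on :: "'a::euclidean_space set \<Rightarrow> ('a \<Rightarrow> real) \<Rightarrow> bool" where
  "smooth_on S f \<longleftrightarrow> (\<forall>k. Ck_on k S f)"

text \<open>
  The left-invariant horizontal field extending \<open>v\<close> in the first layer is
  \<open>(x, t) \<mapsto> (v, br x v / 2)\<close>. A horizontal curve is an absolutely continuous curve with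
  \<open>\<gamma>' s = (u s, br (x s) (u s) / 2)\<close> for almost every \<open>s\<close>, that is, the indefinite integral of
  its derivative; its length is the integral of \<open>norm (u s)\<close>.
\<close>

definition horizontal_curve ::
    "('a::euclidean_space \<Rightarrow> 'a \<Rightarrow> 'b::euclidean_space) \<Rightarrow> (real \<Rightarrow> 'a \<times> 'b) \<Rightarrow> (real \<Rightarrow> 'a) \<Rightarrow> bool"
where
  "horizontal_curve br \<gamma> u \<longleftrightarrow> u absolutely_integrable_on {0..1} \<and>
     (\<forall>s\<in>{0..1}. ((\<lambda>r. (u r, (1/2) *\<^sub>R br (fst (\<gamma> r)) (u r))) has_integral (\<gamma> s - \<gamma> 0)) {0..s})"

definition cc_dist ::
    "('a::euclidean_space \<Rightarrow> 'a \<Rightarrow> 'b::euclidean_space) \<Rightarrow> 'a \<times> 'b \<Rightarrow> 'a \<times> 'b \<Rightarrow> real" where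
  "cc_dist br p q =
     Inf {integral {0..1} (\<lambda>s. norm (u s)) | \<gamma> u. horizontal_curve br \<gamma> u \<and> \<gamma> 0 = p \<and> \<gamma> 1 = q}"

text \<open>
  In the second alternative the constants are suitable if the resulting function is a
  homogeneous norm; only the triangle inequality depends on their choice.
\<close>

definition admissible_dist ::
    "('a::euclidean_space \<Rightarrow> 'a \<Rightarrow> 'b::euclidean_space) \<Rightarrow> ('a \<times> 'b \<Rightarrow> 'a \<times> 'b \<Rightarrow> real) \<Rightarrow> bool" where
  "admissible_dist br d \<longleftrightarrow>
     (\<exists>N. homogeneous_norm (carnot_group br) N \<and> smooth_on (UNIV - {\<one>\<^bsub>carnot_group br\<^esub>}) N \<and>
        d = norm_dist (carnot_group br) N) \<or>
     (\<exists>a>0. \<exists>b>0. let N = (\<lambda>(x, t). max (a * norm x) (b * sqrt (norm t))) in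
        homogeneous_norm (carnot_group br) N \<and> d = norm_dist (carnot_group br) N) \<or>
     d = cc_dist br"

definition assoc_norm :: "'g monoid \<Rightarrow> ('g \<Rightarrow> 'g \<Rightarrow> real) \<Rightarrow> 'g \<Rightarrow> real" where
  "assoc_norm G d p = d p \<one>\<^bsub>G\<^esub>"


section \<open>Hausdorff dimension and spherical Hausdorff measure\<close>

text \<open>
  These are taken with respect to an explicit distance \<open>d\<close>, not the metric of the type.
\<close>

definition ennpowr :: "ennreal \<Rightarrow> real \<Rightarrow> ennreal" where
  "ennpowr x p = (if x = \<infinity> then \<infinity> else ennreal (enn2real x powr p))"

definition ediam :: "('g \<Rightarrow> 'g \<Rightarrow> real) \<Rightarrow> 'g set \<Rightarrow> ennreal" where
  "ediam d A = (SUP x\<in>A. SUP y\<in>A. ennreal (d x y))"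

definition hausdorff_measure :: "('g \<Rightarrow> 'g \<Rightarrow> real) \<Rightarrow> real \<Rightarrow> 'g set \<Rightarrow> ennreal" where
  "hausdorff_measure d s E =
     (SUP \<delta>\<in>{0<..}. INF A\<in>{A::nat \<Rightarrow> 'g set. (\<forall>i. ediam d (A i) \<le> ennreal \<delta>) \<and> E \<subseteq> (\<Union>i. A i)}.
        \<Sum>i. ennpowr (ediam d (A i)) s)"

definition hausdorff_dim :: "('g \<Rightarrow> 'g \<Rightarrow> real) \<Rightarrow> 'g set \<Rightarrow> ennreal" where
  "hausdorff_dim d E = Inf (ennreal ` {s. 0 < s \<and> hausdorff_measure d s E = 0})"

definition closed_balls :: "('g \<Rightarrow> 'g \<Rightarrow> real) \<Rightarrow> 'g set set" where
  "closed_balls d = {{p. d p c \<le> r} | c r. 0 < r}"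

text \<open>
  The infimum increases as \<open>\<delta>\<close> decreases, so the limit for \<open>\<delta> \<rightarrow> 0\<close> is a supremum.
\<close>

definition spherical_measure :: "('g \<Rightarrow> 'g \<Rightarrow> real) \<Rightarrow> nat \<Rightarrow> 'g set \<Rightarrow> ennreal" where
  "spherical_measure d m E =
     (SUP \<delta>\<in>{0<..}. INF B\<in>{B::nat \<Rightarrow> 'g set.
          (\<forall>i. B i \<in> closed_balls d \<and> ediam d (B i) \<le> ennreal \<delta>) \<and> E \<subseteq> (\<Union>i. B i)}.
        \<Sum>i. ediam d (B i) ^ m)"

definition spherical_restrict ::
    "('g::topological_space \<Rightarrow> 'g \<Rightarrow> real) \<Rightarrow> nat \<Rightarrow> 'g set \<Rightarrow> 'g measure" where
  "spherical_restrict d m S = measure_of UNIV (sets borel) (\<lambda>A. spherical_measure d m (A \<inter> S))"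


section \<open>Intrinsic Lipschitz graphs\<close>

definition homogeneous_subgroup ::
    "('a::euclidean_space \<times> 'b::euclidean_space) monoid \<Rightarrow> ('a \<times> 'b) set \<Rightarrow> bool" where
  "homogeneous_subgroup G M \<longleftrightarrow> subgroup M G \<and> (\<forall>l>0. dilation l ` M \<subseteq> M)"

definition decomposition ::
    "('a::euclidean_space \<times> 'b::euclidean_space) monoid \<Rightarrow> ('a \<times> 'b) set \<Rightarrow> ('a \<times> 'b) set \<Rightarrow> bool"
where
  "decomposition G M H \<longleftrightarrow> homogeneous_subgroup G M \<and> homogeneous_subgroup G H \<and>
     M \<inter> H = {\<one>\<^bsub>G\<^esub>} \<and> (\<forall>q. \<exists>m\<in>M. \<exists>h\<in>H. q = m \<otimes>\<^bsub>G\<^esub> h)"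

definition proj_left :: "'g monoid \<Rightarrow> 'g set \<Rightarrow> 'g set \<Rightarrow> 'g \<Rightarrow> 'g" where
  "proj_left G M H q = (THE m. m \<in> M \<and> (\<exists>h\<in>H. q = m \<otimes>\<^bsub>G\<^esub> h))"

definition proj_right :: "'g monoid \<Rightarrow> 'g set \<Rightarrow> 'g set \<Rightarrow> 'g \<Rightarrow> 'g" where
  "proj_right G M H q = (THE h. h \<in> H \<and> (\<exists>m\<in>M. q = m \<otimes>\<^bsub>G\<^esub> h))"

text \<open>
  In exponential coordinates a homogeneous subgroup is a linear subspace, namely its own Lie
  algebra, so its topological dimension is its linear dimension \<open>dim\<close>.
\<close>

definition dims_subgroup ::
    "('a::euclidean_space \<times> 'b::euclidean_space) monoid \<Rightarrow> ('a \<times> 'b \<Rightarrow> 'a \<times> 'b \<Rightarrow> real)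
      \<Rightarrow> nat \<Rightarrow> nat \<Rightarrow> ('a \<times> 'b) set \<Rightarrow> bool" where
  "dims_subgroup G d dt dm M \<longleftrightarrow>
     homogeneous_subgroup G M \<and> dim M = dt \<and> hausdorff_dim d M = of_nat dm"

definition intrinsic_cone ::
    "'g monoid \<Rightarrow> ('g \<Rightarrow> 'g \<Rightarrow> real) \<Rightarrow> 'g set \<Rightarrow> 'g set \<Rightarrow> 'g \<Rightarrow> real \<Rightarrow> 'g set" where
  "intrinsic_cone G d M H q \<beta> =
     q <#\<^bsub>G\<^esub> {p. assoc_norm G d (proj_left G M H p) \<le> \<beta> * assoc_norm G d (proj_right G M H p)}"

definition intrinsic_graph :: "'g monoid \<Rightarrow> 'g set \<Rightarrow> ('g \<Rightarrow> 'g) \<Rightarrow> 'g set" where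
  "intrinsic_graph G \<Omega> f = {m \<otimes>\<^bsub>G\<^esub> f m | m. m \<in> \<Omega>}"

definition intrinsic_lipschitz ::
    "'g monoid \<Rightarrow> ('g \<Rightarrow> 'g \<Rightarrow> real) \<Rightarrow> 'g set \<Rightarrow> 'g set \<Rightarrow> 'g set \<Rightarrow> ('g \<Rightarrow> 'g) \<Rightarrow> bool" where
  "intrinsic_lipschitz G d M H \<Omega> f \<longleftrightarrow>
     (\<exists>L>0. \<forall>p\<in>intrinsic_graph G \<Omega> f. intrinsic_cone G d M H p (1 / L) \<inter> intrinsic_graph G \<Omega> f = {p})"

definition lipschitz_graph ::
    "('a::euclidean_space \<times> 'b::euclidean_space) monoid \<Rightarrow> ('a \<times> 'b \<Rightarrow> 'a \<times> 'b \<Rightarrow> real)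
      \<Rightarrow> nat \<Rightarrow> nat \<Rightarrow> ('a \<times> 'b) set \<Rightarrow> bool" where
  "lipschitz_graph G d dt dm S \<longleftrightarrow>
     (\<exists>M H \<Omega> f. decomposition G M H \<and> dims_subgroup G d dt dm M \<and>
        openin (top_of_set M) \<Omega> \<and> f \<in> \<Omega> \<rightarrow> H \<and> intrinsic_lipschitz G d M H \<Omega> f \<and>
        S = intrinsic_graph G \<Omega> f)"

definition lipschitz_surfaces ::
    "('a::euclidean_space \<times> 'b::euclidean_space) monoid \<Rightarrow> ('a \<times> 'b \<Rightarrow> 'a \<times> 'b \<Rightarrow> real)
      \<Rightarrow> nat \<Rightarrow> nat \<Rightarrow> ('a \<times> 'b) set set" where
  "lipschitz_surfaces G d dt dm =
     {S. S \<noteq> {} \<and>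
        (\<forall>p\<in>S. \<exists>U \<Gamma>. open U \<and> p \<in> U \<and> lipschitz_graph G d dt dm \<Gamma> \<and> S \<inter> U = \<Gamma> \<inter> U)}"


section \<open>The module of a system of measures\<close>

definition p_module :: "'g::topological_space measure \<Rightarrow> real \<Rightarrow> 'g measure set \<Rightarrow> ennreal" where
  "p_module \<mu> p E =
     (INF f\<in>{f \<in> borel_measurable borel. \<forall>\<nu>\<in>E. 1 \<le> (\<integral>\<^sup>+x. f x \<partial>\<nu>)}. \<integral>\<^sup>+x. ennpowr (f x) p \<partial>\<mu>)"

definition surface_module ::
    "'g::topological_space measure \<Rightarrow> ('g \<Rightarrow> 'g \<Rightarrow> real) \<Rightarrow> nat \<Rightarrow> real \<Rightarrow> 'g set set \<Rightarrow> ennreal" where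
  "surface_module \<mu> d m p F = p_module \<mu> p (spherical_restrict d m ` F)"

end

theory Submission
  imports Defs
begin

text \<open>
  All admissible distances are induced by homogeneous norms; for the Carnot--Caratheodory distance
  this rests on reaching central points by commutators of horizontal segments.

  A homogeneous subgroup is a product \<open>M1 \<times> M2\<close> of linear subspaces and its Hausdorff dimension is
  \<open>dim M1 + 2 dim M2\<close>. For a decomposition \<open>M \<cdot> H\<close> the projection to \<open>M\<close> of a ball of radius \<open>r\<close> has
  Haar measure at most a constant times \<open>r\<close> to this power, wherever the ball is centred, because
  translations act on \<open>M\<close> by translations and shears. Hence an intrinsic Lipschitz graph through \<open>g0\<close>, which
  projects onto a neighbourhood in \<open>M\<close>, has spherical measure at least \<open>c r\<^sup>m\<close> in the ball of radius \<open>r\<close>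
  about \<open>g0\<close>. A function comparable to \<open>r\<^sup>-\<^sup>m / log (1 / r)\<close> then has infinite integral over
  every surface through \<open>g0\<close> but finite \<open>p\<close>-energy when \<open>m p \<le> Q\<close> and \<open>p > 1\<close>.

  If \<open>dt = dm\<close> then \<open>M2 = 0\<close>, so \<open>dt \<le> m1\<close> and \<open>p > 1\<close>. The family of all left translates of
  the unit piece of \<open>M\<close> has infinite module: average over the group and use right invariance.
\<close>


section \<open>The group law and its Haar measure\<close>

text \<open>In general the projection \<open>PM\<close> to \<open>M\<close> is neither a
  homomorphism nor Lipschitz, so the measure of a graph cannot be bounded below by pushing it to
  \<open>M\<close> with a Lipschitz map. What survives is a bound for the projection of a single
  ball, uniform in its centre: it turns every cover of a graph by balls into a cover of a ball of
  \<open>M\<close>. The logarithm in the test function is forced by the endpoint m p = Q. There the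
  pure power r^(-m) has energy of order 1 in every dyadic shell, a divergent sum; the extra factor
  1/k turns this into the sum of k^(-p), finite for p > 1, while the surface integrals become
  harmonic sums and still diverge. An infinite surface integral makes every positive multiple of the
  test function admissible, and this pushes the module down to 0. In the second part every translate
  forces a fixed amount of energy, and the translates are indexed by a group of infinite
  volume.\<close>

locale step_two_group =
  fixes br :: "'a::euclidean_space \<Rightarrow> 'a \<Rightarrow> 'b::euclidean_space"
  assumes skew: "skew_bilinear br"
begin

sublocale br: bounded_bilinear br
  using skew by (simp add: skew_bilinear_def bilinear_conv_bounded_bilinear)

lemma br_skew: "br x y = - br y x"
  using skew unfolding skew_bilinear_def by blast

lemma br_self [simp]: "br x x = 0"
proof -
  have "br x x + br x x = 0"
    using br_skew[of x x] by (metis add.right_inverse)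
  then have "2 *\<^sub>R br x x = 0"
    by (simp add: scaleR_2)
  then show ?thesis
    by simp
qed

text \<open>The product of \<open>carnot_group\<close> as an operation on pairs. The carrier is
  everything and the inverse is negation, so the record operations are simplified to
  \<open>\<star>\<close> and \<open>-\<close> throughout.\<close>

definition gmult :: "'a \<times> 'b \<Rightarrow> 'a \<times> 'b \<Rightarrow> 'a \<times> 'b"  (infixl "\<star>" 70) where
  "p \<star> q = (fst p + fst q, snd p + snd q + (1/2) *\<^sub>R br (fst p) (fst q))"

lemma fst_gmult [simp]: "fst (p \<star> q) = fst p + fst q"
  and snd_gmult: "snd (p \<star> q) = snd p + snd q + (1/2) *\<^sub>R br (fst p) (fst q)"
  by (simp_all add: gmult_def)

lemma gmult_assoc: "(p \<star> q) \<star> r = p \<star> (q \<star> r)"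
  by (simp add: gmult_def br.add_left br.add_right algebra_simps)

lemma gmult_0 [simp]: "0 \<star> p = p" "p \<star> 0 = p"
  by (simp_all add: gmult_def br.zero_left br.zero_right)

lemma gmult_minus [simp]: "- p \<star> p = 0" "p \<star> - p = 0"
  by (simp_all add: gmult_def br.minus_left br.minus_right prod_eq_iff)

lemma gmult_cancel [simp]: "- p \<star> (p \<star> q) = q" "p \<star> (- p \<star> q) = q"
  by (simp_all flip: gmult_assoc)

lemma gmult_left_cancel [simp]: "p \<star> q = p \<star> r \<longleftrightarrow> q = r"
  by (metis gmult_cancel(1))

lemma minus_gmult: "- (p \<star> q) = - q \<star> - p"
  using br_skew[of "fst p" "fst q"]
  by (simp add: gmult_def br.minus_left br.minus_right prod_eq_iff algebra_simps)

lemma mult_carnot [simp]: "p \<otimes>\<^bsub>carnot_group br\<^esub> q = p \<star> q"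
  by (simp add: carnot_group_def gmult_def prod_eq_iff)

lemma one_carnot [simp]: "\<one>\<^bsub>carnot_group br\<^esub> = 0"
  and carrier_carnot [simp]: "carrier (carnot_group br) = UNIV"
  by (simp_all add: carnot_group_def)

lemma inv_carnot [simp]: "inv\<^bsub>carnot_group br\<^esub> p = - p"
  using group.inv_equality[OF carnot_group_group[OF skew], of "- p" p] by simp

lemma norm_dist_carnot: "norm_dist (carnot_group br) N p q = N (- q \<star> p)"
  by (simp add: norm_dist_def)

lemma dilation_gmult: "dilation l (p \<star> q) = dilation l p \<star> dilation l q"
  by (simp add: dilation_def gmult_def br.scaleR_left br.scaleR_right algebra_simps power2_eq_square)

lemma continuous_on_gmult [continuous_intros]:
  "continuous_on S f \<Longrightarrow> continuous_on S g \<Longrightarrow> continuous_on S (\<lambda>x. f x \<star> g x)"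
  unfolding gmult_def by (intro continuous_intros br.continuous_on)

lemma borel_measurable_gmult [measurable (raw)]:
  "f \<in> borel_measurable M \<Longrightarrow> g \<in> borel_measurable M \<Longrightarrow> (\<lambda>x. f x \<star> g x) \<in> borel_measurable M"
  by (rule borel_measurable_continuous_Pair[where H = "\<lambda>p q. p \<star> q"])
     (auto intro!: continuous_intros)

end

lemma dilation_dilation: "dilation k (dilation l p) = dilation (k * l) p"
  by (simp add: dilation_def power_mult_distrib)

lemma dilation_1 [simp]: "dilation 1 p = p"
  by (simp add: dilation_def)

lemma dilation_0 [simp]: "dilation l 0 = 0"
  by (simp add: dilation_def prod_eq_iff)

lemma dilation_minus: "dilation l (- p) = - dilation l p"
  by (simp add: dilation_def)

lemma dilation_inverse:
  assumes "l > 0"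
  shows "dilation (inverse l) (dilation l p) = p" "dilation l (dilation (inverse l) p) = p"
  using assms by (simp_all add: dilation_dilation)

lemma continuous_on_dilation [continuous_intros]:
  "continuous_on S f \<Longrightarrow> continuous_on S (\<lambda>x. dilation l (f x))"
  unfolding dilation_def by (intro continuous_intros)

lemma borel_measurable_dilation [measurable]: "dilation l \<in> borel_measurable borel"
  by (intro borel_measurable_continuous_onI continuous_on_dilation continuous_on_id)

section \<open>Lebesgue measure under translations, shears and diagonal maps\<close>

lemma emeasure_lborel_Times_sections:
  fixes A :: "('a::euclidean_space \<times> 'b::euclidean_space) set"
  assumes "A \<in> sets borel"
  shows "emeasure lborel A = (\<integral>\<^sup>+x. emeasure lborel (Pair x -` A) \<partial>lborel)"
  using assms lborel.emeasure_pair_measure_alt[of A "lborel :: 'a measure"]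
  by (metis lborel_prod sets_lborel)

lemma emeasure_lborel_translate:
  fixes A :: "'a::euclidean_space set"
  assumes "A \<in> sets borel"
  shows "emeasure lborel ((\<lambda>x. x + v) -` A) = emeasure lborel A"
proof -
  have "(\<lambda>x. x + v) = (+) v"
    by (auto simp: add.commute)
  then show ?thesis
    using assms by (subst (2) lborel_distr_plus[of v, symmetric], subst emeasure_distr) auto
qed

text \<open>On each vertical section the map is a translation by a constant, and in the base it is
  the translation by \<open>a\<close>; both preserve Lebesgue measure. Group translations, and later
  the actions on \<open>M\<close>, have this form.\<close>

lemma emeasure_lborel_shear:
  fixes \<phi> :: "'a::euclidean_space \<Rightarrow> 'b::euclidean_space"
  assumes [measurable]: "\<phi> \<in> borel_measurable borel" "A \<in> sets borel"
  shows "emeasure lborel ((\<lambda>p. (fst p + a, snd p + \<phi> (fst p))) -` A) = emeasure lborel A"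
proof -
  let ?T = "\<lambda>p. (fst p + a, snd p + \<phi> (fst p))"
  have [measurable]: "?T \<in> borel_measurable borel"
    unfolding borel_prod[symmetric] by measurable
  have TA: "?T -` A \<in> sets borel"
    using measurable_sets[of ?T borel borel A] by simp
  have sec: "Pair y -` A \<in> sets borel" for y
    using assms(2) sets_Pair1[of A "borel :: 'a measure" "borel :: 'b measure" y]
    by (metis borel_prod)
  have m: "(\<lambda>x. emeasure lborel (Pair x -` A)) \<in> borel_measurable (lborel :: 'a measure)"
    using assms(2) by (intro lborel.measurable_emeasure_Pair) (metis lborel_prod sets_lborel)
  have "emeasure lborel (?T -` A) = (\<integral>\<^sup>+x. emeasure lborel (Pair x -` ?T -` A) \<partial>lborel)"
    by (rule emeasure_lborel_Times_sections[OF TA])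
  also have "\<dots> = (\<integral>\<^sup>+x. emeasure lborel (Pair (x + a) -` A) \<partial>lborel)"
  proof (rule nn_integral_cong)
    fix x
    have "Pair x -` ?T -` A = (\<lambda>t. t + \<phi> x) -` (Pair (x + a) -` A)"
      by auto
    then show "emeasure lborel (Pair x -` ?T -` A) = emeasure lborel (Pair (x + a) -` A)"
      using emeasure_lborel_translate[OF sec] by simp
  qed
  also have "\<dots> = (\<integral>\<^sup>+x. emeasure lborel (Pair x -` A) \<partial>distr lborel borel ((+) a))"
    using m by (subst nn_integral_distr) (auto simp: add.commute)
  also have "\<dots> = emeasure lborel A"
    by (simp add: lborel_distr_plus emeasure_lborel_Times_sections[OF assms(2)])
  finally show ?thesis .
qed

lemma emeasure_lborel_uminus:
  fixes A :: "'a::euclidean_space set"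
  assumes "A \<in> sets borel"
  shows "emeasure lborel (uminus -` A) = emeasure lborel A"
proof -
  have "lborel = density (distr lborel borel (\<lambda>x::'a. 0 + (- 1) *\<^sub>R x)) (\<lambda>_. ennreal (\<bar>- 1\<bar> ^ DIM('a)))"
    by (rule lborel_affine) simp
  then have "lborel = distr lborel borel (uminus :: 'a \<Rightarrow> 'a)"
    by (simp add: density_1)
  then have "emeasure lborel A = emeasure (distr lborel borel (uminus :: 'a \<Rightarrow> 'a)) A"
    by simp
  then show ?thesis
    using assms by (subst (asm) emeasure_distr) auto
qed

lemma emeasure_lborel_diagonal:
  fixes c :: "'a::euclidean_space \<Rightarrow> real"
  assumes [measurable]: "A \<in> sets borel" and c: "\<And>b. b \<in> Basis \<Longrightarrow> c b > 0"
  shows "emeasure lborel A =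
    ennreal (\<Prod>b\<in>Basis. c b) * emeasure lborel ((\<lambda>x. \<Sum>b\<in>Basis. (c b * (x \<bullet> b)) *\<^sub>R b) -` A)"
proof -
  let ?T = "\<lambda>x::'a. 0 + (\<Sum>b\<in>Basis. (c b * (x \<bullet> b)) *\<^sub>R b)"
  have T [measurable]: "?T \<in> borel_measurable borel"
    by measurable
  have "(\<Prod>b\<in>Basis. \<bar>c b\<bar>) = (\<Prod>b\<in>Basis. c b)"
    using c by (intro prod.cong) (auto simp: abs_of_pos)
  then have "lborel = density (distr lborel borel ?T) (\<lambda>_. ennreal (\<Prod>b\<in>Basis. c b))"
    using lborel_affine_euclidean[where c = c and t = 0, folded atomize_eq] c by fastforce
  then have "emeasure lborel A
      = emeasure (density (distr lborel borel ?T) (\<lambda>_. ennreal (\<Prod>b\<in>Basis. c b))) A"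
    by simp
  also have "\<dots> = ennreal (\<Prod>b\<in>Basis. c b) * emeasure (distr lborel borel ?T) A"
    by (subst emeasure_density) (auto simp: nn_integral_cmult_indicator)
  finally show ?thesis
    by (simp add: emeasure_distr)
qed

context step_two_group
begin

text \<open>The bracket depends only on first components, so multiplication from either side is a
  shear over a translation. This gives bi-invariance of Lebesgue measure.\<close>

lemma emeasure_lborel_gmult:
  assumes [measurable]: "A \<in> sets borel"
  shows emeasure_lborel_gmult_left: "emeasure lborel ((\<lambda>x. g \<star> x) -` A) = emeasure lborel A"
    and emeasure_lborel_gmult_right: "emeasure lborel ((\<lambda>x. x \<star> g) -` A) = emeasure lborel A"
proof -
  have m: "(\<lambda>x. snd g + (1/2) *\<^sub>R br (fst g) x) \<in> borel_measurable borel"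
    "(\<lambda>x. snd g + (1/2) *\<^sub>R br x (fst g)) \<in> borel_measurable borel"
    by (auto intro!: borel_measurable_continuous_onI continuous_intros br.continuous_on)
  show "emeasure lborel ((\<lambda>x. g \<star> x) -` A) = emeasure lborel A"
    using emeasure_lborel_shear[OF m(1) assms, of "fst g"] by (simp add: gmult_def algebra_simps)
  show "emeasure lborel ((\<lambda>x. x \<star> g) -` A) = emeasure lborel A"
    using emeasure_lborel_shear[OF m(2) assms, of "fst g"] by (simp add: gmult_def algebra_simps)
qed

text \<open>Haar invariance is stated with images, while integrals are transformed by push-forwards.
  The preimage under translation by \<open>g\<close> is the image under translation by
  \<open>- g\<close>.\<close>

lemma haar_measure_carnot_distr:
  assumes "haar_measure (carnot_group br) \<mu>"
  shows "distr \<mu> borel (\<lambda>x. g \<star> x) = \<mu>"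
proof (rule measure_eqI)
  have s [measurable_cong]: "sets \<mu> = sets borel"
    using assms by (simp add: haar_measure_def)
  show "sets (distr \<mu> borel (\<lambda>x. g \<star> x)) = sets \<mu>"
    by (simp add: s)
  fix A assume "A \<in> sets (distr \<mu> borel (\<lambda>x. g \<star> x))"
  then have A [measurable]: "A \<in> sets borel"
    by simp
  have "(\<lambda>x. g \<star> x) -` A = (\<lambda>x. - g \<star> x) ` A"
    by (force simp: image_iff intro: bexI[of _ "g \<star> _"])
  moreover have "emeasure \<mu> ((\<lambda>x. - g \<star> x) ` A) = emeasure \<mu> A"
    using assms A unfolding haar_measure_def mult_carnot carrier_carnot by blast
  ultimately have "emeasure \<mu> ((\<lambda>x. g \<star> x) -` A) = emeasure \<mu> A"
    by simp
  moreover have "space \<mu> = UNIV"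
    using sets_eq_imp_space_eq[OF s] by simp
  ultimately show "emeasure (distr \<mu> borel (\<lambda>x. g \<star> x)) A = emeasure \<mu> A"
    by (subst emeasure_distr) auto
qed

lemma haar_measure_sigma_finite:
  assumes "haar_measure (carnot_group br) \<mu>"
  shows "sigma_finite_measure \<mu>"
proof
  have s: "sets \<mu> = sets borel" and sp: "space \<mu> = UNIV"
    using assms sets_eq_imp_space_eq[of \<mu> borel] by (auto simp: haar_measure_def)
  show "\<exists>A. countable A \<and> A \<subseteq> sets \<mu> \<and> \<Union>A = space \<mu> \<and> (\<forall>a\<in>A. emeasure \<mu> a \<noteq> \<infinity>)"
  proof (intro exI conjI ballI)
    show "countable (range (\<lambda>n. cball (0::'a \<times> 'b) (real n)))"
      by simp
    show "range (\<lambda>n. cball (0::'a \<times> 'b) (real n)) \<subseteq> sets \<mu>"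
      by (auto simp: s)
    show "\<Union> (range (\<lambda>n. cball (0::'a \<times> 'b) (real n))) = space \<mu>"
      using real_arch_simple by (auto simp: sp)
    fix a assume "a \<in> range (\<lambda>n. cball (0::'a \<times> 'b) (real n))"
    then have "emeasure \<mu> a < \<infinity>"
      using assms unfolding haar_measure_def by auto
    then show "emeasure \<mu> a \<noteq> \<infinity>"
      by simp
  qed
qed

text \<open>
  Uniqueness of Haar measure: integrate \<open>1\<^sub>A(y) 1\<^sub>B(x\<^sup>-\<^sup>1 y)\<close> against \<open>\<mu> \<otimes> lborel\<close> in both orders.
  Since Lebesgue measure is also right-invariant, the two results are
  \<open>\<mu>(A) lborel(B)\<close> and \<open>\<mu>(B) lborel(A)\<close>.
\<close>

lemma haar_measure_proportional:
  assumes \<mu>: "haar_measure (carnot_group br) \<mu>"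
    and A [measurable]: "A \<in> sets borel" and B [measurable]: "B \<in> sets borel"
  shows "emeasure \<mu> A * emeasure lborel B = emeasure \<mu> B * emeasure lborel A"
proof -
  have s [measurable_cong]: "sets \<mu> = sets borel" and sp: "space \<mu> = UNIV"
    using \<mu> sets_eq_imp_space_eq[of \<mu> borel] by (auto simp: haar_measure_def)
  interpret \<mu>: sigma_finite_measure \<mu>
    using \<mu> by (rule haar_measure_sigma_finite)
  interpret pair_sigma_finite "lborel :: ('a \<times> 'b) measure" \<mu> ..
  have 1: "(\<integral>\<^sup>+x. indicator A y * indicator B (- x \<star> y) \<partial>lborel)
      = indicator A y * emeasure lborel B" for y
  proof -
    \<comment> \<open>Inversion turns \<open>- x \<star> y\<close> into a left translate of
      \<open>x\<close>, so reflection invariance reduces the claim to left invariance.\<close>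
    have "(\<lambda>x. - x \<star> y) -` B = (\<lambda>x. - y \<star> x) -` (uminus -` B)"
      by (simp add: vimage_def minus_gmult)
    moreover have "uminus -` B \<in> sets borel"
      using measurable_sets[of uminus borel borel B] by simp
    ultimately have "emeasure lborel ((\<lambda>x. - x \<star> y) -` B) = emeasure lborel B"
      by (simp add: emeasure_lborel_gmult_left emeasure_lborel_uminus)
    moreover have "(\<lambda>x. - x \<star> y) -` B \<in> sets lborel"
      using measurable_sets[of "\<lambda>x. - x \<star> y" lborel borel B] by simp
    moreover have "(\<lambda>x. indicator B (- x \<star> y) :: ennreal) = indicator ((\<lambda>x. - x \<star> y) -` B)"
      by (auto simp: indicator_def)
    ultimately show ?thesis
      by (subst nn_integral_cmult) auto
  qed
  have 2: "(\<integral>\<^sup>+y. indicator A y * indicator B (- x \<star> y) \<partial>\<mu>)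
      = (\<integral>\<^sup>+y. indicator A (x \<star> y) * indicator B y \<partial>\<mu>)" for x
    by (subst haar_measure_carnot_distr[OF \<mu>, of x, symmetric], subst nn_integral_distr) auto
  have 3: "(\<integral>\<^sup>+x. indicator A (x \<star> y) * indicator B y \<partial>lborel)
      = indicator B y * emeasure lborel A" for y
  proof -
    have "(\<lambda>x. x \<star> y) -` A \<in> sets lborel"
      using measurable_sets[of "\<lambda>x. x \<star> y" lborel borel A] by simp
    moreover have "(\<lambda>x. indicator A (x \<star> y) :: ennreal) = indicator ((\<lambda>x. x \<star> y) -` A)"
      by (auto simp: indicator_def)
    ultimately show ?thesis
      by (subst nn_integral_multc) (auto simp: emeasure_lborel_gmult_right mult.commute)
  qed
  have "emeasure \<mu> A * emeasure lborel B = (\<integral>\<^sup>+y. indicator A y * emeasure lborel B \<partial>\<mu>)"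
    by (simp add: nn_integral_multc s)
  also have "\<dots> = (\<integral>\<^sup>+y. \<integral>\<^sup>+x. indicator A y * indicator B (- x \<star> y) \<partial>lborel \<partial>\<mu>)"
    by (simp add: 1)
  also have "\<dots> = (\<integral>\<^sup>+x. \<integral>\<^sup>+y. indicator A y * indicator B (- x \<star> y) \<partial>\<mu> \<partial>lborel)"
    by (rule Fubini') measurable
  also have "\<dots> = (\<integral>\<^sup>+x. \<integral>\<^sup>+y. indicator A (x \<star> y) * indicator B y \<partial>\<mu> \<partial>lborel)"
    by (simp add: 2)
  also have "\<dots> = (\<integral>\<^sup>+y. \<integral>\<^sup>+x. indicator A (x \<star> y) * indicator B y \<partial>lborel \<partial>\<mu>)"
    by (rule Fubini'[symmetric]) measurable
  also have "\<dots> = emeasure \<mu> B * emeasure lborel A"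
    by (simp add: 3 nn_integral_multc s)
  finally show ?thesis .
qed

text \<open>Proportionality is tested on the unit ball, which has positive finite measure for both;
  \<open>c\<close> is the quotient of the two values.\<close>

lemma haar_measure_eq_lborel:
  assumes \<mu>: "haar_measure (carnot_group br) \<mu>"
  obtains c where "0 < c" "\<And>A. A \<in> sets borel \<Longrightarrow> emeasure \<mu> A = ennreal c * emeasure lborel A"
proof -
  let ?B = "ball (0::'a \<times> 'b) 1"
  have "emeasure \<mu> ?B > 0"
    using \<mu> unfolding haar_measure_def by (metis ball_eq_empty not_one_le_zero open_ball)
  moreover have "emeasure \<mu> ?B \<le> emeasure \<mu> (cball 0 1)"
    using \<mu> by (intro emeasure_mono) (auto simp: haar_measure_def)
  moreover have "emeasure \<mu> (cball (0::'a \<times> 'b) 1) < \<infinity>"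
    using \<mu> unfolding haar_measure_def by (metis compact_cball)
  ultimately obtain k where k: "emeasure \<mu> ?B = ennreal k" "k > 0"
    by (cases "emeasure \<mu> ?B") (auto simp: top_unique)
  have "emeasure lborel ?B > 0"
    using haar_measure_lborel[OF skew] unfolding haar_measure_def
    by (metis ball_eq_empty not_one_le_zero open_ball)
  moreover have "emeasure lborel ?B < \<infinity>"
    using emeasure_lborel_ball_finite by simp
  ultimately obtain l where l: "emeasure lborel ?B = ennreal l" "l > 0"
    by (cases "emeasure lborel ?B") (auto simp: top_unique)
  have "emeasure \<mu> A = ennreal (k / l) * emeasure lborel A" if A: "A \<in> sets borel" for A
  proof -
    have "emeasure \<mu> A * ennreal l = ennreal k * emeasure lborel A"
      using haar_measure_proportional[OF \<mu> A, of ?B] by (simp add: k l)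
    then have "emeasure \<mu> A * ennreal l * ennreal (1 / l) = ennreal k * emeasure lborel A * ennreal (1 / l)"
      by simp
    moreover have "ennreal l * ennreal (1 / l) = 1" "ennreal k * ennreal (1 / l) = ennreal (k / l)"
      using k l by (simp_all flip: ennreal_mult)
    ultimately show ?thesis
      by (metis mult.assoc mult.commute mult.right_neutral)
  qed
  moreover have "k / l > 0"
    using k l by simp
  ultimately show ?thesis
    using that by blast
qed

end

text \<open>Uniqueness of Haar measure takes the place of the determinant: for the zero bracket the
  group is the additive one, and the push-forward of Lebesgue measure under a linear bijection is
  again translation invariant. The value of \<open>k\<close> stays unspecified.\<close>

lemma emeasure_lborel_linear_iso:
  fixes T :: "'a::euclidean_space \<times> 'b::euclidean_space \<Rightarrow> 'a \<times> 'b"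
  assumes T: "linear T" "bij T"
  obtains k where "k > 0" "\<And>A. A \<in> sets borel \<Longrightarrow> emeasure lborel (T -` A) = ennreal k * emeasure lborel A"
proof -
  let ?br = "\<lambda>(x::'a) (y::'a). 0::'b"
  interpret G: step_two_group ?br
    by unfold_locales (auto intro!: linearI simp: skew_bilinear_def bilinear_def)
  have G: "p \<otimes>\<^bsub>carnot_group ?br\<^esub> q = p + q" for p q
    by (rule prod_eqI)
      (simp_all only: G.mult_carnot G.fst_gmult G.snd_gmult fst_add snd_add scaleR_zero_right add_0_right)
  have cT: "continuous_on UNIV T"
    using T(1) by (intro linear_continuous_on) (simp add: linear_conv_bounded_linear)
  define S where "S = inv_into UNIV T"
  have lT': "linear S"
    unfolding S_def
    using T by (metis bij_is_inj bij_is_surj inj_linear_imp_inv_linear)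
  then have cT': "continuous_on UNIV S"
    by (intro linear_continuous_on) (simp add: linear_conv_bounded_linear)
  have mT [measurable]: "T \<in> borel_measurable borel"
    by (rule borel_measurable_continuous_onI[OF cT])
  have dist: "emeasure (distr lborel borel T) A = emeasure lborel (T -` A)" if "A \<in> sets borel" for A
    using that by (subst emeasure_distr) auto
  have Tinv: "T (S x) = x" "S (T x) = x" for x
    using T(2) by (simp_all add: S_def bij_is_surj bij_is_inj surj_f_inv_f)
  have "haar_measure (carnot_group ?br) (distr lborel borel T)"
    unfolding haar_measure_def
  proof (intro conjI ballI allI impI)
    fix g :: "'a \<times> 'b" and A :: "('a \<times> 'b) set" assume A: "A \<in> sets borel"
    have im: "(\<lambda>x. g \<otimes>\<^bsub>carnot_group ?br\<^esub> x) ` A = (\<lambda>x. x + (- g)) -` A"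
      unfolding G by (auto simp: image_iff algebra_simps intro: bexI[of _ "_ - g"])
    have gA: "(\<lambda>x. x + (- g)) -` A \<in> sets borel"
      using measurable_sets[of "\<lambda>x. x + (- g)" borel borel A] A by simp
    have "T -` ((\<lambda>x. x + (- g)) -` A) = (\<lambda>x. x + (- S g)) -` (T -` A)"
    proof -
      have "T (x - S g) = T x - g" for x
        using T(1) by (simp add: linear_diff Tinv)
      then show ?thesis
        by (simp add: vimage_def)
    qed
    moreover have "T -` A \<in> sets borel"
      using measurable_sets[OF mT A] by simp
    ultimately show "emeasure (distr lborel borel T) ((\<lambda>x. g \<otimes>\<^bsub>carnot_group ?br\<^esub> x) ` A)
        = emeasure (distr lborel borel T) A"
      unfolding im dist[OF gA] dist[OF A] by (simp only: emeasure_lborel_translate)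
  next
    fix K :: "('a \<times> 'b) set" assume K: "compact K"
    have "T -` K = S ` K"
      using T(2) by (simp add: S_def bij_vimage_eq_inv_image)
    then have "compact (T -` K)"
      using K cT' by (metis compact_continuous_image continuous_on_subset subset_UNIV)
    then show "emeasure (distr lborel borel T) K < \<infinity>"
      using dist[OF borel_compact[OF K]] emeasure_compact_finite by simp
  next
    fix U :: "('a \<times> 'b) set" assume U: "open U \<and> U \<noteq> {}"
    then obtain u where "u \<in> U"
      by blast
    then have "S u \<in> T -` U"
      by (simp add: Tinv)
    moreover have "open (T -` U)"
      using U cT by (simp add: open_vimage)
    ultimately have "0 < emeasure lborel (T -` U)"
      using haar_measure_lborel[OF G.skew] unfolding haar_measure_def by blast
    then show "0 < emeasure (distr lborel borel T) U"
      using dist[of U] U by simp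
  qed simp
  then obtain k where k: "0 < k" "\<And>A. A \<in> sets borel \<Longrightarrow> emeasure (distr lborel borel T) A = ennreal k * emeasure lborel A"
    using G.haar_measure_eq_lborel by blast
  show ?thesis
    using that[OF k(1)] k(2) dist by simp
qed

text \<open>
  In a basis adapted to the range and the kernel of the projection \<open>P\<close> the map
  \<open>x \<mapsto> s P x + (x - P x)\<close> is diagonal with entries \<open>s\<close> and \<open>1\<close>.
\<close>

lemma emeasure_lborel_scale_projection:
  fixes P :: "'a::euclidean_space \<times> 'b::euclidean_space \<Rightarrow> 'a \<times> 'b"
  assumes P: "linear P" "\<And>x. P (P x) = P x" and s: "s > 0" and A: "A \<in> sets borel"
  shows "emeasure lborel A
    = ennreal (s ^ dim (range P)) * emeasure lborel ((\<lambda>x. s *\<^sub>R P x + (x - P x)) -` A)"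
proof -
  define \<Delta> where "\<Delta> x = s *\<^sub>R P x + (x - P x)" for x
  let ?V = "range P" and ?W = "{x. P x = 0}"
  have subV: "subspace ?V"
    using P(1) by (simp add: linear_subspace_image)
  have subW: "subspace ?W"
    using P(1) by (simp add: linear_subspace_kernel)
  have PV: "P x = x" if "x \<in> ?V" for x
    using that P(2) by auto
  obtain B1 where B1: "finite B1" "B1 \<subseteq> ?V" "independent B1" "span B1 = ?V" "card B1 = dim ?V"
    using basis_subspace_exists[OF subV] by blast
  obtain B2 where B2: "finite B2" "B2 \<subseteq> ?W" "independent B2" "span B2 = ?W" "card B2 = dim ?W"
    using basis_subspace_exists[OF subW] by blast
  have VW: "?V \<inter> ?W = {0}"
  proof -
    have "x = 0" if "x \<in> ?V \<inter> ?W" for x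
      using that PV[of x] by simp
    moreover have "0 \<in> ?V \<inter> ?W"
      using subspace_0[OF subV] subspace_0[OF subW] by blast
    ultimately show ?thesis
      by blast
  qed
  have "0 \<notin> B1"
    using B1(3) dependent_zero by blast
  have disj: "B1 \<inter> B2 = {}"
  proof (rule ccontr)
    assume "B1 \<inter> B2 \<noteq> {}"
    then obtain x where x: "x \<in> B1" "x \<in> B2"
      by blast
    then have "x \<in> ?V \<inter> ?W"
      by (intro IntI subsetD[OF B1(2)] subsetD[OF B2(2)])
    then have "x = 0"
      unfolding VW by simp
    then show False
      using \<open>0 \<notin> B1\<close> x(1) by simp
  qed
  have sum: "\<exists>v\<in>?V. \<exists>w\<in>?W. x = v + w" for x
    using P by (intro bexI[of _ "P x"] bexI[of _ "x - P x"]) (auto simp: linear_diff)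
  have VW_sum: "{x + y |x y. x \<in> ?V \<and> y \<in> ?W} = UNIV"
  proof -
    have "z \<in> {x + y |x y. x \<in> ?V \<and> y \<in> ?W}" for z
    proof -
      obtain v w where "v \<in> ?V" "w \<in> ?W" "z = v + w"
        using sum[of z] by (elim bexE) (rule that)
      then show ?thesis
        unfolding mem_Collect_eq[of z] by blast
    qed
    then show ?thesis
      by (rule UNIV_eq_I[symmetric])
  qed
  then have "card (B1 \<union> B2) = DIM('a \<times> 'b)"
    using dim_sums_Int[OF subV subW] VW B1 B2 disj by (simp add: card_Un_disjoint dim_UNIV)
  then obtain f where f: "bij_betw f (Basis :: ('a \<times> 'b) set) (B1 \<union> B2)"
    using B1(1) B2(1) finite_same_card_bij[of "Basis :: ('a \<times> 'b) set" "B1 \<union> B2"] by auto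
  \<comment> \<open>\<open>T\<close> sends the standard basis to the adapted one, so it conjugates
    \<open>\<Delta>\<close> to the coordinate scaling \<open>D\<close> below.\<close>
  define T where "T x = (\<Sum>b\<in>Basis. (x \<bullet> b) *\<^sub>R f b)" for x
  have T: "linear T"
    unfolding T_def by (intro linear_compose_sum linear_compose_scale_right ballI linearI)
      (auto simp: inner_add_left algebra_simps)
  have Tb: "T b = f b" if "b \<in> Basis" for b
  proof -
    have "T b = (\<Sum>i\<in>Basis. (if i = b then f i else 0))"
      unfolding T_def using that by (intro sum.cong refl) (simp add: inner_Basis)
    then show ?thesis
      using that by (simp add: sum.delta)
  qed
  have "range T = UNIV"
  proof -
    have "x \<in> range T" if "x \<in> B1 \<union> B2" for x
    proof -
      have "x \<in> f ` Basis"
        unfolding bij_betw_imp_surj_on[OF f] by (rule that)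
      then obtain b where b: "x = f b" "b \<in> Basis"
        by (rule imageE)
      show ?thesis
        unfolding b(1) Tb[OF b(2), symmetric] by (rule rangeI)
    qed
    then have "B1 \<union> B2 \<subseteq> range T"
      by (rule subsetI)
    then have "span (B1 \<union> B2) \<subseteq> range T"
      using T by (intro span_minimal) (simp_all add: linear_subspace_image)
    moreover have "span (B1 \<union> B2) = UNIV"
      unfolding span_Un B1(4) B2(4) using VW_sum by simp
    ultimately show ?thesis
      by blast
  qed
  then have bijT: "bij T"
    using T by (simp add: bij_def linear_surjective_imp_injective)
  obtain k where k: "k > 0" "\<And>A. A \<in> sets borel \<Longrightarrow> emeasure lborel (T -` A) = ennreal k * emeasure lborel A"
    using emeasure_lborel_linear_iso[OF T bijT] by blast
  define c where "c b = (if f b \<in> B1 then s else 1)" for b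
  define D where "D x = (\<Sum>b\<in>Basis. (c b * (x \<bullet> b)) *\<^sub>R b)" for x :: "'a \<times> 'b"
  have \<Delta>: "linear \<Delta>"
    unfolding \<Delta>_def using P(1)
    by (intro linear_compose_add linear_compose_sub linear_compose_scale_right linear_ident)
  have \<Delta>f: "\<Delta> (f b) = c b *\<^sub>R f b" if "b \<in> Basis" for b
  proof (cases "f b \<in> B1")
    case True
    then have "P (f b) = f b"
      by (intro PV subsetD[OF B1(2)])
    then show ?thesis
      using True by (simp add: \<Delta>_def c_def)
  next
    case False
    moreover have "f b \<in> B1 \<union> B2"
      unfolding bij_betw_imp_surj_on[OF f, symmetric] by (rule imageI[OF that])
    ultimately have "f b \<in> B2"
      by simp
    then have "P (f b) = 0"
      using subsetD[OF B2(2)] by simp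
    then show ?thesis
      using False by (simp add: \<Delta>_def c_def)
  qed
  have "\<Delta> (T x) = T (D x)" for x
  proof -
    have "\<Delta> (T x) = (\<Sum>b\<in>Basis. (x \<bullet> b) *\<^sub>R \<Delta> (f b))"
      unfolding T_def using \<Delta> by (simp add: linear_sum linear_scale)
    also have "\<dots> = (\<Sum>b\<in>Basis. (c b * (x \<bullet> b)) *\<^sub>R f b)"
      by (intro sum.cong refl) (simp add: \<Delta>f mult.commute)
    also have "\<dots> = T (D x)"
      unfolding D_def using T by (simp add: linear_sum linear_scale Tb)
    finally show ?thesis .
  qed
  then have comm: "T -` (\<Delta> -` A) = D -` (T -` A)"
    by (simp add: vimage_def)
  have mT: "T \<in> borel_measurable borel" and m\<Delta>: "\<Delta> \<in> borel_measurable borel"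
    using T \<Delta> by (auto intro!: borel_measurable_continuous_onI linear_continuous_on simp: linear_conv_bounded_linear)
  have TA: "T -` A \<in> sets borel" and \<Delta>A: "\<Delta> -` A \<in> sets borel"
    using measurable_sets[OF mT A] measurable_sets[OF m\<Delta> A] by simp_all
  have "(\<Prod>b\<in>Basis. c b) = s ^ card {b \<in> Basis. f b \<in> B1}"
    unfolding c_def by (simp add: prod.If_cases Int_def)
  also have "card {b \<in> Basis. f b \<in> B1} = card B1"
  proof -
    have "bij_betw f {b \<in> Basis. f b \<in> B1} B1"
      unfolding bij_betw_def
    proof
      show "inj_on f {b \<in> Basis. f b \<in> B1}"
        by (rule inj_on_subset[OF bij_betw_imp_inj_on[OF f]]) blast
      show "f ` {b \<in> Basis. f b \<in> B1} = B1"
      proof (rule subset_antisym)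
        show "B1 \<subseteq> f ` {b \<in> Basis. f b \<in> B1}"
        proof
          fix x assume x: "x \<in> B1"
          then have "x \<in> f ` Basis"
            unfolding bij_betw_imp_surj_on[OF f] by (rule UnI1)
          then obtain b where "x = f b" "b \<in> Basis"
            by (rule imageE)
          then show "x \<in> f ` {b \<in> Basis. f b \<in> B1}"
            using x by (intro image_eqI[of _ _ b]) simp_all
        qed
      qed (rule image_subsetI, simp)
    qed
    then show ?thesis
      by (rule bij_betw_same_card)
  qed
  finally have prod: "(\<Prod>b\<in>Basis. c b) = s ^ dim ?V"
    using B1(5) by simp
  \<comment> \<open>The unspecified factor \<open>k\<close> of \<open>T\<close> enters on both sides
    and cancels.\<close>
  have "ennreal k * emeasure lborel A = emeasure lborel (T -` A)"
    using k(2)[OF A] by simp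
  also have "\<dots> = ennreal (s ^ dim ?V) * emeasure lborel (D -` (T -` A))"
    using emeasure_lborel_diagonal[OF TA, of c] s unfolding prod D_def[abs_def] by (simp add: c_def)
  also have "\<dots> = ennreal k * (ennreal (s ^ dim ?V) * emeasure lborel (\<Delta> -` A))"
    unfolding comm[symmetric] k(2)[OF \<Delta>A] by (simp add: mult_ac)
  finally show ?thesis
    using k(1) unfolding \<Delta>_def[abs_def] by (simp add: ennreal_mult_cancel_left)
qed

text \<open>The map combines a scaling by \<open>r\<close> along a horizontal projection with one by
  \<open>r\<^sup>2\<close> along a vertical projection, whence the weight 2 in the exponent.
  Identity projections give the group dilations; the projections onto the layers of \<open>M\<close>
  give a dilation along \<open>M\<close> that fixes a complement.\<close>

lemma emeasure_lborel_scale_layers: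
  fixes P1 :: "'a::euclidean_space \<Rightarrow> 'a" and P2 :: "'b::euclidean_space \<Rightarrow> 'b"
  assumes P1: "linear P1" "\<And>x. P1 (P1 x) = P1 x" and P2: "linear P2" "\<And>t. P2 (P2 t) = P2 t"
    and r: "r > 0" and A: "A \<in> sets borel"
  shows "emeasure lborel A = ennreal (r ^ (dim (range P1) + 2 * dim (range P2))) * emeasure lborel
    ((\<lambda>q. (r *\<^sub>R P1 (fst q) + (fst q - P1 (fst q)), r\<^sup>2 *\<^sub>R P2 (snd q) + (snd q - P2 (snd q)))) -` A)"
proof -
  define F1 where "F1 q = (P1 (fst q), 0::'b)" for q :: "'a \<times> 'b"
  define F2 where "F2 q = (0::'a, P2 (snd q))" for q :: "'a \<times> 'b"
  let ?E1 = "\<lambda>q. r *\<^sub>R F1 q + (q - F1 q)" and ?E2 = "\<lambda>q. r\<^sup>2 *\<^sub>R F2 q + (q - F2 q)"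
  have l: "linear F1" "linear F2"
    using P1(1) P2(1) by (auto intro!: linearI simp: F1_def F2_def linear_add linear_scale)
  have idem: "F1 (F1 q) = F1 q" "F2 (F2 q) = F2 q" for q
    by (simp_all add: F1_def F2_def P1 P2)
  have "(P1 x, 0) \<in> range F1" for x
    by (intro range_eqI[of _ _ "(x, 0)"]) (simp add: F1_def)
  moreover have "F1 q \<in> range P1 \<times> {0}" for q
    by (simp add: F1_def)
  ultimately have "range F1 = range P1 \<times> {0}"
    by blast
  moreover have "dim (range P1 \<times> {0::'b}) = dim (range P1) + dim {0::'b}"
    using P1(1) by (intro dim_Times subspace_single_0 linear_subspace_image subspace_UNIV)
  ultimately have d1: "dim (range F1) = dim (range P1)"
    by (simp only: dim_singleton) simp
  have "(0, P2 t) \<in> range F2" for t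
    by (intro range_eqI[of _ _ "(0, t)"]) (simp add: F2_def)
  moreover have "F2 q \<in> {0} \<times> range P2" for q
    by (simp add: F2_def)
  ultimately have "range F2 = {0} \<times> range P2"
    by blast
  moreover have "dim ({0::'a} \<times> range P2) = dim {0::'a} + dim (range P2)"
    using P2(1) by (intro dim_Times subspace_single_0 linear_subspace_image subspace_UNIV)
  ultimately have d2: "dim (range F2) = dim (range P2)"
    by (simp only: dim_singleton) simp
  have "linear ?E1"
    using l(1) by (intro linear_compose_add linear_compose_sub linear_compose_scale_right linear_ident)
  then have "?E1 \<in> borel_measurable borel"
    by (intro borel_measurable_continuous_onI linear_continuous_on) (simp add: linear_conv_bounded_linear)
  then have E1A: "?E1 -` A \<in> sets borel"
    using measurable_sets[of ?E1 borel borel A] A by simp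
  have "emeasure lborel A = ennreal (r ^ dim (range P1)) * emeasure lborel (?E1 -` A)"
    using emeasure_lborel_scale_projection[OF l(1) idem(1) r A] d1 by simp
  also have "emeasure lborel (?E1 -` A) = ennreal ((r\<^sup>2) ^ dim (range P2)) * emeasure lborel (?E2 -` (?E1 -` A))"
    using emeasure_lborel_scale_projection[OF l(2) idem(2) _ E1A, of "r\<^sup>2"] d2 r by simp
  also have "?E2 -` (?E1 -` A) = (\<lambda>q. (r *\<^sub>R P1 (fst q) + (fst q - P1 (fst q)),
      r\<^sup>2 *\<^sub>R P2 (snd q) + (snd q - P2 (snd q)))) -` A"
    by (simp add: vimage_def F1_def F2_def plus_prod_def minus_prod_def scaleR_prod_def)
  finally show ?thesis
    using r by (simp add: power_add power_mult ennreal_mult mult.assoc)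
qed

lemma emeasure_lborel_dilation:
  fixes A :: "('a::euclidean_space \<times> 'b::euclidean_space) set"
  assumes "A \<in> sets borel" "l > 0"
  shows "emeasure lborel A
    = ennreal (l ^ (DIM('a) + 2 * DIM('b))) * emeasure lborel (dilation l -` A)"
  using emeasure_lborel_scale_layers[OF linear_ident _ linear_ident _ assms(2,1)]
  by (simp add: dilation_def[abs_def] dim_UNIV)

section \<open>Gauge measures and the Caratheodory criterion\<close>

text \<open>Caratheodory's second construction with a free weight \<open>w\<close> and a free class
  \<open>C\<close> of covering sets, so that one theory serves both the Hausdorff measures (all
  sets) and the spherical ones (closed balls).\<close>

definition cover_content ::
    "('g set \<Rightarrow> ennreal) \<Rightarrow> ('g \<Rightarrow> 'g \<Rightarrow> real) \<Rightarrow> 'g set set \<Rightarrow> real \<Rightarrow> 'g set \<Rightarrow> ennreal" where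
  "cover_content w d C \<delta> E =
     (INF B\<in>{B::nat \<Rightarrow> 'g set. (\<forall>i. B i \<in> C \<and> ediam d (B i) \<le> ennreal \<delta>) \<and> E \<subseteq> (\<Union>i. B i)}.
        \<Sum>i. w (B i))"

definition gauge_measure ::
    "('g set \<Rightarrow> ennreal) \<Rightarrow> ('g \<Rightarrow> 'g \<Rightarrow> real) \<Rightarrow> 'g set set \<Rightarrow> 'g set \<Rightarrow> ennreal" where
  "gauge_measure w d C E = (SUP \<delta>\<in>{0<..}. cover_content w d C \<delta> E)"

lemma spherical_measure_gauge:
  "spherical_measure d m = gauge_measure (\<lambda>B. ediam d B ^ m) d (closed_balls d)"
  by (simp add: fun_eq_iff spherical_measure_def gauge_measure_def cover_content_def)

lemma hausdorff_measure_gauge: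
  "hausdorff_measure d s = gauge_measure (\<lambda>B. ennpowr (ediam d B) s) d UNIV"
  by (simp add: fun_eq_iff hausdorff_measure_def gauge_measure_def cover_content_def)

lemma ediam_ge: "x \<in> A \<Longrightarrow> y \<in> A \<Longrightarrow> ennreal (d x y) \<le> ediam d A"
  unfolding ediam_def by (meson SUP_upper2 order_refl)

lemma ediam_le: "(\<And>x y. x \<in> A \<Longrightarrow> y \<in> A \<Longrightarrow> d x y \<le> r) \<Longrightarrow> ediam d A \<le> ennreal r"
  unfolding ediam_def by (intro SUP_least ennreal_leI) auto

lemma suminf_ennreal_power_half: "0 \<le> e \<Longrightarrow> (\<Sum>n. ennreal (e * (1/2) ^ Suc n)) = ennreal e"
  using sums_mult[OF power_half_series, of e] by (intro suminf_ennreal_eq) auto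

lemma suminf_ennreal_add_power_half:
  "0 \<le> e \<Longrightarrow> (\<Sum>n. f n + ennreal (e * (1/2) ^ Suc n)) = (\<Sum>n. f n) + ennreal e"
  by (simp only: suminf_ennreal_power_half flip: suminf_add[OF summableI summableI])

lemma cover_content_mono: "E \<subseteq> F \<Longrightarrow> cover_content w d C \<delta> E \<le> cover_content w d C \<delta> F"
  unfolding cover_content_def by (intro INF_superset_mono) auto

lemma cover_content_antimono:
  "\<delta> \<le> \<delta>' \<Longrightarrow> cover_content w d C \<delta>' E \<le> cover_content w d C \<delta> E"
  unfolding cover_content_def
  by (intro INF_superset_mono) (auto intro: order_trans ennreal_leI)

lemma cover_content_le_gauge_measure:
  "0 < \<delta> \<Longrightarrow> cover_content w d C \<delta> E \<le> gauge_measure w d C E"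
  unfolding gauge_measure_def by (intro SUP_upper) auto

lemma gauge_measure_mono: "E \<subseteq> F \<Longrightarrow> gauge_measure w d C E \<le> gauge_measure w d C F"
  unfolding gauge_measure_def by (intro SUP_mono) (auto intro: cover_content_mono)

text \<open>Contents grow as the scale shrinks, so scales below \<open>\<delta>0\<close> already
  determine the supremum.\<close>

lemma gauge_measure_le_small_scales:
  assumes "\<delta>0 > 0" and "\<And>\<delta>. 0 < \<delta> \<Longrightarrow> \<delta> < \<delta>0 \<Longrightarrow> cover_content w d C \<delta> E \<le> X"
  shows "gauge_measure w d C E \<le> X"
  unfolding gauge_measure_def
proof (rule SUP_least)
  fix \<delta> :: real assume "\<delta> \<in> {0<..}"
  then have "cover_content w d C \<delta> E \<le> cover_content w d C (min \<delta> (\<delta>0 / 2)) E"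
    by (intro cover_content_antimono) auto
  also have "\<dots> \<le> X"
    using assms(1) \<open>\<delta> \<in> _\<close> by (intro assms(2)) auto
  finally show "cover_content w d C \<delta> E \<le> X" .
qed

text \<open>Covers are sequences indexed by all of \<open>nat\<close>, and a closed ball is never
  empty. Fillers of arbitrarily small weight and diameter take the indices that a finite or partial
  cover leaves free.\<close>

locale gauge =
  fixes w :: "'g set \<Rightarrow> ennreal" and d :: "'g \<Rightarrow> 'g \<Rightarrow> real" and C :: "'g set set"
  assumes small: "0 < \<epsilon> \<Longrightarrow> \<exists>B\<in>C. ediam d B \<le> ennreal \<epsilon> \<and> w B \<le> ennreal \<epsilon>"
begin

text \<open>Indices outside \<open>I\<close> are filled with sets of total weight at most
  \<open>e\<close>, using the geometric series.\<close>

lemma cover_content_le: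
  assumes "\<delta> > 0" and B: "\<And>i. i \<in> I \<Longrightarrow> B i \<in> C" "\<And>i. i \<in> I \<Longrightarrow> ediam d (B i) \<le> ennreal \<delta>"
    and E: "E \<subseteq> (\<Union>i\<in>I. B i)"
  shows "cover_content w d C \<delta> E \<le> (\<Sum>i::nat. if i \<in> I then w (B i) else 0)"
proof (rule ennreal_le_epsilon)
  fix e :: real assume e: "0 < e"
  have "\<exists>R\<in>C. ediam d R \<le> ennreal \<delta> \<and> w R \<le> ennreal (e * (1/2) ^ Suc i)" for i
  proof -
    have "0 < min \<delta> (e * (1/2) ^ Suc i)"
      using e \<open>\<delta> > 0\<close> by simp
    then show ?thesis
      using small by (meson ennreal_leI min.cobounded1 min.cobounded2 order_trans)
  qed
  then obtain R where R: "\<And>i. R i \<in> C" "\<And>i. ediam d (R i) \<le> ennreal \<delta>"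
    "\<And>i. w (R i) \<le> ennreal (e * (1/2) ^ Suc i)"
    by metis
  let ?B = "\<lambda>i. if i \<in> I then B i else R i"
  have "E \<subseteq> (\<Union>i. ?B i)"
    using E by fastforce
  then have "cover_content w d C \<delta> E \<le> (\<Sum>i. w (?B i))"
    unfolding cover_content_def using B R by (intro INF_lower) auto
  also have "\<dots> \<le> (\<Sum>i. (if i \<in> I then w (B i) else 0) + ennreal (e * (1/2) ^ Suc i))"
  proof (intro suminf_le)
    show "w (?B i) \<le> (if i \<in> I then w (B i) else 0) + ennreal (e * (1/2) ^ Suc i)" for i
      using R(3)[of i] by (cases "i \<in> I") (simp_all del: power_Suc)
  qed auto
  also have "\<dots> = (\<Sum>i. if i \<in> I then w (B i) else 0) + ennreal e"
    using e by (intro suminf_ennreal_add_power_half) simp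
  finally show "cover_content w d C \<delta> E \<le> (\<Sum>i. if i \<in> I then w (B i) else 0) + ennreal e" .
qed

lemma cover_content_empty [simp]: "\<delta> > 0 \<Longrightarrow> cover_content w d C \<delta> {} = 0"
  using cover_content_le[of \<delta> "{}" "\<lambda>_. {}" "{}"] by simp

lemma gauge_measure_empty [simp]: "gauge_measure w d C {} = 0"
proof -
  have "gauge_measure w d C {} \<le> 0"
    unfolding gauge_measure_def by (intro SUP_least) simp
  then show ?thesis
    by simp
qed

lemma cover_content_UN:
  fixes A :: "nat \<Rightarrow> 'g set"
  assumes "\<delta> > 0"
  shows "cover_content w d C \<delta> (\<Union>n. A n) \<le> (\<Sum>n. cover_content w d C \<delta> (A n))"
proof (rule ennreal_le_epsilon)
  fix e :: real
  assume e: "0 < e" and "(\<Sum>n. cover_content w d C \<delta> (A n)) < top_class.top"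
  then have fin: "(\<Sum>n. cover_content w d C \<delta> (A n)) < \<infinity>"
    by simp
  have "\<exists>B. (\<forall>i. B i \<in> C \<and> ediam d (B i) \<le> ennreal \<delta>) \<and> A n \<subseteq> (\<Union>i. B i) \<and>
      (\<Sum>i. w (B i)) \<le> cover_content w d C \<delta> (A n) + ennreal (e * (1/2) ^ Suc n)" for n
  proof -
    have "cover_content w d C \<delta> (A n) < \<infinity>"
      using fin by (metis ennreal_suminf_lessD)
    moreover have "0 < ennreal (e * (1/2) ^ Suc n)"
      using e by simp
    ultimately have "cover_content w d C \<delta> (A n)
        < cover_content w d C \<delta> (A n) + ennreal (e * (1/2) ^ Suc n)"
      by (metis add.right_neutral ennreal_add_left_cancel_less infinity_ennreal_def less_irrefl)
    then show ?thesis
      unfolding cover_content_def by (subst (asm) INF_less_iff) (auto intro: less_imp_le)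
  qed
  then obtain B where B: "\<And>n i. B n i \<in> C" "\<And>n i. ediam d (B n i) \<le> ennreal \<delta>"
    "\<And>n. A n \<subseteq> (\<Union>i. B n i)"
    "\<And>n. (\<Sum>i. w (B n i)) \<le> cover_content w d C \<delta> (A n) + ennreal (e * (1/2) ^ Suc n)"
    by metis
  define BB where "BB = (\<lambda>k. B (fst (prod_decode k)) (snd (prod_decode k)))"
  have "(\<Union>n. A n) \<subseteq> (\<Union>i. BB i)"
  proof
    fix x assume "x \<in> (\<Union>n. A n)"
    then obtain n i where "x \<in> B n i"
      using B(3) by blast
    then have "x \<in> BB (prod_encode (n, i))"
      by (simp add: BB_def)
    then show "x \<in> (\<Union>i. BB i)"
      by blast
  qed
  moreover have "BB k \<in> C" "ediam d (BB k) \<le> ennreal \<delta>" for k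
    by (simp_all add: BB_def B(1,2))
  ultimately have "cover_content w d C \<delta> (\<Union>n. A n) \<le> (\<Sum>i. w (BB i))"
    unfolding cover_content_def by (intro INF_lower) blast
  also have "\<dots> = (\<Sum>n. \<Sum>i. w (B n i))"
  proof -
    have "(\<Sum>i. (\<lambda>(n, i). w (B n i)) (prod_decode i)) = (\<Sum>n. \<Sum>i. w (B n i))"
      by (rule suminf_ennreal_2dimen) simp
    moreover have "w (BB i) = (\<lambda>(n, i). w (B n i)) (prod_decode i)" for i
      by (simp add: BB_def case_prod_unfold)
    ultimately show ?thesis
      by simp
  qed
  also have "\<dots> \<le> (\<Sum>n. cover_content w d C \<delta> (A n) + ennreal (e * (1/2) ^ Suc n))"
    by (intro suminf_le B(4) summableI)
  also have "\<dots> = (\<Sum>n. cover_content w d C \<delta> (A n)) + ennreal e"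
    using e by (intro suminf_ennreal_add_power_half) simp
  finally show "cover_content w d C \<delta> (\<Union>n. A n) \<le> (\<Sum>n. cover_content w d C \<delta> (A n)) + ennreal e" .
qed

lemma gauge_measure_UN:
  fixes A :: "nat \<Rightarrow> 'g set"
  shows "gauge_measure w d C (\<Union>n. A n) \<le> (\<Sum>n. gauge_measure w d C (A n))"
  unfolding gauge_measure_def[of _ _ _ "\<Union>n. A n"]
proof (rule SUP_least)
  fix \<delta> :: real assume "\<delta> \<in> {0<..}"
  then show "cover_content w d C \<delta> (\<Union>n. A n) \<le> (\<Sum>n. gauge_measure w d C (A n))"
    by (intro order_trans[OF cover_content_UN] suminf_le cover_content_le_gauge_measure) auto
qed

lemma outer_measure_space_gauge: "outer_measure_space UNIV (gauge_measure w d C)"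
proof -
  have "outer_measure_space (Pow UNIV) (gauge_measure w d C)"
    unfolding outer_measure_space_def positive_def increasing_def countably_subadditive_def
    using gauge_measure_UN by (auto intro: gauge_measure_mono)
  then show ?thesis
    by simp
qed

lemma gauge_measure_Un:
  "gauge_measure w d C (A \<union> B) \<le> gauge_measure w d C A + gauge_measure w d C B"
proof -
  have "gauge_measure w d C (\<Union>n. if n = 0 then A else if n = Suc 0 then B else {})
      \<le> (\<Sum>n. gauge_measure w d C (if n = 0 then A else if n = Suc 0 then B else {}))"
    by (rule gauge_measure_UN)
  also have "\<dots> = (\<Sum>n\<in>{0, Suc 0}. gauge_measure w d C (if n = 0 then A else if n = Suc 0 then B else {}))"
    by (intro suminf_finite) auto
  also have "(\<Union>n. if n = 0 then A else if n = Suc 0 then B else {}) = A \<union> B"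
    by (auto split: if_splits)
  finally show ?thesis
    by simp
qed

text \<open>A covering set of diameter below \<open>\<eta>\<close> cannot meet both \<open>A\<close>
  and \<open>B\<close>, so at such scales a cover of the union splits into two families without
  common members.\<close>

lemma gauge_measure_separated:
  assumes \<eta>: "\<eta> > 0" and sep: "\<And>x y. x \<in> A \<Longrightarrow> y \<in> B \<Longrightarrow> \<eta> \<le> d x y"
  shows "gauge_measure w d C A + gauge_measure w d C B \<le> gauge_measure w d C (A \<union> B)"
proof -
  have 1: "cover_content w d C \<delta> A + cover_content w d C \<delta> B \<le> cover_content w d C \<delta> (A \<union> B)"
    if \<delta>: "0 < \<delta>" "\<delta> < \<eta>" for \<delta>
    unfolding cover_content_def[of _ _ _ _ "A \<union> B"]
  proof (rule INF_greatest)
    fix U assume "U \<in> {U::nat \<Rightarrow> 'g set. (\<forall>i. U i \<in> C \<and> ediam d (U i) \<le> ennreal \<delta>) \<and> A \<union> B \<subseteq> (\<Union>i. U i)}"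
    then have U: "\<And>i. U i \<in> C" "\<And>i. ediam d (U i) \<le> ennreal \<delta>" "A \<union> B \<subseteq> (\<Union>i. U i)"
      by auto
    have disj: "A \<inter> U i = {} \<or> B \<inter> U i = {}" for i
    proof (rule ccontr)
      assume "\<not> ?thesis"
      then obtain x y where xy: "x \<in> A" "x \<in> U i" "y \<in> B" "y \<in> U i"
        by blast
      have "ennreal (d x y) \<le> ennreal \<delta>"
        using ediam_ge[of x "U i" y d] U(2) xy by (meson order_trans)
      then show False
        using sep[of x y] xy \<delta> by simp
    qed
    let ?I = "{i. A \<inter> U i \<noteq> {}}" and ?J = "{i. B \<inter> U i \<noteq> {}}"
    have "cover_content w d C \<delta> A + cover_content w d C \<delta> B
        \<le> (\<Sum>i. if i \<in> ?I then w (U i) else 0) + (\<Sum>i. if i \<in> ?J then w (U i) else 0)"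
      using U \<delta> by (intro add_mono cover_content_le) blast+
    also have "\<dots> = (\<Sum>i. (if i \<in> ?I then w (U i) else 0) + (if i \<in> ?J then w (U i) else 0))"
      by (rule suminf_add) auto
    also have "\<dots> \<le> (\<Sum>i. w (U i))"
      using disj by (intro suminf_le) auto
    finally show "cover_content w d C \<delta> A + cover_content w d C \<delta> B \<le> (\<Sum>i. w (U i))" .
  qed
  \<comment> \<open>The two suprema run over independent scales; a common smaller scale below
    \<open>\<eta>\<close> dominates both.\<close>
  have 2: "cover_content w d C \<delta> A + cover_content w d C \<delta>' B \<le> gauge_measure w d C (A \<union> B)"
    if "\<delta> \<in> {0<..}" "\<delta>' \<in> {0<..}" for \<delta> \<delta>'
  proof -
    define e where "e = min \<delta> (min \<delta>' (\<eta> / 2))"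
    have e: "0 < e" "e < \<eta>" "e \<le> \<delta>" "e \<le> \<delta>'"
      using that \<eta> by (auto simp: e_def)
    have "cover_content w d C \<delta> A + cover_content w d C \<delta>' B
        \<le> cover_content w d C e A + cover_content w d C e B"
      using e by (intro add_mono cover_content_antimono)
    also have "\<dots> \<le> gauge_measure w d C (A \<union> B)"
      using 1[OF e(1,2)] cover_content_le_gauge_measure[OF e(1), of w d C "A \<union> B"] by simp
    finally show ?thesis .
  qed
  have ne: "{0<..} \<noteq> ({} :: real set)"
    by auto
  have "gauge_measure w d C A + cover_content w d C \<delta>' B \<le> gauge_measure w d C (A \<union> B)"
    if "\<delta>' \<in> {0<..}" for \<delta>'
    unfolding gauge_measure_def[of _ _ _ A]
    by (subst ennreal_SUP_add_left[OF ne, symmetric]) (intro SUP_least 2 that)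
  then show ?thesis
    unfolding gauge_measure_def[of _ _ _ B]
    by (subst add.commute, subst ennreal_SUP_add_left[OF ne, symmetric])
       (intro SUP_least, simp add: add.commute)
qed

text \<open>
  Caratheodory's criterion for metric outer measures: the part of \<open>E\<close> where \<open>a < g\<close> is exhausted by
  the sets where \<open>a + 1 / (k + 1) \<le> g\<close>, and the layers between consecutive ones have summable
  measures, since every second layer is separated from the others.
\<close>

lemma lambda_system_sublevel:
  assumes lip: "\<And>x y. g y - g x \<le> d x y"
  shows "{x. g x \<le> a} \<in> lambda_system UNIV UNIV (gauge_measure w d C)"
proof -
  let ?m = "gauge_measure w d C"
  let ?a = "\<lambda>k::nat. a + 1 / real (Suc k)"
  have "?m (E \<inter> {x. g x \<le> a}) + ?m (E - {x. g x \<le> a}) \<le> ?m E" if fin: "?m E < \<infinity>" for E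
  proof (rule ennreal_le_epsilon)
    fix e :: real assume e: "0 < e"
    define D where "D k = {x \<in> E. ?a k \<le> g x}" for k
    define R where "R k = {x \<in> E. ?a (Suc k) \<le> g x \<and> g x < ?a k}" for k
    have aa: "?a (Suc k) < ?a k" "a < ?a k" for k
      by (auto simp: field_simps)
    have adec: "?a j \<le> ?a k" if "k \<le> j" for j k
      using that by (auto simp: field_simps)
    have sep: "?m A + ?m B \<le> ?m (A \<union> B)"
      if "u < v" "\<And>x. x \<in> A \<Longrightarrow> g x \<le> u" "\<And>x. x \<in> B \<Longrightarrow> v \<le> g x" for A B u v
      using that lip by (intro gauge_measure_separated[of "v - u"]) (auto, smt (verit, best))
    \<comment> \<open>The skipped layer between \<open>?a (2 * n + i)\<close> and
      \<open>?a (2 * k + i + 1)\<close> keeps the new layer away from all earlier ones of the same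
      parity.\<close>
    have alt: "(\<Sum>j<n. ?m (R (2 * j + i))) \<le> ?m E" for n i
    proof -
      have "(\<Sum>j<n. ?m (R (2 * j + i))) \<le> ?m (\<Union>j<n. R (2 * j + i))"
      proof (induction n)
        case (Suc n)
        have "(\<Sum>j<Suc n. ?m (R (2 * j + i))) \<le> ?m (R (2 * n + i)) + ?m (\<Union>j<n. R (2 * j + i))"
          using Suc by (simp add: add.commute add_left_mono)
        also have "\<dots> \<le> ?m (R (2 * n + i) \<union> (\<Union>j<n. R (2 * j + i)))"
        proof (cases "n = 0")
          case False
          then obtain k where k: "n = Suc k"
            by (cases n) auto
          show ?thesis
          proof (rule sep[of "?a (2 * n + i)" "?a (2 * k + i + 1)"])
            show "?a (2 * n + i) < ?a (2 * k + i + 1)"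
              using aa(1)[of "2 * k + i + 1"] by (simp add: k)
            fix x assume "x \<in> (\<Union>j<n. R (2 * j + i))"
            then obtain j where "j < Suc k" "x \<in> R (2 * j + i)"
              unfolding k by blast
            then have "j \<le> k" "?a (Suc (2 * j + i)) \<le> g x"
              unfolding R_def by simp_all
            moreover from this have "?a (2 * k + i + 1) \<le> ?a (Suc (2 * j + i))"
              by (intro adec) auto
            ultimately show "?a (2 * k + i + 1) \<le> g x"
              by linarith
          qed (auto simp: R_def)
        qed simp
        also have "\<dots> = ?m (\<Union>j<Suc n. R (2 * j + i))"
          by (simp add: lessThan_Suc)
        finally show ?case .
      qed simp
      also have "\<dots> \<le> ?m E"
        by (intro gauge_measure_mono) (auto simp: R_def)
      finally show ?thesis .
    qed
    have "(\<Sum>j<2 * n. ?m (R j)) = (\<Sum>j<n. ?m (R (2 * j + 0))) + (\<Sum>j<n. ?m (R (2 * j + 1)))" for n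
      by (induction n) (simp_all add: ac_simps)
    then have part: "(\<Sum>j<2 * n. ?m (R j)) \<le> ?m E + ?m E" for n
      using alt[of 0 n] alt[of 1 n] by (simp add: add_mono)
    have "(\<Sum>j. ?m (R j)) \<le> ?m E + ?m E"
    proof (rule suminf_le_const)
      fix n
      have "(\<Sum>j<n. ?m (R j)) \<le> (\<Sum>j<2 * n. ?m (R j))"
        by (intro sum_mono2) auto
      then show "(\<Sum>j<n. ?m (R j)) \<le> ?m E + ?m E"
        using part[of n] by simp
    qed simp
    then have sfin: "(\<Sum>j. ?m (R j)) < \<infinity>"
      using fin by (simp add: le_less_trans)
    then have "?m (R j) < \<infinity>" for j
      by (metis ennreal_suminf_lessD)
    then have r: "?m (R j) = ennreal (enn2real (?m (R j)))" for j
      by simp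
    have "summable (\<lambda>j. enn2real (?m (R j)))"
      using sfin by (intro summable_suminf_not_top) (auto simp flip: r)
    then obtain k where k: "norm (\<Sum>j. enn2real (?m (R (j + k)))) < e"
      using suminf_exist_split[OF e] by blast
    have "(\<Sum>j. ?m (R (j + k))) = ennreal (\<Sum>j. enn2real (?m (R (j + k))))"
      using \<open>summable _\<close> by (subst r, intro suminf_ennreal2) (auto intro: summable_ignore_initial_segment)
    then have tail: "(\<Sum>j. ?m (R (j + k))) \<le> ennreal e"
      using k by (auto intro: ennreal_leI)
    have "E - {x. g x \<le> a} \<subseteq> D k \<union> (\<Union>j. R (j + k))"
    proof
      fix x assume x: "x \<in> E - {x. g x \<le> a}"
      then obtain n where n: "1 / real (Suc n) < g x - a"
        using nat_approx_posE[of "g x - a"] by auto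
      show "x \<in> D k \<union> (\<Union>j. R (j + k))"
      proof (cases "?a k \<le> g x")
        case False
        \<comment> \<open>The first threshold that \<open>g x\<close> reaches; then \<open>x\<close>
          lies in the layer with index \<open>j - 1\<close>, and \<open>k < j\<close> puts this
          layer into the tail.\<close>
        define j where "j = (LEAST j. ?a j \<le> g x)"
        have "?a n \<le> g x"
          using n by linarith
        then have j: "?a j \<le> g x"
          unfolding j_def by (rule LeastI)
        have "k < j"
          using False j adec[of j k] by linarith
        moreover have "\<not> ?a (j - 1) \<le> g x"
          using \<open>k < j\<close> unfolding j_def by (intro not_less_Least) linarith
        moreover have "Suc (j - 1) = j" "(j - 1 - k) + k = j - 1"
          using \<open>k < j\<close> by simp_all
        ultimately have "x \<in> R ((j - 1 - k) + k)"
          unfolding R_def using j x by auto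
        then show ?thesis
          by blast
      qed (use x in \<open>auto simp: D_def\<close>)
    qed
    then have "?m (E - {x. g x \<le> a}) \<le> ?m (D k \<union> (\<Union>j. R (j + k)))"
      by (rule gauge_measure_mono)
    also have "\<dots> \<le> ?m (D k) + (\<Sum>j. ?m (R (j + k)))"
      by (intro order_trans[OF gauge_measure_Un] add_mono order_refl gauge_measure_UN)
    also have "\<dots> \<le> ?m (D k) + ennreal e"
      by (intro add_mono order_refl tail)
    finally have "?m (E \<inter> {x. g x \<le> a}) + ?m (E - {x. g x \<le> a})
        \<le> (?m (E \<inter> {x. g x \<le> a}) + ?m (D k)) + ennreal e"
      by (simp add: add.assoc add_left_mono)
    also have "?m (E \<inter> {x. g x \<le> a}) + ?m (D k) \<le> ?m ((E \<inter> {x. g x \<le> a}) \<union> D k)"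
      using aa(2)[of k] by (intro sep[of a "?a k"]) (auto simp: D_def)
    also have "\<dots> \<le> ?m E"
      by (intro gauge_measure_mono) (auto simp: D_def)
    finally show "?m (E \<inter> {x. g x \<le> a}) + ?m (E - {x. g x \<le> a}) \<le> ?m E + ennreal e"
      by (simp add: add_right_mono)
  qed
  then have "?m (E \<inter> {x. g x \<le> a}) + ?m (E - {x. g x \<le> a}) \<le> ?m E" for E
    by (cases "?m E = \<infinity>") (auto simp: less_top)
  moreover have "?m E \<le> ?m (E \<inter> {x. g x \<le> a}) + ?m (E - {x. g x \<le> a})" for E
    using gauge_measure_Un[of "E \<inter> {x. g x \<le> a}" "E - {x. g x \<le> a}"] by (simp add: Int_Diff_Un)
  ultimately show ?thesis
    unfolding lambda_system_def by (auto intro!: antisym simp: Int_commute Diff_eq)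
qed

end

text \<open>Superlevel sets of functions that are 1-Lipschitz for \<open>d\<close> are Caratheodory
  measurable, hence so is the sigma-algebra they generate. Measurability of the sets
  \<open>A i\<close> is tested against the arbitrary set \<open>S\<close>, which yields additivity
  of the restriction to \<open>S\<close>.\<close>

lemma (in gauge) measure_space_gauge_restrict:
  fixes S :: "'g set"
  assumes sub: "\<And>U. U \<in> \<U> \<Longrightarrow> \<exists>g a. (\<forall>x y. g y - g x \<le> d x y) \<and> U = {x. g x > (a::real)}"
  shows "measure_space UNIV (sigma_sets UNIV \<U>) (\<lambda>A. gauge_measure w d C (A \<inter> S))"
proof -
  let ?m = "gauge_measure w d C" and ?L = "lambda_system UNIV UNIV (gauge_measure w d C)"
  interpret U: sigma_algebra UNIV "UNIV :: 'g set set"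
    using sigma_algebra_Pow[of "UNIV :: 'g set"] by simp
  have oms: "outer_measure_space UNIV ?m"
    by (rule outer_measure_space_gauge)
  have pos: "positive UNIV ?m"
    using oms by (simp add: outer_measure_space_def)
  have "measure_space UNIV ?L ?m"
    using U.caratheodory_lemma[OF oms] by simp
  then interpret L: sigma_algebra UNIV ?L
    by (simp add: measure_space_def)
  have "\<U> \<subseteq> ?L"
  proof
    fix U assume "U \<in> \<U>"
    then obtain g and a :: real where g: "\<And>x y. g y - g x \<le> d x y" "U = {x. g x > a}"
      using sub by blast
    have "UNIV - {x. g x \<le> a} \<in> ?L"
      using lambda_system_sublevel[OF g(1)] by (rule L.compl_sets)
    also have "UNIV - {x. g x \<le> a} = U"
      using g(2) by auto
    finally show "U \<in> ?L" .
  qed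
  then have sub: "sigma_sets UNIV \<U> \<subseteq> ?L"
    by (rule L.sigma_sets_subset)
  have "countably_additive (sigma_sets UNIV \<U>) (\<lambda>A. ?m (A \<inter> S))"
  proof (rule countably_additiveI)
    fix A :: "nat \<Rightarrow> 'g set"
    assume A: "range A \<subseteq> sigma_sets UNIV \<U>" and disj: "disjoint_family A"
    show "(\<Sum>i. ?m (A i \<inter> S)) = ?m ((\<Union>i. A i) \<inter> S)"
    proof (rule antisym)
      have "?m ((\<Union>i. A i) \<inter> S) = ?m (\<Union>i. A i \<inter> S)"
        by (rule arg_cong[of _ _ ?m]) auto
      then show "?m ((\<Union>i. A i) \<inter> S) \<le> (\<Sum>i. ?m (A i \<inter> S))"
        using gauge_measure_UN[of "\<lambda>i. A i \<inter> S"] by simp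
      show "(\<Sum>i. ?m (A i \<inter> S)) \<le> ?m ((\<Union>i. A i) \<inter> S)"
      proof (rule suminf_le_const)
        fix n
        have "(\<Sum>i=0..<n. ?m (S \<inter> A i)) = ?m (S \<inter> (\<Union>i\<in>{0..<n}. A i))"
          using A sub disj by (intro U.lambda_system_strong_sum pos) auto
        also have "\<dots> \<le> ?m ((\<Union>i. A i) \<inter> S)"
          by (intro gauge_measure_mono) auto
        finally show "(\<Sum>i<n. ?m (A i \<inter> S)) \<le> ?m ((\<Union>i. A i) \<inter> S)"
          by (simp add: Int_commute lessThan_atLeast0)
      qed simp
    qed
  qed
  then show ?thesis
    unfolding measure_space_def positive_def by (auto intro: sigma_algebra_sigma_sets)
qed

section \<open>The Carnot--Caratheodory distance\<close>

lemma has_integral_affine_interval: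
  fixes f :: "real \<Rightarrow> 'c::real_normed_vector"
  assumes f: "(f has_integral I) {a..b}" and m: "m > 0" and ab: "a = m * s + c" "b = m * t + c"
  shows "((\<lambda>x. m *\<^sub>R f (m * x + c)) has_integral I) {s..t}"
proof -
  have "((\<lambda>x. f (m *\<^sub>R x + c)) has_integral (I /\<^sub>R m ^ DIM(real))) (cbox ((a - c) /\<^sub>R m) ((b - c) /\<^sub>R m))"
    using f m by (intro has_integral_affinity') auto
  moreover have "(a - c) /\<^sub>R m = s" "(b - c) /\<^sub>R m = t"
    using m by (simp_all add: ab)
  ultimately have "((\<lambda>x. f (m * x + c)) has_integral (I /\<^sub>R m)) {s..t}"
    by simp
  then have "((\<lambda>x. m *\<^sub>R f (m * x + c)) has_integral (m *\<^sub>R (I /\<^sub>R m))) {s..t}"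
    by (rule has_integral_cmul)
  moreover have "m *\<^sub>R (I /\<^sub>R m) = I"
    using m by simp
  ultimately show ?thesis
    by simp
qed

section \<open>Calculus of horizontal curves\<close>

context step_two_group
begin

definition horizontal_velocity :: "(real \<Rightarrow> 'a \<times> 'b) \<Rightarrow> (real \<Rightarrow> 'a) \<Rightarrow> real \<Rightarrow> 'a \<times> 'b" where
  "horizontal_velocity \<gamma> u r = (u r, (1/2) *\<^sub>R br (fst (\<gamma> r)) (u r))"

text \<open>A horizontal curve of length exactly \<open>L\<close>. The velocity is integrated over
  every interval from \<open>s\<close> to \<open>t\<close>, not only from 0, so that reversed,
  rescaled and concatenated curves can be checked piece by piece.\<close>

definition connected_by :: "'a \<times> 'b \<Rightarrow> 'a \<times> 'b \<Rightarrow> real \<Rightarrow> bool" where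
  "connected_by p q L \<longleftrightarrow> (\<exists>\<gamma> u. \<gamma> 0 = p \<and> \<gamma> 1 = q \<and> ((\<lambda>r. norm (u r)) has_integral L) {0..1} \<and>
     (\<forall>s t. 0 \<le> s \<longrightarrow> s \<le> t \<longrightarrow> t \<le> 1 \<longrightarrow>
        (horizontal_velocity \<gamma> u has_integral (\<gamma> t - \<gamma> s)) {s..t}))"

lemma connected_byI:
  assumes "\<gamma> 0 = p" "\<gamma> 1 = q" "((\<lambda>r. norm (u r)) has_integral L) {0..1}"
    and "\<And>s t. 0 \<le> s \<Longrightarrow> s \<le> t \<Longrightarrow> t \<le> 1 \<Longrightarrow>
        (horizontal_velocity \<gamma> u has_integral (\<gamma> t - \<gamma> s)) {s..t}"
  shows "connected_by p q L"
  unfolding connected_by_def by (intro exI[of _ \<gamma>] exI[of _ u] conjI allI impI assms)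

lemma connected_byE:
  assumes "connected_by p q L"
  obtains \<gamma> u where "\<gamma> 0 = p" "\<gamma> 1 = q" "((\<lambda>r. norm (u r)) has_integral L) {0..1}"
    "\<And>s t. 0 \<le> s \<Longrightarrow> s \<le> t \<Longrightarrow> t \<le> 1 \<Longrightarrow>
        (horizontal_velocity \<gamma> u has_integral (\<gamma> t - \<gamma> s)) {s..t}"
  using assms unfolding connected_by_def by blast

lemma horizontal_velocity_fst:
  assumes "(horizontal_velocity \<gamma> u has_integral v) S"
  shows "(u has_integral fst v) S"
  using has_integral_linear[OF assms bounded_linear_fst]
  by (simp add: o_def horizontal_velocity_def)

lemma horizontal_velocity_snd:
  assumes "(horizontal_velocity \<gamma> u has_integral v) S"
  shows "((\<lambda>r. (1/2) *\<^sub>R br (fst (\<gamma> r)) (u r)) has_integral snd v) S"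
  using has_integral_linear[OF assms bounded_linear_snd]
  by (simp add: o_def horizontal_velocity_def)

lemma horizontal_curve_velocity:
  "horizontal_curve br \<gamma> u \<longleftrightarrow> u absolutely_integrable_on {0..1} \<and>
     (\<forall>s\<in>{0..1}. (horizontal_velocity \<gamma> u has_integral (\<gamma> s - \<gamma> 0)) {0..s})"
  unfolding horizontal_curve_def horizontal_velocity_def[abs_def] ..

text \<open>Forwards, the integral over a subinterval exists and additivity identifies its value.
  Backwards, \<open>u\<close> is integrable as the first component of the velocity, and absolutely
  so because its norm is integrable.\<close>

lemma horizontal_curve_iff:
  "horizontal_curve br \<gamma> u \<longleftrightarrow> (\<lambda>r. norm (u r)) integrable_on {0..1} \<and>
     (\<forall>s t. 0 \<le> s \<longrightarrow> s \<le> t \<longrightarrow> t \<le> 1 \<longrightarrow>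
        (horizontal_velocity \<gamma> u has_integral (\<gamma> t - \<gamma> s)) {s..t})"
  (is "?l \<longleftrightarrow> ?r")
proof
  assume l: ?l
  then have "\<forall>s\<in>{0..1}. (horizontal_velocity \<gamma> u has_integral (\<gamma> s - \<gamma> 0)) {0..s}"
    unfolding horizontal_curve_velocity by (rule conjunct2)
  then have i: "(horizontal_velocity \<gamma> u has_integral (\<gamma> s - \<gamma> 0)) {0..s}" if "0 \<le> s" "s \<le> 1" for s
    by (rule bspec) (use that in simp)
  have "(horizontal_velocity \<gamma> u has_integral (\<gamma> t - \<gamma> s)) {s..t}" if st: "0 \<le> s" "s \<le> t" "t \<le> 1" for s t
  proof -
    have s: "(horizontal_velocity \<gamma> u has_integral (\<gamma> s - \<gamma> 0)) {0..s}"
      and t: "(horizontal_velocity \<gamma> u has_integral (\<gamma> t - \<gamma> 0)) {0..t}"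
      by (rule i; use st in linarith)+
    have "{s..t} \<subseteq> {0..t}"
      using st by simp
    then have "horizontal_velocity \<gamma> u integrable_on {s..t}"
      by (rule integrable_on_subinterval[OF has_integral_integrable[OF t]])
    then obtain J where J: "(horizontal_velocity \<gamma> u has_integral J) {s..t}"
      unfolding integrable_on_def ..
    have "\<gamma> t - \<gamma> 0 = (\<gamma> s - \<gamma> 0) + J"
      by (rule has_integral_unique[OF t has_integral_combine[OF st(1,2) s J]])
    then have "J = \<gamma> t - \<gamma> s"
      by (simp only: diff_add_eq) (simp add: algebra_simps)
    with J show ?thesis
      by (simp only:)
  qed
  then show ?r
    using l unfolding horizontal_curve_velocity absolutely_integrable_on_def by (intro conjI allI impI) blast+
next
  assume r: ?r
  then have "(horizontal_velocity \<gamma> u has_integral (\<gamma> 1 - \<gamma> 0)) {0..1}"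
    by simp
  then have "u integrable_on {0..1}"
    using horizontal_velocity_fst by blast
  then have "u absolutely_integrable_on {0..1}"
    using r unfolding absolutely_integrable_on_def by blast
  moreover have "(horizontal_velocity \<gamma> u has_integral (\<gamma> s - \<gamma> 0)) {0..s}" if "s \<in> {0..1}" for s
    using r that by auto
  ultimately show ?l
    unfolding horizontal_curve_velocity by blast
qed

lemma cc_dist_eq: "cc_dist br p q = Inf {L. connected_by p q L}"
proof -
  have "connected_by p q L \<longleftrightarrow> (\<exists>\<gamma> u. L = integral {0..1} (\<lambda>s. norm (u s)) \<and>
      (horizontal_curve br \<gamma> u \<and> \<gamma> 0 = p \<and> \<gamma> 1 = q))" for L
    unfolding connected_by_def horizontal_curve_iff has_integral_iff[of "\<lambda>r. norm (_ r)"]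
    by (intro iff_exI) blast
  then show ?thesis
    unfolding cc_dist_def by (simp only:)
qed

lemma connected_by_nonneg: "connected_by p q L \<Longrightarrow> 0 \<le> L"
  by (elim connected_byE, rule has_integral_nonneg) auto

lemma connected_by_translate:
  assumes "connected_by p q L"
  shows "connected_by (g \<star> p) (g \<star> q) L"
proof -
  obtain \<gamma> u where \<gamma>: "\<gamma> 0 = p" "\<gamma> 1 = q" "((\<lambda>r. norm (u r)) has_integral L) {0..1}"
    "\<And>s t. 0 \<le> s \<Longrightarrow> s \<le> t \<Longrightarrow> t \<le> 1 \<Longrightarrow>
        (horizontal_velocity \<gamma> u has_integral (\<gamma> t - \<gamma> s)) {s..t}"
    using connected_byE[OF assms] by blast
  \<comment> \<open>The differential of left translation by \<open>g\<close>. It is a linear map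
    that does not depend on the base point, and it carries horizontal velocities along
    \<open>\<gamma>\<close> to those along the translated curve.\<close>
  let ?T = "\<lambda>v::'a \<times> 'b. (fst v, snd v + (1/2) *\<^sub>R br (fst g) (fst v))"
  have T: "bounded_linear ?T"
    by (intro bounded_linear_intros bounded_linear_compose[OF br.bounded_linear_right])
  show ?thesis
  proof (rule connected_byI[of "\<lambda>r. g \<star> \<gamma> r" _ _ u])
    fix s t :: real assume "0 \<le> s" "s \<le> t" "t \<le> 1"
    then have "((?T \<circ> horizontal_velocity \<gamma> u) has_integral ?T (\<gamma> t - \<gamma> s)) {s..t}"
      by (intro has_integral_linear[OF _ T] \<gamma>)
    moreover have "?T \<circ> horizontal_velocity \<gamma> u = horizontal_velocity (\<lambda>r. g \<star> \<gamma> r) u"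
      by (auto simp: fun_eq_iff horizontal_velocity_def br.add_left algebra_simps)
    moreover have "?T (\<gamma> t - \<gamma> s) = g \<star> \<gamma> t - g \<star> \<gamma> s"
      by (simp add: gmult_def br.diff_right algebra_simps)
    ultimately show "(horizontal_velocity (\<lambda>r. g \<star> \<gamma> r) u has_integral (g \<star> \<gamma> t - g \<star> \<gamma> s)) {s..t}"
      by simp
  qed (use \<gamma> in auto)
qed

lemma connected_by_dilation:
  assumes "connected_by p q L" "l > 0"
  shows "connected_by (dilation l p) (dilation l q) (l * L)"
proof -
  obtain \<gamma> u where \<gamma>: "\<gamma> 0 = p" "\<gamma> 1 = q" "((\<lambda>r. norm (u r)) has_integral L) {0..1}"
    "\<And>s t. 0 \<le> s \<Longrightarrow> s \<le> t \<Longrightarrow> t \<le> 1 \<Longrightarrow>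
        (horizontal_velocity \<gamma> u has_integral (\<gamma> t - \<gamma> s)) {s..t}"
    using connected_byE[OF assms(1)] by blast
  have T: "bounded_linear (dilation l :: 'a \<times> 'b \<Rightarrow> 'a \<times> 'b)"
    unfolding dilation_def[abs_def] by (intro bounded_linear_intros)
  show ?thesis
  proof (rule connected_byI[of "\<lambda>r. dilation l (\<gamma> r)" _ _ "\<lambda>r. l *\<^sub>R u r"])
    fix s t :: real assume "0 \<le> s" "s \<le> t" "t \<le> 1"
    then have "((dilation l \<circ> horizontal_velocity \<gamma> u) has_integral dilation l (\<gamma> t - \<gamma> s)) {s..t}"
      by (intro has_integral_linear[OF _ T] \<gamma>)
    moreover have "dilation l \<circ> horizontal_velocity \<gamma> u = horizontal_velocity (\<lambda>r. dilation l (\<gamma> r)) (\<lambda>r. l *\<^sub>R u r)"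
      by (auto simp: fun_eq_iff horizontal_velocity_def dilation_def br.scaleR_left br.scaleR_right power2_eq_square)
    moreover have "dilation l (\<gamma> t - \<gamma> s) = dilation l (\<gamma> t) - dilation l (\<gamma> s)"
      by (simp add: dilation_def algebra_simps)
    ultimately show "(horizontal_velocity (\<lambda>r. dilation l (\<gamma> r)) (\<lambda>r. l *\<^sub>R u r) has_integral
        (dilation l (\<gamma> t) - dilation l (\<gamma> s))) {s..t}"
      by simp
  next
    show "((\<lambda>r. norm (l *\<^sub>R u r)) has_integral l * L) {0..1}"
      using has_integral_mult_right[OF \<gamma>(3), of l] assms(2) by simp
  qed (use \<gamma> in auto)
qed

lemma connected_by_sym:
  assumes "connected_by p q L"
  shows "connected_by q p L"
proof -
  obtain \<gamma> u where \<gamma>: "\<gamma> 0 = p" "\<gamma> 1 = q" "((\<lambda>r. norm (u r)) has_integral L) {0..1}"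
    "\<And>s t. 0 \<le> s \<Longrightarrow> s \<le> t \<Longrightarrow> t \<le> 1 \<Longrightarrow>
        (horizontal_velocity \<gamma> u has_integral (\<gamma> t - \<gamma> s)) {s..t}"
    using connected_byE[OF assms] by blast
  have refl: "((\<lambda>r. f (1 - r)) has_integral I) {s..t}"
    if "(f has_integral I) {1 - t..1 - s}" for f :: "real \<Rightarrow> 'c::real_normed_vector" and I s t
  proof -
    have "((\<lambda>x. 1 *\<^sub>R f (1 * x + 1)) has_integral I) {-t..-s}"
      using that by (rule has_integral_affine_interval) auto
    then have "((\<lambda>x. (\<lambda>x. f (x + 1)) (- x)) has_integral I) {s..t}"
      using has_integral_reflect_real[of "\<lambda>x. f (x + 1)" I "- s" "- t"] by simp
    then show ?thesis
      by simp
  qed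
  show ?thesis
  proof (rule connected_byI[of "\<lambda>r. \<gamma> (1 - r)" _ _ "\<lambda>r. - u (1 - r)"])
    show "((\<lambda>r. norm (- u (1 - r))) has_integral L) {0..1}"
      using refl[of "\<lambda>r. norm (u r)" L 1 0] \<gamma>(3) by simp
    fix s t :: real assume st: "0 \<le> s" "s \<le> t" "t \<le> 1"
    then have "((\<lambda>r. horizontal_velocity \<gamma> u (1 - r)) has_integral (\<gamma> (1 - s) - \<gamma> (1 - t))) {s..t}"
      by (intro refl \<gamma>) auto
    then have "((\<lambda>r. - horizontal_velocity \<gamma> u (1 - r)) has_integral - (\<gamma> (1 - s) - \<gamma> (1 - t))) {s..t}"
      by (rule has_integral_neg)
    moreover have "- horizontal_velocity \<gamma> u (1 - r)
        = horizontal_velocity (\<lambda>r. \<gamma> (1 - r)) (\<lambda>r. - u (1 - r)) r" for r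
      by (simp add: horizontal_velocity_def br.minus_right)
    ultimately show "(horizontal_velocity (\<lambda>r. \<gamma> (1 - r)) (\<lambda>r. - u (1 - r)) has_integral
        (\<gamma> (1 - t) - \<gamma> (1 - s))) {s..t}"
      by (simp only: minus_diff_eq)
  qed (use \<gamma> in auto)
qed

lemma connected_by_trans:
  assumes "connected_by p q L" "connected_by q z L'"
  shows "connected_by p z (L + L')"
proof -
  obtain \<gamma> u where \<gamma>: "\<gamma> 0 = p" "\<gamma> 1 = q" "((\<lambda>r. norm (u r)) has_integral L) {0..1}"
    "\<And>s t. 0 \<le> s \<Longrightarrow> s \<le> t \<Longrightarrow> t \<le> 1 \<Longrightarrow>
        (horizontal_velocity \<gamma> u has_integral (\<gamma> t - \<gamma> s)) {s..t}"
    using connected_byE[OF assms(1)] by blast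
  obtain \<eta> v where \<eta>: "\<eta> 0 = q" "\<eta> 1 = z" "((\<lambda>r. norm (v r)) has_integral L') {0..1}"
    "\<And>s t. 0 \<le> s \<Longrightarrow> s \<le> t \<Longrightarrow> t \<le> 1 \<Longrightarrow>
        (horizontal_velocity \<eta> v has_integral (\<eta> t - \<eta> s)) {s..t}"
    using connected_byE[OF assms(2)] by blast
  let ?\<gamma> = "\<lambda>r. if r \<le> 1/2 then \<gamma> (2 * r) else \<eta> (2 * r - 1)"
  let ?u = "\<lambda>r. if r \<le> 1/2 then 2 *\<^sub>R u (2 * r) else 2 *\<^sub>R v (2 * r - 1)"
  have lo: "(horizontal_velocity ?\<gamma> ?u has_integral (?\<gamma> t - ?\<gamma> s)) {s..t}"
    if "0 \<le> s" "s \<le> t" "t \<le> 1/2" for s t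
  proof -
    have "((\<lambda>r. 2 *\<^sub>R horizontal_velocity \<gamma> u (2 * r + 0)) has_integral (\<gamma> (2 * t) - \<gamma> (2 * s))) {s..t}"
      using that by (intro has_integral_affine_interval[OF \<gamma>(4)]) auto
    then show ?thesis
      using that by (subst has_integral_cong[where g = "\<lambda>r. 2 *\<^sub>R horizontal_velocity \<gamma> u (2 * r + 0)"])
        (auto simp: horizontal_velocity_def br.scaleR_right)
  qed
  have hi: "(horizontal_velocity ?\<gamma> ?u has_integral (?\<gamma> t - ?\<gamma> s)) {s..t}"
    if "1/2 \<le> s" "s \<le> t" "t \<le> 1" for s t
  proof -
    \<comment> \<open>At \<open>1/2\<close> both branches give the common endpoint
      \<open>q\<close>.\<close>
    have mid: "?\<gamma> r = \<eta> (2 * r - 1)" if "1/2 \<le> r" for r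
    proof (cases "r = 1/2")
      case True
      show ?thesis
        unfolding True using \<gamma>(2) \<eta>(1) by simp
    qed (use that in simp)
    have e: "?\<gamma> t - ?\<gamma> s = \<eta> (2 * t - 1) - \<eta> (2 * s - 1)"
      unfolding mid[OF that(1)] mid[OF order_trans[OF that(1,2)]] ..
    have i: "((\<lambda>r. 2 *\<^sub>R horizontal_velocity \<eta> v (2 * r + - 1)) has_integral (\<eta> (2 * t - 1) - \<eta> (2 * s - 1))) {s..t}"
      using that by (intro has_integral_affine_interval[OF \<eta>(4)]) auto
    \<comment> \<open>The formulas for the velocity can disagree only at \<open>1/2\<close>, and one
      point does not affect the integral.\<close>
    show ?thesis
      unfolding e
      by (rule has_integral_spike_finite[OF finite.insertI[OF finite.emptyI] _ i, of "1/2"])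
        (use that in \<open>simp add: horizontal_velocity_def br.scaleR_right\<close>)
  qed
  show ?thesis
  proof (rule connected_byI[of ?\<gamma> _ _ ?u])
    fix s t :: real assume st: "0 \<le> s" "s \<le> t" "t \<le> 1"
    consider "t \<le> 1/2" | "1/2 \<le> s" | "s \<le> 1/2" "1/2 \<le> t"
      by linarith
    then show "(horizontal_velocity ?\<gamma> ?u has_integral (?\<gamma> t - ?\<gamma> s)) {s..t}"
    proof cases
      case 3
      have "(horizontal_velocity ?\<gamma> ?u has_integral ((?\<gamma> (1/2) - ?\<gamma> s) + (?\<gamma> t - ?\<gamma> (1/2)))) {s..t}"
        using st 3 by (intro has_integral_combine[of s "1/2" t] lo hi) auto
      then show ?thesis
        by (simp only: algebra_simps) simp
    qed (use st lo hi in blast)+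
  next
    have 1: "((\<lambda>r. norm (?u r)) has_integral L) {0..1/2}"
      using has_integral_affine_interval[OF \<gamma>(3), of 2 0 0 "1/2"]
      by (subst has_integral_cong[where g = "\<lambda>r. 2 *\<^sub>R norm (u (2 * r + 0))"]) auto
    have i: "((\<lambda>r. 2 *\<^sub>R norm (v (2 * r + - 1))) has_integral L') {1/2..1}"
      by (rule has_integral_affine_interval[OF \<eta>(3)]) auto
    have "((\<lambda>r. norm (?u r)) has_integral L') {1/2..1}"
      by (rule has_integral_spike_finite[OF finite.insertI[OF finite.emptyI] _ i, of "1/2"]) simp
    with 1 show "((\<lambda>r. norm (?u r)) has_integral L + L') {0..1}"
      by (intro has_integral_combine[of 0 "1/2" 1]) simp_all
  qed (use \<gamma> \<eta> in auto)
qed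

text \<open>A straight horizontal segment from the origin has no vertical velocity because
  \<open>br v v = 0\<close>.\<close>

lemma connected_by_line: "connected_by 0 (v, 0) (norm v)"
proof (rule connected_byI[of "\<lambda>r. (r *\<^sub>R v, 0)" _ _ "\<lambda>_. v"])
  show "((\<lambda>r::real. norm v) has_integral norm v) {0..1}"
    using has_integral_const_real[of "norm v" 0 1] by simp
  fix s t :: real assume "0 \<le> s" "s \<le> t" "t \<le> 1"
  then have "((\<lambda>r. (v, 0::'b)) has_integral ((t - s) *\<^sub>R (v, 0))) {s..t}"
    using has_integral_const_real[of "(v, 0::'b)" s t] by simp
  then show "(horizontal_velocity (\<lambda>r. (r *\<^sub>R v, 0)) (\<lambda>_. v) has_integral ((t *\<^sub>R v, 0) - (s *\<^sub>R v, 0))) {s..t}"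
    by (simp add: horizontal_velocity_def[abs_def] br.scaleR_left algebra_simps)
qed (auto simp: zero_prod_def)

lemma connected_by_gmult:
  assumes "connected_by 0 p L" "connected_by 0 q L'"
  shows "connected_by 0 (p \<star> q) (L + L')"
  using connected_by_trans[OF assms(1)] connected_by_translate[OF assms(2), of p] by simp

text \<open>
  The commutator of the horizontal elements \<open>a x\<close> and \<open>b y\<close> is \<open>(0, a b br x y)\<close>; taking \<open>\<bar>a\<bar> = \<bar>b\<bar>\<close>
  reaches the central point \<open>(0, s br x y)\<close> at cost proportional to \<open>sqrt \<bar>s\<bar>\<close>.
\<close>

lemma connected_by_commutator:
  "\<exists>L. connected_by 0 (0, s *\<^sub>R br x y) L \<and> L \<le> 2 * (norm x + norm y) * sqrt \<bar>s\<bar>"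
proof -
  \<comment> \<open>The sign of \<open>s\<close> is carried by \<open>b\<close>, so that the product
    is \<open>s\<close> while both factors have size at most the square root of its absolute
    value.\<close>
  define a b where "a = sqrt \<bar>s\<bar>" and "b = sgn s * sqrt \<bar>s\<bar>"
  have ab: "a * b = s"
    by (simp add: a_def b_def sgn_if)
  have "connected_by 0 (((a *\<^sub>R x, 0) \<star> (b *\<^sub>R y, 0)) \<star> (((- a) *\<^sub>R x, 0) \<star> ((- b) *\<^sub>R y, 0)))
      ((norm (a *\<^sub>R x) + norm (b *\<^sub>R y)) + (norm ((- a) *\<^sub>R x) + norm ((- b) *\<^sub>R y)))"
    by (intro connected_by_gmult connected_by_line)
  moreover have "(a *\<^sub>R x, 0) \<star> (b *\<^sub>R y, 0) = (a *\<^sub>R x + b *\<^sub>R y, (s / 2) *\<^sub>R br x y)"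
    by (simp add: gmult_def br.scaleR_left br.scaleR_right flip: ab)
  moreover have "((- a) *\<^sub>R x, 0) \<star> ((- b) *\<^sub>R y, 0) = (- (a *\<^sub>R x + b *\<^sub>R y), (s / 2) *\<^sub>R br x y)"
    by (simp add: gmult_def br.scaleR_left br.scaleR_right br.minus_left br.minus_right flip: ab)
  \<comment> \<open>The two halves of the commutator have opposite horizontal parts, so these
    cancel, their bracket vanishes and the equal vertical parts add up.\<close>
  moreover have "(z, (s / 2) *\<^sub>R br x y) \<star> (- z, (s / 2) *\<^sub>R br x y) = (0, s *\<^sub>R br x y)" for z
    by (simp add: gmult_def br.minus_right flip: scaleR_left.add)
  moreover have "\<bar>b\<bar> \<le> sqrt \<bar>s\<bar>" "\<bar>a\<bar> = sqrt \<bar>s\<bar>"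
    by (auto simp: a_def b_def abs_mult sgn_if)
  then have "(norm (a *\<^sub>R x) + norm (b *\<^sub>R y)) + (norm ((- a) *\<^sub>R x) + norm ((- b) *\<^sub>R y))
      \<le> 2 * (norm x + norm y) * sqrt \<bar>s\<bar>"
    using mult_right_mono[of "\<bar>b\<bar>" "sqrt \<bar>s\<bar>" "norm y"] by (simp add: algebra_simps)
  ultimately show ?thesis
    by metis
qed

text \<open>A curve of length \<open>L\<close> from the origin has horizontal part of norm at most
  \<open>L\<close>, so its vertical speed is at most a constant times \<open>L * norm (u r)\<close>;
  integration makes the vertical displacement quadratic in \<open>L\<close>. Definiteness of the
  distance comes from this.\<close>

lemma connected_by_lower:
  obtains K where "K \<ge> 0"
    "\<And>p L. connected_by 0 p L \<Longrightarrow> norm (fst p) \<le> L \<and> norm (snd p) \<le> K * L\<^sup>2"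
proof -
  obtain K where K: "K \<ge> 0" "\<And>x y. norm (br x y) \<le> norm x * norm y * K"
    using br.nonneg_bounded by blast
  have "norm (fst p) \<le> L \<and> norm (snd p) \<le> K * L\<^sup>2" if conn: "connected_by 0 p L" for p L
  proof -
    obtain \<gamma> u where \<gamma>: "\<gamma> 0 = 0" "\<gamma> 1 = p" "((\<lambda>r. norm (u r)) has_integral L) {0..1}"
      "\<And>s t. 0 \<le> s \<Longrightarrow> s \<le> t \<Longrightarrow> t \<le> 1 \<Longrightarrow>
          (horizontal_velocity \<gamma> u has_integral (\<gamma> t - \<gamma> s)) {s..t}"
      using connected_byE[OF conn] by blast
    have L: "L \<ge> 0"
      using conn by (rule connected_by_nonneg)
    have nu: "(\<lambda>r. norm (u r)) integrable_on {0..1}" "integral {0..1} (\<lambda>r. norm (u r)) = L"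
      using \<gamma>(3) by (auto simp: has_integral_integrable integral_unique)
    have f: "norm (fst (\<gamma> t)) \<le> L" if "0 \<le> t" "t \<le> 1" for t
    proof -
      have u: "(u has_integral fst (\<gamma> t)) {0..t}"
        using horizontal_velocity_fst[OF \<gamma>(4)[of 0 t]] that \<gamma>(1) by simp
      have nt: "(\<lambda>r. norm (u r)) integrable_on {0..t}"
        using nu(1) that by (rule_tac integrable_on_subinterval[of _ "{0..1}"]) auto
      have "norm (integral {0..t} u) \<le> integral {0..t} (\<lambda>r. norm (u r))"
        using u nt by (intro Henstock_Kurzweil_Integration.integral_norm_bound_integral) (auto simp: has_integral_integrable)
      also have "\<dots> \<le> integral {0..1} (\<lambda>r. norm (u r))"
        using nt nu that by (intro integral_subset_le) auto
      finally show ?thesis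
        using u nu by (simp add: integral_unique)
    qed
    have s: "((\<lambda>r. (1/2) *\<^sub>R br (fst (\<gamma> r)) (u r)) has_integral snd p) {0..1}"
      using horizontal_velocity_snd[OF \<gamma>(4)[of 0 1]] \<gamma>(1,2) by simp
    have "norm (integral {0..1} (\<lambda>r. (1/2) *\<^sub>R br (fst (\<gamma> r)) (u r))) \<le> integral {0..1} (\<lambda>r. L * K * norm (u r))"
    proof (rule Henstock_Kurzweil_Integration.integral_norm_bound_integral)
      fix r :: real assume "r \<in> {0..1}"
      then have "norm (fst (\<gamma> r)) * (norm (u r) * K) \<le> L * (norm (u r) * K)"
        using f[of r] K(1) by (intro mult_right_mono) auto
      moreover have "norm (br (fst (\<gamma> r)) (u r)) \<le> norm (fst (\<gamma> r)) * norm (u r) * K"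
        by (rule K)
      ultimately have "norm (br (fst (\<gamma> r)) (u r)) \<le> L * K * norm (u r)"
        by (simp add: mult_ac)
      moreover have "norm ((1/2) *\<^sub>R br (fst (\<gamma> r)) (u r)) \<le> norm (br (fst (\<gamma> r)) (u r))"
        by simp
      ultimately show "norm ((1/2) *\<^sub>R br (fst (\<gamma> r)) (u r)) \<le> L * K * norm (u r)"
        by linarith
    qed (use s nu in \<open>auto simp: has_integral_integrable intro: integrable_on_mult_right\<close>)
    then have "norm (snd p) \<le> L * K * L"
      using nu by (simp only: integral_unique[OF s] integral_mult_right)
    then show ?thesis
      using f[of 1] \<gamma>(2) by (simp add: power2_eq_square mult.assoc mult.left_commute)
  qed
  then show ?thesis
    using that K(1) by blast
qed

text \<open>Go straight to \<open>(fst p, 0)\<close> and then correct one central coordinate after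
  the other by commutators. Each coordinate is bounded by \<open>norm (snd p)\<close>, and right
  multiplication by central elements creates no bracket. This gives finiteness of the distance and,
  near the origin, its continuity.\<close>

lemma connected_by_upper:
  assumes e: "finite I" "orthonormal_basis I e" "\<And>i. i \<in> I \<Longrightarrow> \<exists>x y. br x y = e i"
  obtains K where "\<And>p. \<exists>L. connected_by 0 p L \<and> L \<le> norm (fst p) + K * sqrt (norm (snd p))"
proof -
  obtain X Y where XY: "\<And>i. i \<in> I \<Longrightarrow> br (X i) (Y i) = e i"
    using e(3) by metis
  define K where "K = (\<Sum>i\<in>I. 2 * (norm (X i) + norm (Y i)))"
  have ne: "norm (e i) = 1" if "i \<in> I" for i
    using e(2) that by (simp add: orthonormal_basis_def norm_eq_1)
  have inj: "inj_on e I"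
    using e(2) unfolding orthonormal_basis_def inj_on_def by (metis zero_neq_one)
  have orth: "pairwise orthogonal (e ` I)"
    using e(2) unfolding orthonormal_basis_def pairwise_def orthogonal_def by auto
  have "\<exists>L. connected_by 0 p L \<and> L \<le> norm (fst p) + K * sqrt (norm (snd p))" for p :: "'a \<times> 'b"
  proof -
    let ?t = "snd p"
    have "\<exists>L. connected_by 0 (fst p, \<Sum>i\<in>J. (?t \<bullet> e i) *\<^sub>R e i) L \<and>
        L \<le> norm (fst p) + (\<Sum>i\<in>J. 2 * (norm (X i) + norm (Y i))) * sqrt (norm ?t)" if "J \<subseteq> I" for J
      using finite_subset[OF that e(1)] that
    proof (induction J)
      case empty
      then show ?case
        using connected_by_line[of "fst p"] by auto
    next
      case (insert j J)
      then obtain L where L: "connected_by 0 (fst p, \<Sum>i\<in>J. (?t \<bullet> e i) *\<^sub>R e i) L"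
        "L \<le> norm (fst p) + (\<Sum>i\<in>J. 2 * (norm (X i) + norm (Y i))) * sqrt (norm ?t)"
        by auto
      obtain L' where L': "connected_by 0 (0, (?t \<bullet> e j) *\<^sub>R br (X j) (Y j)) L'"
        "L' \<le> 2 * (norm (X j) + norm (Y j)) * sqrt \<bar>?t \<bullet> e j\<bar>"
        using connected_by_commutator by blast
      have "\<bar>?t \<bullet> e j\<bar> \<le> norm ?t"
        using Cauchy_Schwarz_ineq2[of ?t "e j"] ne insert by simp
      then have "2 * (norm (X j) + norm (Y j)) * sqrt \<bar>?t \<bullet> e j\<bar> \<le> 2 * (norm (X j) + norm (Y j)) * sqrt (norm ?t)"
        by (intro mult_left_mono) auto
      then have "L + L' \<le> norm (fst p) + (\<Sum>i\<in>insert j J. 2 * (norm (X i) + norm (Y i))) * sqrt (norm ?t)"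
        using L(2) L'(2) insert by (simp add: algebra_simps)
      moreover have "connected_by 0 (fst p, \<Sum>i\<in>insert j J. (?t \<bullet> e i) *\<^sub>R e i) (L + L')"
        using connected_by_gmult[OF L(1) L'(1)] insert XY[of j]
        by (simp add: gmult_def br.zero_right add.commute)
      ultimately show ?case
        by blast
    qed
    moreover have "(\<Sum>i\<in>I. (?t \<bullet> e i) *\<^sub>R e i) = ?t"
    proof -
      have "(\<Sum>b\<in>e ` I. (?t \<bullet> b) *\<^sub>R b) = ?t"
      proof (rule orthonormal_basis_expand[OF orth])
        show "?t \<in> span (e ` I)"
          using e(2) unfolding orthonormal_basis_def by simp
        show "finite (e ` I)"
          using e(1) by (rule finite_imageI)
      qed (use ne in blast)
      then show ?thesis
        by (simp add: sum.reindex[OF inj] inner_commute)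
    qed
    ultimately show ?thesis
      unfolding K_def by (metis order_refl prod.collapse)
  qed
  then show ?thesis
    using that by blast
qed

theorem cc_dist_homogeneous_norm:
  assumes e: "finite I" "orthonormal_basis I e" "\<And>i. i \<in> I \<Longrightarrow> \<exists>x y. br x y = e i"
  shows "homogeneous_norm (carnot_group br) (cc_dist br 0)"
    and "cc_dist br = norm_dist (carnot_group br) (cc_dist br 0)"
proof -
  let ?N = "cc_dist br 0"
  obtain K where K: "\<And>p. \<exists>L. connected_by 0 p L \<and> L \<le> norm (fst p) + K * sqrt (norm (snd p))"
    using connected_by_upper[OF e] by blast
  obtain K' where K': "K' \<ge> 0"
    "\<And>p L. connected_by 0 p L \<Longrightarrow> norm (fst p) \<le> L \<and> norm (snd p) \<le> K' * L\<^sup>2"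
    using connected_by_lower by blast
  have ex: "\<exists>L. connected_by 0 p L" for p
    using K by blast
  have bdd: "bdd_below {L. connected_by p q L}" for p q
    by (rule bdd_belowI[of _ 0]) (use connected_by_nonneg in blast)
  have le: "?N p \<le> L" if "connected_by 0 p L" for p L
    unfolding cc_dist_eq using that bdd by (intro cInf_lower) auto
  have ge: "X \<le> ?N p" if "\<And>L. connected_by 0 p L \<Longrightarrow> X \<le> L" for p X
    unfolding cc_dist_eq using that ex by (intro cInf_greatest) auto
  have close: "\<exists>L. connected_by 0 p L \<and> L < ?N p + \<epsilon>" if "\<epsilon> > 0" for p \<epsilon>
    using cInf_lessD[of "{L. connected_by 0 p L}" "?N p + \<epsilon>"] ex that unfolding cc_dist_eq by auto
  have nonneg: "0 \<le> ?N p" for p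
    by (rule ge) (rule connected_by_nonneg)
  have upper: "?N p \<le> norm (fst p) + K * sqrt (norm (snd p))" for p
    using K le by (meson order_trans)
  have tri: "?N (p \<star> q) \<le> ?N p + ?N q" for p q
  proof (rule field_le_epsilon)
    fix \<epsilon> :: real assume "\<epsilon> > 0"
    then obtain L L' where "connected_by 0 p L" "L < ?N p + \<epsilon> / 2" "connected_by 0 q L'" "L' < ?N q + \<epsilon> / 2"
      using close[of "\<epsilon> / 2"] by (meson half_gt_zero)
    then show "?N (p \<star> q) \<le> ?N p + ?N q + \<epsilon>"
      using le[OF connected_by_gmult] by fastforce
  qed
  have conn_minus: "connected_by 0 (- p) L" if "connected_by 0 p L" for p L
    using connected_by_translate[OF connected_by_sym[OF that], of "- p"] by simp
  have minus: "?N (- p) = ?N p" for p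
    by (rule antisym; rule ge; rule le) (use conn_minus[of p] conn_minus[of "- p"] in auto)
  have dil: "?N (dilation l p) = l * ?N p" if l: "l > 0" for l p
  proof (rule antisym)
    have 1: "?N (dilation l p) \<le> l * ?N p" if l: "l > 0" for l p
    proof -
      have "?N (dilation l p) / l \<le> ?N p"
      proof (rule ge)
        fix L assume "connected_by 0 p L"
        then show "?N (dilation l p) / l \<le> L"
          using le[of "dilation l p" "l * L"] connected_by_dilation[of 0 p L l] l
          by (simp add: field_simps)
      qed
      then show ?thesis
        using l by (simp add: field_simps)
    qed
    show "?N (dilation l p) \<le> l * ?N p"
      by (rule 1[OF l])
    show "l * ?N p \<le> ?N (dilation l p)"
      using 1[of "inverse l" "dilation l p"] l unfolding dilation_inverse(1)[OF l] by (simp add: field_simps)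
  qed
  have zero: "?N p = 0 \<longleftrightarrow> p = 0" for p
  proof
    assume 0: "?N p = 0"
    have "norm (fst p) \<le> ?N p"
      by (rule ge) (use K' in blast)
    moreover have "norm (snd p) \<le> 0"
    proof (rule field_le_epsilon)
      fix \<epsilon> :: real assume \<epsilon>: "\<epsilon> > 0"
      \<comment> \<open>Chosen such that \<open>K' * \<eta>\<^sup>2\<close> is at most
        \<open>\<epsilon>\<close>; the summand 1 keeps the denominator positive.\<close>
      define \<eta> where "\<eta> = sqrt (\<epsilon> / (K' + 1))"
      have \<eta>: "\<eta> > 0" "\<eta>\<^sup>2 = \<epsilon> / (K' + 1)"
        using \<epsilon> K'(1) by (simp_all add: \<eta>_def)
      obtain L where L: "connected_by 0 p L" "L < \<eta>"
        using close[OF \<eta>(1), of p] 0 by auto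
      have "norm (snd p) \<le> K' * L\<^sup>2"
        using K'(2) L(1) by blast
      also have "\<dots> \<le> K' * \<eta>\<^sup>2"
        using connected_by_nonneg[OF L(1)] L(2) K'(1) by (intro mult_left_mono power_mono) auto
      also have "\<dots> \<le> \<epsilon>"
        using \<epsilon> K'(1) by (simp add: \<eta>(2) field_simps)
      finally show "norm (snd p) \<le> 0 + \<epsilon>"
        by simp
    qed
    ultimately show "p = 0"
      using 0 by (simp add: prod_eq_iff)
  next
    assume "p = 0"
    then show "?N p = 0"
      using upper[of 0] nonneg[of 0] by simp
  qed
  \<comment> \<open>By the triangle inequality the increment of \<open>?N\<close> is at most
    \<open>?N (- q \<star> p)\<close>, and the upper bound for this tends to 0 as \<open>p\<close>
    tends to \<open>q\<close>.\<close>
  have "isCont ?N q" for q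
  proof -
    have "((\<lambda>p. norm (fst (- q \<star> p)) + K * sqrt (norm (snd (- q \<star> p)))) \<longlongrightarrow>
        norm (fst (- q \<star> q)) + K * sqrt (norm (snd (- q \<star> q)))) (at q)"
      unfolding gmult_def by (intro tendsto_intros br.tendsto)
    then have "((\<lambda>p. norm (fst (- q \<star> p)) + K * sqrt (norm (snd (- q \<star> p)))) \<longlongrightarrow> 0) (at q)"
      by simp
    moreover have "norm (?N p - ?N q) \<le> norm (fst (- q \<star> p)) + K * sqrt (norm (snd (- q \<star> p)))" for p
    proof -
      have "?N p \<le> ?N q + ?N (- q \<star> p)"
        using tri[of q "- q \<star> p"] by simp
      moreover have "?N q \<le> ?N p + ?N (- q \<star> p)"
        using tri[of p "- p \<star> q"] minus[of "- q \<star> p"] by (simp add: minus_gmult)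
      ultimately show ?thesis
        using upper[of "- q \<star> p"] by (simp add: abs_le_iff)
    qed
    ultimately have "((\<lambda>p. ?N p - ?N q) \<longlongrightarrow> 0) (at q)"
      by (rule Lim_null_comparison[OF always_eventually[OF allI], rotated]) 
    then show ?thesis
      by (simp add: isCont_def LIM_zero_iff)
  qed
  then have cont: "continuous_on UNIV ?N"
    by (simp add: continuous_at_imp_continuous_on)
  show "homogeneous_norm (carnot_group br) ?N"
    unfolding homogeneous_norm_def using cont nonneg zero minus dil tri by simp
  show "cc_dist br = norm_dist (carnot_group br) ?N"
  proof (intro ext)
    fix p q
    \<comment> \<open>Left translation by \<open>- p\<close> matches curves from \<open>p\<close> to
      \<open>q\<close> with curves from 0; symmetry of the norm then swaps the order of the points
      as \<open>norm_dist\<close> has it.\<close>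
    have "{L. connected_by p q L} = {L. connected_by 0 (- p \<star> q) L}"
      using connected_by_translate[of p q _ "- p"] connected_by_translate[of 0 "- p \<star> q" _ p] by auto
    then have "cc_dist br p q = ?N (- (- p \<star> q))"
      unfolding minus by (simp only: cc_dist_eq)
    then show "cc_dist br p q = norm_dist (carnot_group br) ?N p q"
      by (simp add: norm_dist_carnot minus_gmult)
  qed
qed

end

text \<open>Isolates the common feature of the three bracket tables: every vector of an orthonormal
  basis of the centre is a single bracket, already visible at index \<open>k = 1\<close>.\<close>

lemma heisenberg_algebra_generated:
  fixes br :: "'a::euclidean_space \<Rightarrow> 'a \<Rightarrow> 'b::euclidean_space"
  assumes "heisenberg_algebra K n br" "n \<ge> 1"
  obtains I and e :: "nat \<Rightarrow> 'b" where "skew_bilinear br" "finite I" "orthonormal_basis I e"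
    "\<And>i. i \<in> I \<Longrightarrow> \<exists>x y. br x y = e i"
proof (cases K)
  case Real_Numbers
  then have "real_heisenberg n br"
    using assms by simp
  then obtain X Y and e :: "nat \<Rightarrow> 'b" where e: "skew_bilinear br" "orthonormal_basis {1} e"
    "\<forall>k\<in>{1..n}. br (X k) (Y k) = e 1"
    unfolding real_heisenberg_def by blast
  then have "br (X 1) (Y 1) = e 1"
    using assms(2) by simp
  then show ?thesis
    using e that[of "{1}" e] by auto
next
  case Complex_Numbers
  then have *: "complex_heisenberg n br"
    using assms by simp
  then have "skew_bilinear br"
    unfolding complex_heisenberg_def by (rule conjunct1)
  moreover from * obtain X :: "nat \<times> nat \<Rightarrow> 'a" and e :: "nat \<Rightarrow> 'b" where e: "orthonormal_basis {1..2} e"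
    "\<forall>k\<in>{1..n}.
       br (X (1, k)) (X (2, k)) = e 1 \<and> br (X (3, k)) (X (4, k)) = - e 1 \<and>
       br (X (1, k)) (X (3, k)) = e 2 \<and> br (X (2, k)) (X (4, k)) = e 2 \<and>
       br (X (1, k)) (X (4, k)) = 0 \<and> br (X (2, k)) (X (3, k)) = 0"
    unfolding complex_heisenberg_def by (elim conjE exE)
  moreover have "br (X (1, 1)) (X (2, 1)) = e 1" "br (X (1, 1)) (X (3, 1)) = e 2"
    using bspec[OF e(2), of 1] assms(2) by simp_all
  moreover have "{1..2} = {1, 2::nat}"
    by auto
  ultimately show ?thesis
    using that[of "{1..2}" e] by auto
next
  case Quaternions
  then have *: "quaternionic_heisenberg n br"
    using assms by simp
  then have "skew_bilinear br"
    unfolding quaternionic_heisenberg_def by (rule conjunct1)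
  moreover from * obtain X :: "nat \<times> nat \<Rightarrow> 'a" and e :: "nat \<Rightarrow> 'b" where e: "orthonormal_basis {1..3} e"
    "\<forall>k\<in>{1..n}.
       br (X (1, k)) (X (2, k)) = e 1 \<and> br (X (3, k)) (X (4, k)) = - e 1 \<and>
       br (X (1, k)) (X (3, k)) = e 2 \<and> br (X (2, k)) (X (4, k)) = e 2 \<and>
       br (X (1, k)) (X (4, k)) = e 3 \<and> br (X (2, k)) (X (3, k)) = - e 3"
    unfolding quaternionic_heisenberg_def by (elim conjE exE)
  moreover have "br (X (1, 1)) (X (2, 1)) = e 1" "br (X (1, 1)) (X (3, 1)) = e 2" "br (X (1, 1)) (X (4, 1)) = e 3"
    using bspec[OF e(2), of 1] assms(2) by simp_all
  moreover have "{1..3} = {1, 2, 3::nat}"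
    by auto
  ultimately show ?thesis
    using that[of "{1..3}" e] by auto
qed

lemma admissible_dist_homogeneous_norm:
  assumes "heisenberg_algebra K n br" "n \<ge> 1" "admissible_dist br d"
  obtains N where "homogeneous_norm (carnot_group br) N" "d = norm_dist (carnot_group br) N"
proof -
  obtain I and e :: "nat \<Rightarrow> _" where e: "skew_bilinear br" "finite I" "orthonormal_basis I e"
    "\<And>i. i \<in> I \<Longrightarrow> \<exists>x y. br x y = e i"
    using heisenberg_algebra_generated[OF assms(1,2)] by blast
  interpret step_two_group br
    using e(1) by unfold_locales
  show ?thesis
    using assms(3) cc_dist_homogeneous_norm[OF e(2-4)] that
    unfolding admissible_dist_def Let_def by blast
qed

section \<open>Geometry of homogeneous norms\<close>

declare split_paired_All [simp del] split_paired_Ex [simp del]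

locale homogeneous_group = step_two_group br
  for br :: "'a::euclidean_space \<Rightarrow> 'a \<Rightarrow> 'b::euclidean_space" +
  fixes N :: "'a \<times> 'b \<Rightarrow> real"
  assumes homnorm: "homogeneous_norm (carnot_group br) N"
begin

abbreviation d where "d \<equiv> norm_dist (carnot_group br) N"

lemma d_eq: "d p q = N (- q \<star> p)"
  by (rule norm_dist_carnot)

lemma N_nonneg [simp]: "0 \<le> N p"
  and N_eq_0 [simp]: "N p = 0 \<longleftrightarrow> p = 0"
  and N_minus [simp]: "N (- p) = N p"
  and N_dilation: "l > 0 \<Longrightarrow> N (dilation l p) = l * N p"
  and N_triangle: "N (p \<star> q) \<le> N p + N q"
  and continuous_on_N: "continuous_on UNIV N"
  using homnorm unfolding homogeneous_norm_def by simp_all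

lemma N_0 [simp]: "N 0 = 0"
  by simp

lemma continuous_on_N' [continuous_intros]: "continuous_on S f \<Longrightarrow> continuous_on S (\<lambda>x. N (f x))"
  using continuous_on_compose2[OF continuous_on_N] by auto

lemma borel_measurable_N [measurable]: "N \<in> borel_measurable borel"
  by (rule borel_measurable_continuous_onI[OF continuous_on_N])

lemma d_0 [simp]: "d p 0 = N p"
  by (simp add: d_eq)

lemma d_self [simp]: "d p p = 0"
  by (simp add: d_eq)

lemma d_nonneg [simp]: "0 \<le> d p q"
  by (simp add: d_eq)

lemma d_sym: "d p q = d q p"
  using N_minus[of "- q \<star> p"] by (simp add: d_eq minus_gmult)

lemma d_triangle: "d p r \<le> d p q + d q r"
  using N_triangle[of "- r \<star> q" "- q \<star> p"] by (simp add: d_eq gmult_assoc)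

lemma d_translate [simp]: "d (g \<star> p) (g \<star> q) = d p q"
  by (simp add: d_eq minus_gmult gmult_assoc)

text \<open>By compactness \<open>N\<close> has a positive minimum on the unit sphere of the gauge
  \<open>max (norm x) (sqrt (norm t))\<close>, and homogeneity spreads this bound to all points.
  Hence balls of \<open>N\<close> are bounded and form a neighbourhood base.\<close>

lemma N_lower_bound:
  obtains m where "m > 0" "\<And>p. norm (fst p) \<le> m * N p" "\<And>p. norm (snd p) \<le> (m * N p)\<^sup>2"
proof -
  define S where "S = {p::'a \<times> 'b. (norm (fst p) \<le> 1 \<and> norm (snd p) \<le> 1) \<and>
      (norm (fst p) = 1 \<or> norm (snd p) = 1)}"
  have "closed S"
    unfolding S_def by (intro closed_Collect_conj closed_Collect_disj closed_Collect_le
        closed_Collect_eq continuous_intros)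
  moreover have "bounded S"
    unfolding bounded_iff
  proof (intro exI[of _ 2] ballI)
    fix p assume "p \<in> S"
    then show "norm p \<le> 2"
      using norm_Pair_le[of "fst p" "snd p"] unfolding S_def by auto
  qed
  ultimately have comp: "compact S"
    by (simp add: compact_eq_bounded_closed)
  obtain b :: 'a where b: "norm b = 1"
    using vector_choose_size[of 1] by auto
  then have "(b, 0) \<in> S"
    by (simp add: S_def)
  then obtain p0 where p0: "p0 \<in> S" "\<And>p. p \<in> S \<Longrightarrow> N p0 \<le> N p"
    using continuous_attains_inf[OF comp _ continuous_on_subset[OF continuous_on_N]]
    by (metis empty_iff subset_UNIV)
  have "p0 \<noteq> 0"
    using p0(1) by (auto simp: S_def)
  then have m0: "N p0 > 0"
    by (simp add: order_less_le)
  have "max (norm (fst p)) (sqrt (norm (snd p))) * N p0 \<le> N p" for p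
  proof (cases "p = 0")
    case False
    \<comment> \<open>The gauge of \<open>p\<close>, so that the dilation by
      \<open>inverse r\<close> lands on the sphere \<open>S\<close>.\<close>
    define r where "r = max (norm (fst p)) (sqrt (norm (snd p)))"
    have r: "r > 0" "norm (fst p) \<le> r" "sqrt (norm (snd p)) \<le> r"
      "r = norm (fst p) \<or> r = sqrt (norm (snd p))"
      using False unfolding r_def by (auto simp: prod_eq_iff less_max_iff_disj max_def)
    have "norm (snd p) \<le> r\<^sup>2"
      using r(3) by (metis norm_ge_zero real_sqrt_le_iff real_sqrt_unique r(1) less_imp_le real_sqrt_pow2
          real_sqrt_abs abs_of_nonneg)
    moreover have "r = sqrt (norm (snd p)) \<Longrightarrow> norm (snd p) = r\<^sup>2"
      by simp
    moreover have "norm (fst (dilation (inverse r) p)) = norm (fst p) / r"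
      "norm (snd (dilation (inverse r) p)) = norm (snd p) / r\<^sup>2"
      using r(1) by (auto simp: dilation_def power_inverse divide_inverse mult.commute abs_inverse)
    ultimately have "dilation (inverse r) p \<in> S"
      using r unfolding S_def by auto
    then have "N p0 \<le> N (dilation (inverse r) p)"
      by (rule p0(2))
    also have "\<dots> = inverse r * N p"
      using r(1) by (simp add: N_dilation)
    finally have "N p0 \<le> N p / r"
      by (simp add: field_simps)
    then show ?thesis
      using r(1) by (simp add: r_def field_simps)
  qed simp
  then have *: "max (norm (fst p)) (sqrt (norm (snd p))) \<le> inverse (N p0) * N p" for p
    using m0 by (simp only: divide_inverse[symmetric] pos_le_divide_eq mult.commute[of "inverse _"])
  show ?thesis
  proof (rule that[of "inverse (N p0)"])
    fix p
    show "norm (fst p) \<le> inverse (N p0) * N p"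
      using *[of p] by simp
    have "sqrt (norm (snd p)) \<le> inverse (N p0) * N p"
      using *[of p] by simp
    then show "norm (snd p) \<le> (inverse (N p0) * N p)\<^sup>2"
      by (rule sqrt_le_D)
  qed (use m0 in simp)
qed

lemma bounded_N_le: "bounded {p. N p \<le> r}"
proof -
  obtain m where m: "m > 0" "\<And>p. norm (fst p) \<le> m * N p" "\<And>p. norm (snd p) \<le> (m * N p)\<^sup>2"
    using N_lower_bound by blast
  have "norm p \<le> m * r + (m * r)\<^sup>2" if "N p \<le> r" for p
  proof -
    have "m * N p \<le> m * r"
      using that m(1) by simp
    moreover from this have "(m * N p)\<^sup>2 \<le> (m * r)\<^sup>2"
      using m(1) by (intro power_mono) auto
    ultimately show ?thesis
      using norm_Pair_le[of "fst p" "snd p"] m(2,3)[of p] by simp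
  qed
  then show ?thesis
    unfolding bounded_iff by blast
qed

lemma compact_N_le: "compact {p. N p \<le> r}"
  unfolding compact_eq_bounded_closed
  by (intro conjI bounded_N_le closed_Collect_le continuous_intros)

lemma open_contains_N_ball:
  assumes "open U" "0 \<in> U"
  obtains e where "e > 0" "\<And>p. N p < e \<Longrightarrow> p \<in> U"
proof -
  obtain m where m: "m > 0" "\<And>p. norm (fst p) \<le> m * N p" "\<And>p. norm (snd p) \<le> (m * N p)\<^sup>2"
    using N_lower_bound by blast
  obtain e where e: "e > 0" "ball 0 e \<subseteq> U"
    using assms openE by blast
  \<comment> \<open>With \<open>k\<close> at most 1 the vertical estimate, a square, is no larger
    than the horizontal one; each is then below \<open>k\<close>, and together they stay below
    \<open>e\<close>.\<close>
  define k where "k = min 1 (e / 2)"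
  have k: "0 < k" "k \<le> 1" "2 * k \<le> e"
    using e by (auto simp: k_def)
  show ?thesis
  proof (rule that[of "k / m"])
    show "k / m > 0"
      using k m by simp
    fix p assume "N p < k / m"
    then have "m * N p < k"
      using m(1) by (simp add: field_simps)
    moreover have "(m * N p)\<^sup>2 \<le> m * N p"
      using calculation k m(1) by (simp add: power2_eq_square mult_left_le)
    ultimately have "norm p < e"
      using norm_Pair_le[of "fst p" "snd p"] m(2,3)[of p] k by simp
    then show "p \<in> U"
      using e(2) by (auto simp: subset_iff)
  qed
qed

lemma open_contains_d_ball:
  assumes "open U" "p \<in> U"
  obtains e where "e > 0" "\<And>q. d q p < e \<Longrightarrow> q \<in> U"
proof -
  have "open ((\<lambda>x. p \<star> x) -` U)"
    using assms(1) by (intro open_vimage continuous_intros)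
  then obtain e where "e > 0" "\<And>q. N q < e \<Longrightarrow> q \<in> (\<lambda>x. p \<star> x) -` U"
    using open_contains_N_ball[of "(\<lambda>x. p \<star> x) -` U"] assms(2) by auto
  then show ?thesis
    using that[of e] by (metis d_eq gmult_cancel(2) vimageE)
qed

lemma exists_N_eq: assumes "r \<ge> 0" obtains p where "N p = r"
proof (cases "r = 0")
  case False
  obtain b :: 'a where "norm b = 1"
    using vector_choose_size[of 1] by auto
  then have "(b, 0) \<noteq> (0 :: 'a \<times> 'b)"
    by (auto simp: zero_prod_def)
  then have "N (b, 0) > 0"
    by (simp add: order_less_le)
  moreover have "N (dilation (r / N (b, 0)) (b, 0)) = r / N (b, 0) * N (b, 0)"
    using calculation False assms by (intro N_dilation divide_pos_pos) auto
  ultimately show ?thesis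
    by (intro that) (simp add: \<open>(b, 0) \<noteq> 0\<close>)
qed (use that[of 0] in simp)

section \<open>Balls and their diameters\<close>

definition gball :: "'a \<times> 'b \<Rightarrow> real \<Rightarrow> ('a \<times> 'b) set" where
  "gball c r = {p. d p c \<le> r}"

lemma mem_gball: "p \<in> gball c r \<longleftrightarrow> N (- c \<star> p) \<le> r"
  by (simp add: gball_def d_eq)

lemma gball_translate: "gball c r = (\<lambda>p. c \<star> p) ` gball 0 r"
proof -
  have "p \<in> (\<lambda>p. c \<star> p) ` gball 0 r" if "p \<in> gball c r" for p
    using that by (intro image_eqI[of _ _ "- c \<star> p"]) (simp_all add: mem_gball)
  moreover have "c \<star> p \<in> gball c r" if "p \<in> gball 0 r" for p
    using that by (simp add: mem_gball)
  ultimately show ?thesis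
    by blast
qed

lemma image_gmult_gball: "(\<lambda>p. g \<star> p) ` gball c r = gball (g \<star> c) r"
  unfolding gball_translate[of c] gball_translate[of "g \<star> c"] by (simp add: image_image gmult_assoc)

lemma compact_gball: "compact (gball c r)"
proof -
  have "gball 0 r = {p. N p \<le> r}"
    by (simp add: gball_def)
  then show ?thesis
    unfolding gball_translate[of c]
    by (intro compact_continuous_image continuous_intros) (simp add: compact_N_le)
qed

lemma borel_gball [measurable]: "gball c r \<in> sets borel"
  by (rule borel_compact[OF compact_gball])

lemma ediam_gball_le: "ediam d (gball c r) \<le> ennreal (2 * r)"
proof (rule ediam_le)
  fix p q assume "p \<in> gball c r" "q \<in> gball c r"
  then have "d p c \<le> r" "d q c \<le> r"
    by (simp_all add: gball_def)
  then show "d p q \<le> 2 * r"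
    using d_triangle[of p q c] d_sym[of c q] by linarith
qed

text \<open>Some point lies at distance exactly \<open>r\<close> from the centre. The spherical
  measure weights balls by diameter while volume estimates use the radius, and this compares the
  two.\<close>

lemma ediam_gball_ge:
  assumes "r \<ge> 0"
  shows "ennreal r \<le> ediam d (gball c r)"
proof -
  obtain p where p: "N p = r"
    using exists_N_eq[OF assms] by blast
  have "ennreal (d (c \<star> p) c) \<le> ediam d (gball c r)"
    by (rule ediam_ge) (use p assms in \<open>simp_all add: mem_gball d_eq\<close>)
  then show ?thesis
    by (simp add: d_eq p)
qed

lemma closed_balls_eq: "closed_balls d = {gball c r | c r. 0 < r}"
  by (simp add: closed_balls_def gball_def)

lemma gauge_spherical:
  assumes "m \<ge> 1"
  shows "gauge (\<lambda>B. ediam d B ^ m) d (closed_balls d)"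
proof
  fix \<epsilon> :: real assume \<epsilon>: "0 < \<epsilon>"
  \<comment> \<open>Besides being small, \<open>2 * r\<close> is at most 1, so its power with
    exponent \<open>m\<close> is no larger than \<open>2 * r\<close> itself.\<close>
  define r where "r = min \<epsilon> 1 / 2"
  have r: "r > 0" "2 * r \<le> \<epsilon>" "2 * r \<le> 1"
    using \<epsilon> by (auto simp: r_def)
  have e: "ediam d (gball 0 r) \<le> ennreal (2 * r)"
    by (rule ediam_gball_le)
  then have "ediam d (gball 0 r) ^ m \<le> ennreal (2 * r) ^ m"
    by (intro power_mono) auto
  also have "\<dots> = ennreal ((2 * r) ^ m)"
    using r(1) by (simp add: ennreal_power)
  also have "\<dots> \<le> ennreal (2 * r)"
    using r assms power_decreasing[of 1 m "2 * r"] by (intro ennreal_leI) simp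
  finally have "ediam d (gball 0 r) ^ m \<le> ennreal \<epsilon>"
    using r(2) by (meson ennreal_leI order_trans)
  moreover have "ediam d (gball 0 r) \<le> ennreal \<epsilon>"
    using e r(2) by (meson ennreal_leI order_trans)
  moreover have "gball 0 r \<in> closed_balls d"
    using r(1) unfolding closed_balls_eq by blast
  ultimately show "\<exists>B\<in>closed_balls d. ediam d B \<le> ennreal \<epsilon> \<and> ediam d B ^ m \<le> ennreal \<epsilon>"
    by blast
qed

text \<open>Away from the whole space, \<open>g\<close> is the \<open>d\<close>-distance to the
  complement, positive exactly on \<open>U\<close> because the topology of the type is the one given
  by \<open>d\<close>. The whole space is separate since an infimum over an empty complement carries
  no information.\<close>

lemma open_eq_superlevel:
  assumes "open U"
  shows "\<exists>g a. (\<forall>x y. g y - g x \<le> d x y) \<and> U = {x. g x > (a::real)}"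
proof (cases "U = UNIV")
  case True
  then show ?thesis
    by (intro exI[of _ "\<lambda>_. 1"] exI[of _ 0]) simp
next
  case False
  define g where "g x = (INF y\<in>-U. d x y)" for x
  have ne: "- U \<noteq> {}"
    using False by auto
  have bdd: "bdd_below (d x ` (- U))" for x
    by (rule bdd_belowI[of _ 0]) auto
  have lip: "g y - g x \<le> d x y" for x y
  proof -
    have "g y - d x y \<le> g x"
      unfolding g_def[of x]
    proof (rule cINF_greatest[OF ne])
      fix z assume "z \<in> - U"
      then have "g y \<le> d y z"
        unfolding g_def by (intro cINF_lower bdd)
      also have "\<dots> \<le> d x y + d x z"
        using d_triangle[of y z x] d_sym[of x y] by simp
      finally show "g y - d x y \<le> d x z"
        by simp
    qed
    then show ?thesis
      by simp
  qed
  have "x \<in> U \<longleftrightarrow> g x > 0" for x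
  proof
    assume "x \<in> U"
    then obtain e where e: "e > 0" "\<And>q. d q x < e \<Longrightarrow> q \<in> U"
      using open_contains_d_ball[OF assms] by blast
    have "e \<le> g x"
      unfolding g_def by (rule cINF_greatest[OF ne]) (metis e(2) ComplD d_sym not_le)
    then show "g x > 0"
      using e(1) by simp
  next
    assume "g x > 0"
    show "x \<in> U"
    proof (rule ccontr)
      assume "x \<notin> U"
      then have "g x \<le> d x x"
        unfolding g_def by (intro cINF_lower bdd) simp
      then show False
        using \<open>g x > 0\<close> by simp
    qed
  qed
  then show ?thesis
    using lip by (intro exI[of _ g] exI[of _ 0]) blast
qed

text \<open>\<open>measure_of\<close> falls back to the zero measure unless its argument is a
  measure on the given sigma-algebra; Caratheodory's criterion rules this out.\<close>

lemma emeasure_spherical_restrict: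
  assumes "m \<ge> 1" "A \<in> sets borel"
  shows "emeasure (spherical_restrict d m S) A = spherical_measure d m (A \<inter> S)"
proof -
  interpret gauge "\<lambda>B. ediam d B ^ m" d "closed_balls d"
    using assms(1) by (rule gauge_spherical)
  have "measure_space UNIV (sigma_sets UNIV {U. open U}) (\<lambda>A. spherical_measure d m (A \<inter> S))"
    unfolding spherical_measure_gauge
    by (rule measure_space_gauge_restrict) (use open_eq_superlevel in blast)
  moreover have "sigma_sets UNIV {U :: ('a \<times> 'b) set. open U} = sets borel"
    unfolding borel_def by simp
  ultimately have "measure_space UNIV (sets borel) (\<lambda>A. spherical_measure d m (A \<inter> S))"
    by (simp only:)
  then show ?thesis
    using assms(2) unfolding spherical_restrict_def measure_space_def
    by (intro emeasure_measure_of_sigma) blast+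
qed

lemma sets_spherical_restrict [simp, measurable_cong]: "sets (spherical_restrict d m S) = sets borel"
  unfolding spherical_restrict_def using sets.sigma_sets_eq[of borel] by (simp add: sets_measure_of_conv)

lemma space_spherical_restrict [simp]: "space (spherical_restrict d m S) = UNIV"
  unfolding spherical_restrict_def by (simp add: space_measure_of_conv)

text \<open>Left translations permute the balls and keep diameters, so covers are carried to covers
  of equal weight. One inequality for all \<open>g\<close> suffices, applied to \<open>g\<close> and
  to \<open>- g\<close>.\<close>

lemma spherical_measure_translate: "spherical_measure d m ((\<lambda>p. g \<star> p) ` E) = spherical_measure d m E"
proof -
  have diam: "ediam d ((\<lambda>p. g \<star> p) ` A) = ediam d A" for g A
    unfolding ediam_def by (simp add: image_image)
  have "spherical_measure d m ((\<lambda>p. g \<star> p) ` E) \<le> spherical_measure d m E" for g E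
    unfolding spherical_measure_gauge gauge_measure_def
  proof (intro SUP_mono bexI)
    fix \<delta> :: real
    let ?w = "\<lambda>B. ediam d B ^ m"
    show "cover_content ?w d (closed_balls d) \<delta> ((\<lambda>p. g \<star> p) ` E)
        \<le> cover_content ?w d (closed_balls d) \<delta> E"
      unfolding cover_content_def[of _ _ _ _ E]
    proof (rule INF_greatest)
      fix B assume "B \<in> {B::nat \<Rightarrow> _. (\<forall>i. B i \<in> closed_balls d \<and> ediam d (B i) \<le> ennreal \<delta>) \<and> E \<subseteq> (\<Union>i. B i)}"
      then have B: "\<And>i. B i \<in> closed_balls d" "\<And>i. ediam d (B i) \<le> ennreal \<delta>" "E \<subseteq> (\<Union>i. B i)"
        by auto
      have "(\<lambda>p. g \<star> p) ` B i \<in> closed_balls d" for i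
        using B(1)[of i] unfolding closed_balls_eq by (force simp: image_gmult_gball)
      moreover have "(\<lambda>p. g \<star> p) ` E \<subseteq> (\<Union>i. (\<lambda>p. g \<star> p) ` B i)"
        using B(3) by blast
      ultimately have "cover_content ?w d (closed_balls d) \<delta> ((\<lambda>p. g \<star> p) ` E)
          \<le> (\<Sum>i. ?w ((\<lambda>p. g \<star> p) ` B i))"
        unfolding cover_content_def using B(2) by (intro INF_lower) (simp add: diam)
      then show "cover_content ?w d (closed_balls d) \<delta> ((\<lambda>p. g \<star> p) ` E) \<le> (\<Sum>i. ?w (B i))"
        by (simp add: diam)
    qed
  qed
  from this[of g E] this[of "- g" "(\<lambda>p. g \<star> p) ` E"] show ?thesis
    by (simp add: image_image)
qed

lemma spherical_restrict_translate:
  assumes "m \<ge> 1"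
  shows "spherical_restrict d m ((\<lambda>p. g \<star> p) ` E) = distr (spherical_restrict d m E) borel (\<lambda>p. g \<star> p)"
proof (rule measure_eqI)
  fix A assume "A \<in> sets (spherical_restrict d m ((\<lambda>p. g \<star> p) ` E))"
  then have A [measurable]: "A \<in> sets borel"
    by simp
  have "A \<inter> (\<lambda>p. g \<star> p) ` E = (\<lambda>p. g \<star> p) ` ((\<lambda>p. g \<star> p) -` A \<inter> E)"
    by auto
  moreover have "(\<lambda>p. g \<star> p) -` A \<in> sets borel"
    using measurable_sets[of "\<lambda>p. g \<star> p" borel borel A] by simp
  ultimately show "emeasure (spherical_restrict d m ((\<lambda>p. g \<star> p) ` E)) A
      = emeasure (distr (spherical_restrict d m E) borel (\<lambda>p. g \<star> p)) A"
    using assms by (simp add: emeasure_spherical_restrict emeasure_distr spherical_measure_translate)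
qed simp

lemma emeasure_lborel_gball:
  assumes "r > 0"
  shows "emeasure lborel (gball c r) = ennreal (r ^ (DIM('a) + 2 * DIM('b))) * emeasure lborel (gball 0 1)"
proof -
  have "gball c r = (\<lambda>x. - c \<star> x) -` gball 0 r"
    by (auto simp: mem_gball)
  then have "emeasure lborel (gball c r) = emeasure lborel (gball 0 r)"
    by (simp add: emeasure_lborel_gmult_left)
  also have "\<dots> = ennreal (r ^ (DIM('a) + 2 * DIM('b))) * emeasure lborel (dilation r -` gball 0 r)"
    by (rule emeasure_lborel_dilation) (use assms in auto)
  also have "dilation r -` gball 0 r = gball 0 1"
    using assms by (simp add: set_eq_iff mem_gball N_dilation)
  finally show ?thesis .
qed

lemma emeasure_lborel_gball_finite: "emeasure lborel (gball c r) < \<infinity>"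
  using emeasure_compact_finite[OF compact_gball] by simp

end

section \<open>Homogeneous subgroups and decompositions\<close>

text \<open>Components are chosen pointwise; uniqueness of the decomposition makes the choice
  linear.\<close>

lemma direct_sum_projection:
  fixes A B :: "'a::euclidean_space set"
  assumes A: "subspace A" and B: "subspace B" and int: "A \<inter> B = {0}"
    and sum: "\<And>x. \<exists>a\<in>A. \<exists>b\<in>B. x = a + b"
  shows "\<exists>P. linear P \<and> (\<forall>x. P x \<in> A \<and> x - P x \<in> B)"
proof -
  obtain P where P: "\<And>x. P x \<in> A" "\<And>x. x - P x \<in> B"
    using sum by (metis add_diff_cancel_left')
  have uniq: "a = a'" if "a \<in> A" "a' \<in> A" "x - a \<in> B" "x - a' \<in> B" for a a' x
  proof -
    have "a - a' \<in> A"
      using A that by (simp add: subspace_diff)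
    moreover have "(x - a') - (x - a) \<in> B"
      by (rule subspace_diff[OF B that(4,3)])
    then have "a - a' \<in> B"
      by (simp add: algebra_simps)
    ultimately have "a - a' \<in> A \<inter> B"
      by (rule IntI)
    then show ?thesis
      unfolding int by simp
  qed
  have "P (x + y) = P x + P y" for x y
  proof (rule uniq[of _ _ "x + y"])
    have "(x - P x) + (y - P y) \<in> B"
      using B P by (simp add: subspace_add)
    then show "x + y - (P x + P y) \<in> B"
      by (simp add: algebra_simps)
  qed (use A P in \<open>simp_all add: subspace_add\<close>)
  moreover have "P (c *\<^sub>R x) = c *\<^sub>R P x" for c x
  proof (rule uniq[of _ _ "c *\<^sub>R x"])
    have "c *\<^sub>R (x - P x) \<in> B"
      using B P by (simp add: subspace_scale)
    then show "c *\<^sub>R x - c *\<^sub>R P x \<in> B"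
      by (simp add: scaleR_diff_right)
  qed (use A P in \<open>simp_all add: subspace_scale\<close>)
  ultimately have "linear P"
    by (rule linearI)
  then show ?thesis
    using P by blast
qed

context step_two_group
begin

definition hlayer :: "('a \<times> 'b) set \<Rightarrow> 'a set" where "hlayer M = {x. (x, 0) \<in> M}"
definition vlayer :: "('a \<times> 'b) set \<Rightarrow> 'b set" where "vlayer M = {t. (0, t) \<in> M}"

lemma homogeneous_subgroup_closed:
  assumes "homogeneous_subgroup (carnot_group br) M"
  shows "0 \<in> M" "p \<in> M \<Longrightarrow> q \<in> M \<Longrightarrow> p \<star> q \<in> M" "p \<in> M \<Longrightarrow> - p \<in> M"
    "l > 0 \<Longrightarrow> p \<in> M \<Longrightarrow> dilation l p \<in> M"
proof -
  have M: "subgroup M (carnot_group br)" "\<forall>l>0. dilation l ` M \<subseteq> M"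
    using assms by (auto simp: homogeneous_subgroup_def)
  show "0 \<in> M"
    using subgroup.one_closed[OF M(1)] by simp
  show "p \<in> M \<Longrightarrow> q \<in> M \<Longrightarrow> p \<star> q \<in> M"
    using subgroup.m_closed[OF M(1), of p q] by simp
  show "p \<in> M \<Longrightarrow> - p \<in> M"
    using subgroup.m_inv_closed[OF M(1), of p] by simp
  show "l > 0 \<Longrightarrow> p \<in> M \<Longrightarrow> dilation l p \<in> M"
    using M(2) by blast
qed

text \<open>
  The vertical part of \<open>p\<close> lies in \<open>M\<close> because \<open>(p\<^sup>2)\<^sup>-\<^sup>1 \<delta>\<^sub>2 p\<close> is twice that part.
\<close>

lemma homogeneous_subgroup_layers:
  assumes "homogeneous_subgroup (carnot_group br) M"
  shows "M = hlayer M \<times> vlayer M" "subspace (hlayer M)" "subspace (vlayer M)"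
    "x \<in> hlayer M \<Longrightarrow> y \<in> hlayer M \<Longrightarrow> br x y \<in> vlayer M"
proof -
  note M = homogeneous_subgroup_closed[OF assms]
  \<comment> \<open>A dilation acts on the centre by the square of its factor, so the factor
    \<open>sqrt s\<close> scales by \<open>s\<close>.\<close>
  have scale_pos: "(0, s *\<^sub>R t) \<in> M" if "(0, t) \<in> M" "s > 0" for s t
    using M(4)[of "sqrt s" "(0, t)"] that by (simp add: dilation_def)
  have vert: "(0, snd p) \<in> M" if "p \<in> M" for p
  proof -
    have "- (p \<star> p) \<star> dilation 2 p \<in> M"
      using M(2)[OF M(3)[OF M(2)[OF that that]] M(4)[of 2 p]] that by simp
    also have "- (p \<star> p) \<star> dilation 2 p = (0, 2 *\<^sub>R snd p)"
    proof -
      have "p \<star> p = 2 *\<^sub>R p"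
        by (simp add: gmult_def prod_eq_iff scaleR_2)
      moreover have "4 *\<^sub>R snd p = 2 *\<^sub>R snd p + 2 *\<^sub>R snd p"
        by (simp flip: scaleR_left.add)
      ultimately show ?thesis
        by (simp add: gmult_def dilation_def prod_eq_iff br.minus_left br.scaleR_left br.scaleR_right)
    qed
    finally show ?thesis
      using scale_pos[of "2 *\<^sub>R snd p" "1/2"] by simp
  qed
  have horiz: "(fst p, 0) \<in> M" if "p \<in> M" for p
    using M(2)[OF that M(3)[OF vert[OF that]]] by (simp add: gmult_def br.zero_right)
  have "p \<in> M \<longleftrightarrow> fst p \<in> hlayer M \<and> snd p \<in> vlayer M" for p
    using vert[of p] horiz[of p] M(2)[of "(fst p, 0)" "(0, snd p)"]
    by (auto simp: hlayer_def vlayer_def gmult_def br.zero_right)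
  then show "M = hlayer M \<times> vlayer M"
    by (auto simp: mem_Times_iff)
  show b: "br x y \<in> vlayer M" if "x \<in> hlayer M" "y \<in> hlayer M" for x y
    using vert[OF M(2)[of "(x, 0)" "(y, 0)"]] that scale_pos[of "(1/2) *\<^sub>R br x y" 2]
    by (simp add: hlayer_def vlayer_def gmult_def)
  show "subspace (vlayer M)"
    unfolding subspace_def
  proof (intro conjI ballI allI)
    show "0 \<in> vlayer M"
      using M(1) by (simp add: vlayer_def zero_prod_def)
    show "t + u \<in> vlayer M" if "t \<in> vlayer M" "u \<in> vlayer M" for t u
      using M(2)[of "(0, t)" "(0, u)"] that by (simp add: vlayer_def gmult_def br.zero_right)
    show "c *\<^sub>R t \<in> vlayer M" if "t \<in> vlayer M" for c t
    \<comment> \<open>Dilations give only positive scalars; 0 comes from the neutral element and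
      negative scalars from inverses.\<close>
    proof (cases "c > 0" "c = 0" rule: bool.exhaust[case_product bool.exhaust])
      case False_False
      then have "(0, (- c) *\<^sub>R t) \<in> M"
        using scale_pos[of t "- c"] that by (simp add: vlayer_def)
      then show ?thesis
        using M(3)[of "(0, (- c) *\<^sub>R t)"] by (simp add: vlayer_def)
    qed (use that scale_pos[of t c] M(1) in \<open>simp_all add: vlayer_def zero_prod_def\<close>)
  qed
  show "subspace (hlayer M)"
    unfolding subspace_def
  proof (intro conjI ballI allI)
    show "0 \<in> hlayer M"
      using M(1) by (simp add: hlayer_def zero_prod_def)
    show "x + y \<in> hlayer M" if "x \<in> hlayer M" "y \<in> hlayer M" for x y
      using horiz[OF M(2)[of "(x, 0)" "(y, 0)"]] that by (simp add: hlayer_def)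
    have pos: "c *\<^sub>R x \<in> hlayer M" if "x \<in> hlayer M" "c > 0" for c x
      using M(4)[of c "(x, 0)"] that by (simp add: hlayer_def dilation_def)
    show "c *\<^sub>R x \<in> hlayer M" if "x \<in> hlayer M" for c x
    proof (cases "c > 0" "c = 0" rule: bool.exhaust[case_product bool.exhaust])
      case False_False
      then have "(- c) *\<^sub>R x \<in> hlayer M"
        using pos[of x "- c"] that by simp
      then show ?thesis
        using M(3)[of "((- c) *\<^sub>R x, 0)"] by (simp add: hlayer_def)
    qed (use that pos[of x c] M(1) in \<open>simp_all add: hlayer_def zero_prod_def\<close>)
  qed
qed

end

section \<open>Projections of a decomposition\<close>

locale splitting = homogeneous_group br N
  for br :: "'a::euclidean_space \<Rightarrow> 'a \<Rightarrow> 'b::euclidean_space" and N +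
  fixes M H :: "('a \<times> 'b) set"
  assumes dec: "decomposition (carnot_group br) M H"
begin

lemma subgroups: "homogeneous_subgroup (carnot_group br) M" "homogeneous_subgroup (carnot_group br) H"
  and M_Int_H: "M \<inter> H = {0}"
  and M_gmult_H: "\<exists>m\<in>M. \<exists>h\<in>H. q = m \<star> h"
  using dec unfolding decomposition_def by auto

lemmas M_closed = homogeneous_subgroup_closed[OF subgroups(1)]
lemmas H_closed = homogeneous_subgroup_closed[OF subgroups(2)]
lemmas M_layers = homogeneous_subgroup_layers[OF subgroups(1)]
lemmas H_layers = homogeneous_subgroup_layers[OF subgroups(2)]

abbreviation "M1 \<equiv> hlayer M"
abbreviation "M2 \<equiv> vlayer M"
abbreviation "H1 \<equiv> hlayer H"
abbreviation "H2 \<equiv> vlayer H"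

lemma mem_M_iff: "p \<in> M \<longleftrightarrow> fst p \<in> M1 \<and> snd p \<in> M2"
  by (subst M_layers(1)) (simp add: mem_Times_iff)

lemma mem_H_iff: "p \<in> H \<longleftrightarrow> fst p \<in> H1 \<and> snd p \<in> H2"
  by (subst H_layers(1)) (simp add: mem_Times_iff)

lemma gmult_unique:
  assumes "m \<in> M" "m' \<in> M" "h \<in> H" "h' \<in> H" "m \<star> h = m' \<star> h'"
  shows "m = m'" "h = h'"
proof -
  have "- m' \<star> m = h' \<star> - h"
    using assms(5) by (metis gmult_assoc gmult_cancel(1) gmult_minus(2) gmult_0(2))
  then have "- m' \<star> m \<in> M \<inter> H"
    using assms M_closed H_closed by (metis IntI)
  then have "- m' \<star> m = 0"
    using M_Int_H by simp
  then show "m = m'"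
    by (metis gmult_0(2) gmult_cancel(2))
  then show "h = h'"
    using assms(5) by simp
qed

lemma layers_Int: "M1 \<inter> H1 = {0}" "M2 \<inter> H2 = {0}"
  using M_Int_H M_closed(1) H_closed(1)
  by (auto simp: hlayer_def vlayer_def zero_prod_def)

lemma hlayers_sum: "\<exists>a\<in>M1. \<exists>b\<in>H1. x = a + b"
proof -
  obtain m h where "m \<in> M" "h \<in> H" "(x, 0) = m \<star> h"
    using M_gmult_H by blast
  then show ?thesis
    by (intro bexI[of _ "fst m"] bexI[of _ "fst h"]) (auto simp: mem_M_iff mem_H_iff gmult_def)
qed

text \<open>In the decomposition of a central element the horizontal parts are opposite, hence lie
  in both \<open>M1\<close> and \<open>H1\<close> and vanish; the product is then the sum of the
  vertical parts.\<close>

lemma vlayers_sum: "\<exists>a\<in>M2. \<exists>b\<in>H2. t = a + b"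
proof -
  obtain m h where mh: "m \<in> M" "h \<in> H" "(0, t) = m \<star> h"
    using M_gmult_H by blast
  then have "fst m + fst h = 0"
    by (metis fst_conv fst_gmult)
  then have "fst m = - fst h"
    by (simp add: eq_neg_iff_add_eq_0)
  moreover have in_layers: "fst m \<in> M1" "fst h \<in> H1" "snd m \<in> M2" "snd h \<in> H2"
    using mh(1,2) by (simp_all add: mem_M_iff mem_H_iff)
  ultimately have "fst m \<in> M1 \<inter> H1"
    using subspace_neg[OF H_layers(2)] by simp
  then have "fst m = 0"
    using layers_Int(1) by simp
  then have "t = snd m + snd h"
    using arg_cong[OF mh(3), of snd] by (simp add: snd_gmult br.zero_left)
  then show ?thesis
    using in_layers by blast
qed

text \<open>Linear projections of each layer onto the part in \<open>M\<close> along the part in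
  \<open>H\<close>. They enter both the group projection \<open>PM\<close> and the linear projection
  \<open>\<pi>\<close>.\<close>

definition \<pi>1 :: "'a \<Rightarrow> 'a" where "\<pi>1 = (SOME P. linear P \<and> (\<forall>x. P x \<in> M1 \<and> x - P x \<in> H1))"
definition \<pi>2 :: "'b \<Rightarrow> 'b" where "\<pi>2 = (SOME P. linear P \<and> (\<forall>x. P x \<in> M2 \<and> x - P x \<in> H2))"

lemma \<pi>1: "linear \<pi>1" "\<pi>1 x \<in> M1" "x - \<pi>1 x \<in> H1"
  using someI_ex[OF direct_sum_projection[OF M_layers(2) H_layers(2) layers_Int(1) hlayers_sum]]
  unfolding \<pi>1_def by blast+

lemma \<pi>2: "linear \<pi>2" "\<pi>2 t \<in> M2" "t - \<pi>2 t \<in> H2"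
  using someI_ex[OF direct_sum_projection[OF M_layers(3) H_layers(3) layers_Int(2) vlayers_sum]]
  unfolding \<pi>2_def by blast+

lemma \<pi>1_M1 [simp]: "x \<in> M1 \<Longrightarrow> \<pi>1 x = x"
proof -
  assume "x \<in> M1"
  then have "x - \<pi>1 x \<in> M1 \<inter> H1"
    using \<pi>1 by (simp add: subspace_diff[OF M_layers(2)])
  then show ?thesis
    using layers_Int(1) by simp
qed

lemma \<pi>2_M2 [simp]: "t \<in> M2 \<Longrightarrow> \<pi>2 t = t"
proof -
  assume "t \<in> M2"
  then have "t - \<pi>2 t \<in> M2 \<inter> H2"
    using \<pi>2 by (simp add: subspace_diff[OF M_layers(3)])
  then show ?thesis
    using layers_Int(2) by simp
qed

lemma \<pi>1_H1 [simp]: "x \<in> H1 \<Longrightarrow> \<pi>1 x = 0"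
proof -
  assume "x \<in> H1"
  then have "x - (x - \<pi>1 x) \<in> H1"
    using \<pi>1(3)[of x] by (rule subspace_diff[OF H_layers(2)])
  then show ?thesis
    using layers_Int(1) \<pi>1(2)[of x] by auto
qed

lemma \<pi>2_H2 [simp]: "t \<in> H2 \<Longrightarrow> \<pi>2 t = 0"
proof -
  assume "t \<in> H2"
  then have "t - (t - \<pi>2 t) \<in> H2"
    using \<pi>2(3)[of t] by (rule subspace_diff[OF H_layers(3)])
  then show ?thesis
    using layers_Int(2) \<pi>2(2)[of t] by auto
qed

lemmas \<pi>1_linear = linear_add[OF \<pi>1(1)] linear_diff[OF \<pi>1(1)] linear_scale[OF \<pi>1(1)] linear_0[OF \<pi>1(1)] linear_neg[OF \<pi>1(1)]
lemmas \<pi>2_linear = linear_add[OF \<pi>2(1)] linear_diff[OF \<pi>2(1)] linear_scale[OF \<pi>2(1)] linear_0[OF \<pi>2(1)] linear_neg[OF \<pi>2(1)]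

lemma continuous_on_\<pi>1 [continuous_intros]: "continuous_on S f \<Longrightarrow> continuous_on S (\<lambda>x. \<pi>1 (f x))"
  by (rule bounded_linear.continuous_on[OF \<pi>1(1)[unfolded linear_conv_bounded_linear]])

lemma continuous_on_\<pi>2 [continuous_intros]: "continuous_on S f \<Longrightarrow> continuous_on S (\<lambda>x. \<pi>2 (f x))"
  by (rule bounded_linear.continuous_on[OF \<pi>2(1)[unfolded linear_conv_bounded_linear]])

text \<open>Solving \<open>q = m \<star> h\<close> in coordinates: the vertical part of
  \<open>q\<close> is that of \<open>m\<close> plus that of \<open>h\<close> plus half the bracket
  of \<open>\<pi>1 (fst q)\<close> with the remainder of \<open>fst q\<close>. As \<open>br\<close>
  vanishes on equal arguments, the remainder may be replaced by \<open>fst q\<close>.\<close>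

definition PM :: "'a \<times> 'b \<Rightarrow> 'a \<times> 'b" where
  "PM q = (\<pi>1 (fst q), \<pi>2 (snd q - (1/2) *\<^sub>R br (\<pi>1 (fst q)) (fst q)))"

definition PH :: "'a \<times> 'b \<Rightarrow> 'a \<times> 'b" where
  "PH q = - PM q \<star> q"

lemma PM_in [simp]: "PM q \<in> M"
  by (simp add: mem_M_iff PM_def \<pi>1 \<pi>2)

lemma PM_PH [simp]: "PM q \<star> PH q = q"
  by (simp add: PH_def)

lemma PH_in [simp]: "PH q \<in> H"
proof -
  let ?u = "snd q - (1/2) *\<^sub>R br (\<pi>1 (fst q)) (fst q)"
  have "PH q = (fst q - \<pi>1 (fst q), ?u - \<pi>2 ?u)"
    by (simp add: PH_def PM_def gmult_def prod_eq_iff br.minus_left)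
  then show ?thesis
    by (simp add: mem_H_iff \<pi>1 \<pi>2)
qed

lemma PM_gmult: "m \<in> M \<Longrightarrow> h \<in> H \<Longrightarrow> PM (m \<star> h) = m"
  and PH_gmult: "m \<in> M \<Longrightarrow> h \<in> H \<Longrightarrow> PH (m \<star> h) = h"
  by (rule gmult_unique[OF PM_in _ PH_in _ PM_PH]; assumption)+

lemma PM_M [simp]: "m \<in> M \<Longrightarrow> PM m = m"
  and PH_M [simp]: "m \<in> M \<Longrightarrow> PH m = 0"
  using PM_gmult[of m 0] PH_gmult[of m 0] H_closed(1) by simp_all

lemma PM_gmult_left: "m \<in> M \<Longrightarrow> PM (m \<star> q) = m \<star> PM q"
  using PM_gmult[of "m \<star> PM q" "PH q"] M_closed(2) by (simp add: gmult_assoc)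

lemma PM_gmult_right: "h \<in> H \<Longrightarrow> PM (q \<star> h) = PM q"
  using PM_gmult[of "PM q" "PH q \<star> h"] H_closed(2) by (simp flip: gmult_assoc)

lemma PM_dilation: "l > 0 \<Longrightarrow> PM (dilation l q) = dilation l (PM q)"
  using PM_gmult[of "dilation l (PM q)" "dilation l (PH q)"] M_closed(4) H_closed(4)
  by (simp flip: dilation_gmult)

lemma proj_left_eq: "proj_left (carnot_group br) M H q = PM q"
  unfolding proj_left_def mult_carnot
proof (rule the_equality)
  show "PM q \<in> M \<and> (\<exists>h\<in>H. q = PM q \<star> h)"
    by (intro conjI bexI[of _ "PH q"]) simp_all
qed (auto simp: PM_gmult)

lemma proj_right_eq: "proj_right (carnot_group br) M H q = PH q"
  unfolding proj_right_def mult_carnot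
proof (rule the_equality)
  show "PH q \<in> H \<and> (\<exists>m\<in>M. q = m \<star> PH q)"
    by (intro conjI bexI[of _ "PM q"]) simp_all
qed (auto simp: PH_gmult)

lemma continuous_on_PM: "continuous_on UNIV PM"
  unfolding PM_def[abs_def] by (intro continuous_intros br.continuous_on)

text \<open>The action of \<open>H\<close> on \<open>M\<close> given by multiplying with
  \<open>h\<close> on the left and projecting back, written as a shear of the whole space. The full
  bracket appears because one half comes from the product and the other from the correction in
  \<open>PM\<close>.\<close>

definition twist :: "'a \<times> 'b \<Rightarrow> 'a \<times> 'b \<Rightarrow> 'a \<times> 'b" where
  "twist h q = (fst q, snd q + \<pi>2 (br (fst h) (\<pi>1 (fst q))))"

lemma PM_gmult_H:
  assumes "h \<in> H" "m \<in> M"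
  shows "PM (h \<star> m) = twist h m"
proof -
  have "fst h \<in> H1" "snd h \<in> H2" "fst m \<in> M1" "snd m \<in> M2"
    using assms by (simp_all add: mem_M_iff mem_H_iff)
  moreover have "br (fst m) (fst h) = - br (fst h) (fst m)"
    by (rule br_skew)
  ultimately show ?thesis
    by (simp add: PM_def twist_def gmult_def prod_eq_iff \<pi>1_linear \<pi>2_linear br.add_right
        flip: scaleR_left.add scaleR_left.diff)
qed

lemma twist_in [simp]: "m \<in> M \<Longrightarrow> twist h m \<in> M"
  by (simp add: twist_def mem_M_iff \<pi>2 subspace_add[OF M_layers(3)])

lemma twist_inverse [simp]: "twist (- h) (twist h q) = q" "twist h (twist (- h) q) = q"
  by (simp_all add: twist_def br.minus_left \<pi>2_linear)

lemma continuous_on_twist: "continuous_on UNIV (twist h)"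
  unfolding twist_def[abs_def] by (intro continuous_intros br.continuous_on)

text \<open>In \<open>PM c \<star> (PH c \<star> PM q) \<star> PH q\<close> the left factor from
  \<open>M\<close> comes out of \<open>PM\<close> and the right factor from \<open>H\<close>
  disappears. A translation of the group therefore acts on projections by a shear followed by a
  translation.\<close>

lemma PM_gmult_decomp: "PM (c \<star> q) = PM c \<star> twist (PH c) (PM q)"
proof -
  have "c \<star> q = PM c \<star> (PH c \<star> PM q \<star> PH q)"
    by (simp flip: gmult_assoc) (simp add: gmult_assoc)
  then have "PM (c \<star> q) = PM c \<star> PM (PH c \<star> PM q \<star> PH q)"
    by (simp only: PM_gmult_left PM_in)
  then show ?thesis
    by (simp add: PM_gmult_right PM_gmult_H)
qed

section \<open>Haar measure on the subgroup \<open>M\<close>\<close>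

definition \<pi> :: "'a \<times> 'b \<Rightarrow> 'a \<times> 'b" where "\<pi> q = (\<pi>1 (fst q), \<pi>2 (snd q))"

lemma \<pi>_in [simp]: "\<pi> q \<in> M"
  by (simp add: \<pi>_def mem_M_iff \<pi>1 \<pi>2)

lemma \<pi>_M [simp]: "m \<in> M \<Longrightarrow> \<pi> m = m"
  by (simp add: \<pi>_def mem_M_iff)

lemma continuous_on_\<pi> [continuous_intros]: "continuous_on S f \<Longrightarrow> continuous_on S (\<lambda>x. \<pi> (f x))"
  unfolding \<pi>_def[abs_def] by (intro continuous_intros)

lemma borel_measurable_\<pi> [measurable]: "\<pi> \<in> borel_measurable borel"
  by (intro borel_measurable_continuous_onI continuous_intros)

text \<open>A neighbourhood of \<open>M\<close> of fixed thickness in the complementary directions: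
  fat enough for positive Lebesgue measure, and bounded across \<open>M\<close>, so that bounded
  sets get finite \<open>\<nu>\<close>-measure.\<close>

definition slab :: "('a \<times> 'b) set" where "slab = {q. norm (q - \<pi> q) \<le> 1}"

lemma borel_slab [measurable]: "slab \<in> sets borel"
  unfolding slab_def by (intro borel_closed closed_Collect_le continuous_intros)

text \<open>
  A Haar measure on \<open>M\<close>, obtained by thickening subsets of \<open>M\<close> along \<open>H\<close>.
\<close>

definition \<nu> :: "('a \<times> 'b) measure" where
  "\<nu> = distr (density lborel (indicator slab)) borel \<pi>"

lemma sets_\<nu> [simp, measurable_cong]: "sets \<nu> = sets borel"
  by (simp add: \<nu>_def)

lemma vimage_borel: "f \<in> borel_measurable borel \<Longrightarrow> A \<in> sets borel \<Longrightarrow> f -` A \<in> sets borel"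
  using measurable_sets[of f borel borel A] by simp

lemma emeasure_\<nu>:
  assumes A: "A \<in> sets borel"
  shows "emeasure \<nu> A = emeasure lborel (\<pi> -` A \<inter> slab)"
proof -
  have "\<pi> -` A \<in> sets borel"
    by (rule vimage_borel[OF borel_measurable_\<pi> A])
  then have "emeasure \<nu> A = (\<integral>\<^sup>+x. indicator slab x * indicator (\<pi> -` A) x \<partial>lborel)"
    unfolding \<nu>_def using A by (simp add: emeasure_distr emeasure_density)
  also have "\<dots> = (\<integral>\<^sup>+x. indicator (\<pi> -` A \<inter> slab) x \<partial>lborel)"
    by (intro nn_integral_cong) (auto simp: indicator_def)
  also have "\<dots> = emeasure lborel (\<pi> -` A \<inter> slab)"
    using \<open>\<pi> -` A \<in> sets borel\<close> by (intro nn_integral_indicator) auto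
  finally show ?thesis .
qed

text \<open>\<open>\<nu>\<close> is carried by \<open>M\<close>, the range of \<open>\<pi>\<close>,
  so sets are compared only there.\<close>

lemma emeasure_\<nu>_mono:
  assumes "A \<inter> M \<subseteq> B" "A \<in> sets borel" "B \<in> sets borel"
  shows "emeasure \<nu> A \<le> emeasure \<nu> B"
  unfolding emeasure_\<nu>[OF assms(2)] emeasure_\<nu>[OF assms(3)]
proof (rule emeasure_mono)
  show "\<pi> -` A \<inter> slab \<subseteq> \<pi> -` B \<inter> slab"
    using assms(1) \<pi>_in by blast
  show "\<pi> -` B \<inter> slab \<in> sets lborel"
    using vimage_borel[OF borel_measurable_\<pi> assms(3)] by simp
qed

lemma emeasure_\<nu>_finite:
  assumes "bounded A" "A \<in> sets borel"
  shows "emeasure \<nu> A < \<infinity>"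
proof -
  obtain r where r: "\<And>q. q \<in> A \<Longrightarrow> norm q \<le> r"
    using assms(1) unfolding bounded_iff by blast
  have "\<pi> -` A \<inter> slab \<subseteq> cball 0 (r + 1)"
  proof
    fix q assume "q \<in> \<pi> -` A \<inter> slab"
    then have "norm (\<pi> q) \<le> r" "norm (q - \<pi> q) \<le> 1"
      using r by (auto simp: slab_def)
    then show "q \<in> cball 0 (r + 1)"
      using norm_triangle_ineq[of "\<pi> q" "q - \<pi> q"] by simp
  qed
  then have "emeasure lborel (\<pi> -` A \<inter> slab) \<le> emeasure lborel (cball (0::'a \<times> 'b) (r + 1))"
    by (intro emeasure_mono) auto
  also have "\<dots> < \<infinity>"
    using emeasure_compact_finite[OF compact_cball] by simp
  finally show ?thesis
    by (simp add: emeasure_\<nu>[OF assms(2)])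
qed

lemma emeasure_\<nu>_pos:
  assumes "open U" "0 \<in> U" "U \<subseteq> A" "A \<in> sets borel"
  shows "emeasure \<nu> A > 0"
proof -
  let ?V = "\<pi> -` U \<inter> {q. norm (q - \<pi> q) < 1}"
  have "open ?V"
    using assms(1) by (intro open_Int open_vimage open_Collect_less continuous_intros)
  moreover have "0 \<in> ?V"
    using assms(2) M_closed(1) by simp
  ultimately have "0 < emeasure lborel ?V"
    using haar_measure_lborel[OF skew] unfolding haar_measure_def by blast
  also have "\<dots> \<le> emeasure lborel (\<pi> -` A \<inter> slab)"
    using assms(3) vimage_borel[OF borel_measurable_\<pi> assms(4)]
    by (intro emeasure_mono) (auto simp: slab_def)
  finally show ?thesis
    by (simp add: emeasure_\<nu>[OF assms(4)])
qed

text \<open>As \<open>a\<close> and the values of \<open>\<phi>\<close> lie in the layers of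
  \<open>M\<close>, the map commutes with \<open>\<pi>\<close> and leaves \<open>q - \<pi> q\<close>
  unchanged. It thus preserves the slab, and invariance of Lebesgue measure under shears
  applies.\<close>

lemma emeasure_\<nu>_shear:
  assumes \<phi>: "\<phi> \<in> borel_measurable borel" "\<And>x. \<phi> x \<in> M2" "a \<in> M1" and A: "A \<in> sets borel"
  shows "emeasure \<nu> ((\<lambda>q. (fst q + a, snd q + \<phi> (\<pi>1 (fst q)))) -` A) = emeasure \<nu> A"
proof -
  let ?F = "\<lambda>q. (fst q + a, snd q + \<phi> (\<pi>1 (fst q)))"
  have \<phi>': "(\<lambda>x. \<phi> (\<pi>1 x)) \<in> borel_measurable borel"
    by (rule measurable_compose[OF _ \<phi>(1)]) (intro borel_measurable_continuous_onI continuous_intros)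
  then have F: "?F \<in> borel_measurable borel"
    unfolding borel_prod[symmetric] by measurable
  have "\<pi> (?F q) = ?F (\<pi> q)" for q
    using \<phi>(2,3) \<pi>1(2) by (simp add: \<pi>_def \<pi>1_linear \<pi>2_linear)
  moreover from this have "?F q - \<pi> (?F q) = q - \<pi> q" for q
    using \<pi>1(2) by (simp add: \<pi>_def prod_eq_iff)
  ultimately have "\<pi> -` (?F -` A) \<inter> slab = ?F -` (\<pi> -` A \<inter> slab)"
    unfolding slab_def vimage_def by (simp add: Int_def)
  moreover have "\<pi> -` A \<inter> slab \<in> sets borel"
    using vimage_borel[OF borel_measurable_\<pi> A] by simp
  ultimately show ?thesis
    by (simp only: emeasure_\<nu>[OF A] emeasure_\<nu>[OF vimage_borel[OF F A]] emeasure_lborel_shear[OF \<phi>'])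
qed

lemma emeasure_\<nu>_twist:
  assumes A: "A \<in> sets borel"
  shows "emeasure \<nu> (twist h -` A) = emeasure \<nu> A"
proof -
  have "(\<lambda>x. \<pi>2 (br (fst h) x)) \<in> borel_measurable borel"
    by (intro borel_measurable_continuous_onI continuous_intros br.continuous_on)
  from emeasure_\<nu>_shear[OF this \<pi>2(2) subspace_0[OF M_layers(2)] A] show ?thesis
    by (simp add: twist_def[abs_def])
qed

lemma emeasure_\<nu>_gmult:
  assumes A: "A \<in> sets borel" and m: "m \<in> M"
  shows "emeasure \<nu> ((\<lambda>q. m \<star> q) -` A) = emeasure \<nu> A"
proof -
  let ?\<phi> = "\<lambda>x. snd m + (1/2) *\<^sub>R br (fst m) (\<pi>1 x)"
  let ?F = "\<lambda>q. (fst q + fst m, snd q + ?\<phi> (\<pi>1 (fst q)))"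
  have m': "fst m \<in> M1" "snd m \<in> M2"
    using m by (simp_all add: mem_M_iff)
  have \<phi>: "?\<phi> \<in> borel_measurable borel"
    by (intro borel_measurable_continuous_onI continuous_intros br.continuous_on)
  have \<phi>': "?\<phi> x \<in> M2" for x
    using m' \<pi>1(2) by (intro subspace_add[OF M_layers(3)] subspace_scale[OF M_layers(3)] M_layers(4))
  have F: "?F \<in> borel_measurable borel"
    by (intro borel_measurable_continuous_onI continuous_intros br.continuous_on)
  \<comment> \<open>The shear and the left translation agree on \<open>M\<close>, which is all that
    \<open>\<nu>\<close> sees.\<close>
  have eq: "?F q = m \<star> q" if "q \<in> M" for q
    using that by (simp add: gmult_def mem_M_iff algebra_simps)
  have "emeasure \<nu> (?F -` A) = emeasure \<nu> A"
    by (rule emeasure_\<nu>_shear[OF \<phi> \<phi>' m'(1) A])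
  moreover have "(\<lambda>q. m \<star> q) -` A \<in> sets borel"
    by (rule vimage_borel[OF _ A]) measurable
  then have "emeasure \<nu> (?F -` A) = emeasure \<nu> ((\<lambda>q. m \<star> q) -` A)"
    using eq vimage_borel[OF F A] by (intro antisym emeasure_\<nu>_mono) (auto simp del: fst_gmult)
  ultimately show ?thesis
    by simp
qed

definition hdim :: nat where "hdim = dim M1 + 2 * dim M2"

text \<open>A group dilation would change the thickness of the slab. The map \<open>?E\<close>
  dilates along \<open>M\<close> only and fixes the complementary component, so the slab stays and
  only the layers of \<open>M\<close> contribute to the factor.\<close>

lemma emeasure_\<nu>_dilation:
  assumes A: "A \<in> sets borel" and r: "r > 0"
  shows "emeasure \<nu> A = ennreal (r ^ hdim) * emeasure \<nu> (dilation r -` A)"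
proof -
  let ?B = "\<pi> -` A \<inter> slab"
  let ?E = "\<lambda>q. (r *\<^sub>R \<pi>1 (fst q) + (fst q - \<pi>1 (fst q)), r\<^sup>2 *\<^sub>R \<pi>2 (snd q) + (snd q - \<pi>2 (snd q)))"
  have "?B \<in> sets borel"
    using vimage_borel[OF borel_measurable_\<pi> A] by simp
  then have "emeasure lborel ?B
      = ennreal (r ^ (dim (range \<pi>1) + 2 * dim (range \<pi>2))) * emeasure lborel (?E -` ?B)"
    using \<pi>1 \<pi>2 r by (intro emeasure_lborel_scale_layers) simp_all
  moreover have "range \<pi>1 = M1" "range \<pi>2 = M2"
    using \<pi>1(2) \<pi>2(2) \<pi>1_M1[symmetric] \<pi>2_M2[symmetric] by (blast intro: range_eqI)+
  moreover have "?E -` ?B = \<pi> -` (dilation r -` A) \<inter> slab"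
  proof -
    have \<pi>E: "\<pi> (?E q) = dilation r (\<pi> q)" for q
      by (simp add: \<pi>_def dilation_def \<pi>1_linear \<pi>2_linear \<pi>1 \<pi>2)
    have diff: "?E q - dilation r (\<pi> q) = q - \<pi> q" for q
      by (simp add: \<pi>_def dilation_def prod_eq_iff)
    show ?thesis
      by (rule Set.set_eqI) (simp only: vimage_eq Int_iff slab_def mem_Collect_eq \<pi>E diff)
  qed
  ultimately show ?thesis
    by (simp only: hdim_def emeasure_\<nu>[OF A] emeasure_\<nu>[OF vimage_borel[OF borel_measurable_dilation A]])
qed

end

section \<open>Dimension and regularity of graphs\<close>

lemma ennpowr_mono: "x \<le> y \<Longrightarrow> 0 \<le> s \<Longrightarrow> ennpowr x s \<le> ennpowr y s"
proof -
  assume "x \<le> y" "0 \<le> s"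
  then show ?thesis
    by (cases x; cases y) (simp_all add: ennpowr_def top_unique ennreal_leI powr_mono2)
qed

lemma ennpowr_ennreal: "0 \<le> x \<Longrightarrow> ennpowr (ennreal x) s = ennreal (x powr s)"
  by (simp add: ennpowr_def)

lemma ediam_empty [simp]: "ediam d {} = 0"
  by (simp add: ediam_def bot_ennreal)

lemma ennreal_le_0_if_le_all:
  fixes x K :: ennreal
  assumes "K < \<infinity>" "m \<ge> 1" "\<And>r. r > 0 \<Longrightarrow> x \<le> ennreal (r ^ m) * K"
  shows "x = 0"
proof -
  obtain k where k: "K = ennreal k" "k \<ge> 0"
    using assms(1) by (cases K) auto
  have "x \<le> 0 + ennreal e" if e: "e > 0" for e
  proof -
    define r where "r = min 1 (e / (k + 1))"
    have "r \<le> e / (k + 1)"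
      by (simp add: r_def)
    then have r: "r > 0" "r \<le> 1" "r * (k + 1) \<le> e"
      using e k by (simp_all only: pos_le_divide_eq) (simp_all add: r_def)
    have "r ^ m * k \<le> r * k"
      using power_decreasing[of 1 m r] r assms(2) k by (intro mult_right_mono) auto
    also have "\<dots> \<le> e"
      using r k by (simp add: algebra_simps)
    finally have "ennreal (r ^ m) * K \<le> ennreal e"
      using r(1) k by (simp add: k(1) ennreal_leI flip: ennreal_mult)
    then show ?thesis
      using assms(3)[OF r(1)] by simp
  qed
  then have "x \<le> 0"
    by (rule ennreal_le_epsilon)
  then show ?thesis
    by simp
qed

context homogeneous_group
begin

lemma gball_mono: "r \<le> s \<Longrightarrow> gball c r \<subseteq> gball c s"
  by (auto simp: gball_def)

lemma gball_vimage_gmult: "(\<lambda>q. c \<star> q) -` gball c r = gball 0 r"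
  by (simp add: set_eq_iff mem_gball)

lemma gball_vimage_dilation: "r > 0 \<Longrightarrow> dilation r -` gball 0 (r * s) = gball 0 s"
  by (simp add: set_eq_iff mem_gball N_dilation)

lemma gauge_hausdorff: "s > 0 \<Longrightarrow> gauge (\<lambda>B. ennpowr (ediam d B) s) d UNIV"
proof
  fix \<epsilon> :: real assume "0 < s" "0 < \<epsilon>"
  then show "\<exists>B\<in>UNIV. ediam d B \<le> ennreal \<epsilon> \<and> ennpowr (ediam d B) s \<le> ennreal \<epsilon>"
    by (intro bexI[of _ "{}"]) (simp_all add: ennpowr_def)
qed

end

section \<open>Covering numbers and Hausdorff dimension of \<open>M\<close>\<close>

context splitting
begin

lemma emeasure_\<nu>_gball:
  assumes "m \<in> M" "r > 0"
  shows "emeasure \<nu> (gball m r) = ennreal (r ^ hdim) * emeasure \<nu> (gball 0 1)"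
proof -
  have "emeasure \<nu> (gball m r) = emeasure \<nu> (gball 0 r)"
    using emeasure_\<nu>_gmult[OF borel_gball assms(1)] by (metis gball_vimage_gmult)
  also have "\<dots> = ennreal (r ^ hdim) * emeasure \<nu> (dilation r -` gball 0 r)"
    by (rule emeasure_\<nu>_dilation[OF borel_gball assms(2)])
  also have "dilation r -` gball 0 r = gball 0 1"
    using gball_vimage_dilation[OF assms(2), of 1] by simp
  finally show ?thesis .
qed

lemma emeasure_\<nu>_gball_finite: "emeasure \<nu> (gball c r) < \<infinity>"
  by (rule emeasure_\<nu>_finite[OF compact_imp_bounded[OF compact_gball] borel_gball])

lemma emeasure_\<nu>_gball_pos: "0 < emeasure \<nu> (gball 0 1)"
proof (rule emeasure_\<nu>_pos)
  show "open {p. N p < 1}"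
    by (intro open_Collect_less continuous_intros)
qed (auto simp: mem_gball)

lemma compact_PM_gball: "compact (PM ` gball c r)"
  by (rule compact_continuous_image[OF continuous_on_subset[OF continuous_on_PM] compact_gball]) simp

lemma borel_PM_gball [measurable]: "PM ` gball c r \<in> sets borel"
  by (rule borel_compact[OF compact_PM_gball])

lemma emeasure_\<nu>_PM_gball_finite: "emeasure \<nu> (PM ` gball c r) < \<infinity>"
  by (rule emeasure_\<nu>_finite[OF compact_imp_bounded[OF compact_PM_gball] borel_PM_gball])

text \<open>
  Up to a translation and a shear of \<open>M\<close>, both of which preserve \<open>\<nu>\<close>, the projection of a ball does
  not depend on its centre.
\<close>

lemma emeasure_\<nu>_PM_gball:
  assumes "r > 0"
  shows "emeasure \<nu> (PM ` gball c r) \<le> ennreal (r ^ hdim) * emeasure \<nu> (PM ` gball 0 1)"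
proof -
  let ?X = "PM ` gball c r" and ?Y = "PM ` gball 0 r"
  let ?Z = "(\<lambda>q. PM c \<star> q) -` ?X"
  have Z: "?Z \<in> sets borel"
    by (rule vimage_borel[OF _ borel_PM_gball]) measurable
  have tZ: "twist (PH c) -` ?Z \<in> sets borel"
    by (rule vimage_borel[OF borel_measurable_continuous_onI[OF continuous_on_twist] Z])
  have "emeasure \<nu> ?X = emeasure \<nu> (twist (PH c) -` ?Z)"
    by (simp only: emeasure_\<nu>_gmult[OF borel_PM_gball PM_in] emeasure_\<nu>_twist[OF Z])
  also have "\<dots> \<le> emeasure \<nu> ?Y"
  proof (rule emeasure_\<nu>_mono[OF _ tZ borel_PM_gball])
    show "twist (PH c) -` ?Z \<inter> M \<subseteq> ?Y"
    proof
      fix q assume "q \<in> twist (PH c) -` ?Z \<inter> M"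
      then obtain p where p: "p \<in> gball c r" "PM c \<star> twist (PH c) q = PM p"
        by auto
      obtain b where b: "b \<in> gball 0 r" "p = c \<star> b"
        using p(1) unfolding gball_translate[of c] by blast
      have "twist (PH c) q = twist (PH c) (PM b)"
        using p(2) unfolding b(2) PM_gmult_decomp by simp
      then have "q = PM b"
        by (metis twist_inverse(1))
      then show "q \<in> ?Y"
        using b(1) by simp
    qed
  qed
  also have "\<dots> = ennreal (r ^ hdim) * emeasure \<nu> (dilation r -` ?Y)"
    by (rule emeasure_\<nu>_dilation[OF borel_PM_gball assms])
  also have "\<dots> \<le> ennreal (r ^ hdim) * emeasure \<nu> (PM ` gball 0 1)"
  proof (intro mult_left_mono emeasure_\<nu>_mono)
    show "dilation r -` ?Y \<inter> M \<subseteq> PM ` gball 0 1"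
    proof
      fix q assume "q \<in> dilation r -` ?Y \<inter> M"
      then obtain p where p: "p \<in> gball 0 r" "dilation r q = PM p"
        by auto
      have "q = dilation (inverse r) (dilation r q)"
        using assms by (simp only: dilation_inverse)
      also have "\<dots> = PM (dilation (inverse r) p)"
        using assms by (simp add: p(2) PM_dilation)
      finally have "q = PM (dilation (inverse r) p)" .
      moreover have "dilation (inverse r) p \<in> gball 0 1"
        using p(1) assms by (simp add: mem_gball N_dilation field_simps)
      ultimately show "q \<in> PM ` gball 0 1"
        by (rule image_eqI)
    qed
  qed (auto intro: vimage_borel[OF borel_measurable_dilation])
  finally show ?thesis .
qed

text \<open>Volume packing with \<open>\<nu>\<close>: the balls of radius
  \<open>\<epsilon> / 2\<close> about the points of \<open>C\<close> are disjoint and lie in the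
  ball of radius \<open>2 * R\<close>; the ratio of these radii is
  \<open>4 * R / \<epsilon>\<close>.\<close>

lemma card_separated_le:
  assumes C: "finite C" "C \<subseteq> M \<inter> gball 0 R" and sep: "\<And>x y. x \<in> C \<Longrightarrow> y \<in> C \<Longrightarrow> x \<noteq> y \<Longrightarrow> d x y > \<epsilon>"
    and \<epsilon>: "0 < \<epsilon>" "\<epsilon> \<le> R"
  shows "real (card C) \<le> (4 * R / \<epsilon>) ^ hdim"
proof -
  let ?\<kappa> = "emeasure \<nu> (gball 0 1)"
  obtain k where k: "?\<kappa> = ennreal k" "k > 0"
    using emeasure_\<nu>_gball_pos emeasure_\<nu>_gball_finite[of 0 1] by (cases ?\<kappa>) auto
  have "disjoint_family_on (\<lambda>c. gball c (\<epsilon> / 2)) C"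
    unfolding disjoint_family_on_def
  proof (intro ballI impI)
    fix x y assume xy: "x \<in> C" "y \<in> C" "x \<noteq> y"
    show "gball x (\<epsilon> / 2) \<inter> gball y (\<epsilon> / 2) = {}"
    proof (rule ccontr)
      assume "\<not> ?thesis"
      then obtain p where "d p x \<le> \<epsilon> / 2" "d p y \<le> \<epsilon> / 2"
        by (auto simp: gball_def)
      then have "d x y \<le> \<epsilon>"
        using d_triangle[of x y p] d_sym[of x p] by linarith
      then show False
        using sep[OF xy] by simp
    qed
  qed
  then have "(\<Sum>c\<in>C. emeasure \<nu> (gball c (\<epsilon> / 2))) = emeasure \<nu> (\<Union>c\<in>C. gball c (\<epsilon> / 2))"
    using C(1) by (intro sum_emeasure) auto
  also have "\<dots> \<le> emeasure \<nu> (gball 0 (2 * R))"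
  proof (intro emeasure_mono UN_least subsetI)
    fix c p assume "c \<in> C" "p \<in> gball c (\<epsilon> / 2)"
    then have "d c 0 \<le> R" "d p c \<le> \<epsilon> / 2"
      using C(2) by (auto simp: gball_def)
    then have "d p 0 \<le> 2 * R"
      using d_triangle[of p 0 c] \<epsilon> by linarith
    then show "p \<in> gball 0 (2 * R)"
      by (simp add: gball_def)
  qed simp
  also have "\<dots> = ennreal ((2 * R) ^ hdim * k)"
    using \<epsilon> k emeasure_\<nu>_gball[OF M_closed(1), of "2 * R"] by (simp add: ennreal_mult)
  also have "(\<Sum>c\<in>C. emeasure \<nu> (gball c (\<epsilon> / 2))) = (\<Sum>c\<in>C. ennreal ((\<epsilon> / 2) ^ hdim * k))"
    using \<epsilon> k C(2) by (intro sum.cong refl) (subst emeasure_\<nu>_gball, auto simp: ennreal_mult)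
  also have "\<dots> = ennreal (real (card C) * ((\<epsilon> / 2) ^ hdim * k))"
    using \<epsilon> k by (simp add: ennreal_of_nat_eq_real_of_nat ennreal_mult)
  finally have "real (card C) * ((\<epsilon> / 2) ^ hdim * k) \<le> (2 * R) ^ hdim * k"
    using \<epsilon> k by (simp add: ennreal_le_iff)
  then have "real (card C) * (\<epsilon> / 2) ^ hdim \<le> (2 * R) ^ hdim"
    using k by (simp flip: mult.assoc)
  then have "real (card C) \<le> (2 * R) ^ hdim / (\<epsilon> / 2) ^ hdim"
    using \<epsilon> by (simp add: pos_le_divide_eq)
  also have "\<dots> = (4 * R / \<epsilon>) ^ hdim"
    by (simp only: power_divide[symmetric]) simp
  finally show ?thesis .
qed

text \<open>A separated set of largest cardinality is a net, since an uncovered point could be added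
  to it. The packing bound guarantees that a largest one exists.\<close>

lemma exists_net:
  assumes \<epsilon>: "0 < \<epsilon>" "\<epsilon> \<le> R"
  obtains C where "finite C" "C \<subseteq> M" "real (card C) \<le> (4 * R / \<epsilon>) ^ hdim"
    "M \<inter> gball 0 R \<subseteq> (\<Union>c\<in>C. gball c \<epsilon>)"
proof -
  define P where "P C \<longleftrightarrow> finite C \<and> C \<subseteq> M \<inter> gball 0 R \<and>
      (\<forall>x\<in>C. \<forall>y\<in>C. x \<noteq> y \<longrightarrow> d x y > \<epsilon>)" for C
  have bound: "card C \<le> nat \<lfloor>(4 * R / \<epsilon>) ^ hdim\<rfloor>" if "P C" for C
    using card_separated_le[of C R \<epsilon>] that \<epsilon> unfolding P_def by (simp add: le_nat_floor)
  have "P {}"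
    by (simp add: P_def)
  then have "\<exists>C. P C \<and> (\<forall>C'. P C' \<longrightarrow> card C' \<le> card C)"
  proof (rule ex_has_greatest_nat)
    show "\<forall>C. P C \<longrightarrow> card C < Suc (nat \<lfloor>(4 * R / \<epsilon>) ^ hdim\<rfloor>)"
      using bound by (simp add: less_Suc_eq_le)
  qed
  then obtain C where C: "P C" "\<And>C'. P C' \<Longrightarrow> card C' \<le> card C"
    by (elim exE conjE) simp
  have "M \<inter> gball 0 R \<subseteq> (\<Union>c\<in>C. gball c \<epsilon>)"
  proof (rule ccontr)
    assume "\<not> ?thesis"
    then obtain x where x: "x \<in> M \<inter> gball 0 R" "\<And>c. c \<in> C \<Longrightarrow> x \<notin> gball c \<epsilon>"
      by blast
    then have far: "d x c > \<epsilon>" "d c x > \<epsilon>" if "c \<in> C" for c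
      using x(2)[OF that] d_sym[of x c] by (simp_all add: gball_def)
    then have "x \<notin> C"
      using \<epsilon>(1) far(1)[of x] by auto
    moreover have "P (insert x C)"
      using C(1) x(1) far unfolding P_def by blast
    ultimately show False
      using C unfolding P_def by (metis card_insert_disjoint not_less_eq_eq order_refl)
  qed
  moreover have "real (card C) \<le> (4 * R / \<epsilon>) ^ hdim"
    using C(1) \<epsilon> unfolding P_def by (intro card_separated_le) auto
  ultimately show ?thesis
    using C(1) unfolding P_def by (intro that[of C]) auto
qed

text \<open>The number of balls in a net times a bound for the weight of one; it serves the
  spherical and the Hausdorff upper bounds alike.\<close>

lemma cover_content_net_le:
  assumes g: "gauge w d \<C>" and \<delta>: "\<delta> > 0" and \<epsilon>: "0 < \<epsilon>" "\<epsilon> \<le> R" "2 * \<epsilon> \<le> \<delta>"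
    and \<C>: "\<And>c. gball c \<epsilon> \<in> \<C>" and w: "\<And>c. w (gball c \<epsilon>) \<le> ennreal W" and W: "W \<ge> 0"
  shows "cover_content w d \<C> \<delta> (M \<inter> gball 0 R) \<le> ennreal ((4 * R / \<epsilon>) ^ hdim * W)"
proof -
  interpret gauge w d \<C> by (rule g)
  obtain C where C: "finite C" "real (card C) \<le> (4 * R / \<epsilon>) ^ hdim"
    "M \<inter> gball 0 R \<subseteq> (\<Union>c\<in>C. gball c \<epsilon>)"
    by (rule exists_net[OF \<epsilon>(1,2)])
  obtain f where f: "bij_betw f {..<card C} C"
    using C(1) by (metis bij_betw_from_nat_into_finite)
  have "M \<inter> gball 0 R \<subseteq> (\<Union>i\<in>{..<card C}. gball (f i) \<epsilon>)"
  proof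
    fix x assume "x \<in> M \<inter> gball 0 R"
    then obtain c where c: "c \<in> C" "x \<in> gball c \<epsilon>"
      using C(3) by blast
    have "c \<in> f ` {..<card C}"
      unfolding bij_betw_imp_surj_on[OF f] by (rule c(1))
    then obtain i where "c = f i" "i \<in> {..<card C}"
      by (rule imageE)
    then show "x \<in> (\<Union>i\<in>{..<card C}. gball (f i) \<epsilon>)"
      using c(2) by blast
  qed
  moreover have "ediam d (gball (f i) \<epsilon>) \<le> ennreal \<delta>" for i
    using ediam_gball_le[of "f i" \<epsilon>] \<epsilon>(3) by (meson ennreal_leI order_trans)
  ultimately have "cover_content w d \<C> \<delta> (M \<inter> gball 0 R)
      \<le> (\<Sum>i. if i \<in> {..<card C} then w (gball (f i) \<epsilon>) else 0)"
    using \<delta> \<C> by (intro cover_content_le)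
  also have "\<dots> = (\<Sum>i<card C. w (gball (f i) \<epsilon>))"
    by (subst suminf_finite[of "{..<card C}"]) auto
  also have "\<dots> \<le> (\<Sum>i<card C. ennreal W)"
    by (intro sum_mono w)
  also have "\<dots> = ennreal (real (card C) * W)"
    using W by (simp add: ennreal_of_nat_eq_real_of_nat ennreal_mult)
  also have "\<dots> \<le> ennreal ((4 * R / \<epsilon>) ^ hdim * W)"
    using C(2) W by (intro ennreal_leI mult_right_mono)
  finally show ?thesis .
qed

text \<open>At scale \<open>\<delta>\<close> a net of balls of radius \<open>\<delta> / 2\<close>
  has at most \<open>(8 / \<delta>) ^ hdim\<close> members, each of weight at most
  \<open>\<delta> ^ m\<close>; for \<open>m\<close> at least \<open>hdim\<close> the product is
  bounded by \<open>8 ^ hdim\<close>.\<close>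

lemma spherical_measure_finite:
  assumes m: "m \<ge> 1" "m \<ge> hdim"
  shows "spherical_measure d m (M \<inter> gball 0 1) < \<infinity>"
proof -
  have "spherical_measure d m (M \<inter> gball 0 1) \<le> ennreal (8 ^ hdim)"
    unfolding spherical_measure_gauge
  proof (rule gauge_measure_le_small_scales[of 1])
    fix \<delta> :: real assume \<delta>: "0 < \<delta>" "\<delta> < 1"
    have "gball c (\<delta> / 2) \<in> closed_balls d" for c
      unfolding closed_balls_eq using \<delta> by force
    moreover have "ediam d (gball c (\<delta> / 2)) ^ m \<le> ennreal (\<delta> ^ m)" for c
      using power_mono[OF ediam_gball_le[of c "\<delta> / 2"], of m] \<delta> by (simp add: ennreal_power)
    ultimately have "cover_content (\<lambda>B. ediam d B ^ m) d (closed_balls d) \<delta> (M \<inter> gball 0 1)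
        \<le> ennreal ((4 * 1 / (\<delta> / 2)) ^ hdim * \<delta> ^ m)"
      using \<delta> by (intro cover_content_net_le gauge_spherical m(1)) auto
    also have "(4 * 1 / (\<delta> / 2)) ^ hdim * \<delta> ^ m \<le> 8 ^ hdim"
    proof -
      have "(4 * 1 / (\<delta> / 2)) ^ hdim * \<delta> ^ m = 8 ^ hdim * (\<delta> ^ m / \<delta> ^ hdim)"
        by (simp add: power_divide)
      also have "\<delta> ^ m / \<delta> ^ hdim = \<delta> ^ (m - hdim)"
        using \<delta> m(2) by (simp add: power_diff)
      also have "\<delta> ^ (m - hdim) \<le> 1"
        using \<delta> by (simp add: power_le_one)
      finally show ?thesis
        by simp
    qed
    finally show "cover_content (\<lambda>B. ediam d B ^ m) d (closed_balls d) \<delta> (M \<inter> gball 0 1) \<le> ennreal (8 ^ hdim)"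
      by (simp add: ennreal_leI)
  qed simp
  then show ?thesis
    by (simp add: le_less_trans)
qed

text \<open>Nets of radius \<open>x / 2\<close> bound the content of a ball of \<open>M\<close> by a
  constant times \<open>x powr (s - hdim)\<close>, which tends to 0 with \<open>x\<close>. Countably
  many balls exhaust \<open>M\<close>.\<close>

lemma hausdorff_measure_eq_0:
  assumes s: "s > real hdim"
  shows "hausdorff_measure d s M = 0"
proof -
  have "s > 0"
    using s of_nat_0_le_iff[of hdim, where 'a = real] by linarith
  interpret gauge "\<lambda>B. ennpowr (ediam d B) s" d UNIV
    by (rule gauge_hausdorff) fact
  let ?w = "\<lambda>B. ennpowr (ediam d B) s"
  have ball: "cover_content ?w d UNIV \<delta> (M \<inter> gball 0 R) = 0" if \<delta>: "\<delta> > 0" and R: "R \<ge> 1" for \<delta> R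
  proof -
    have "cover_content ?w d UNIV \<delta> (M \<inter> gball 0 R) \<le> 0 + ennreal e" if e: "e > 0" for e
    proof -
      \<comment> \<open>The last term solves \<open>(8 * R) ^ hdim * x powr (s - hdim) = e\<close>;
        the others keep \<open>x\<close> at most \<open>\<delta>\<close> and at most 1.\<close>
      define x where "x = min (min \<delta> 1) ((e / (8 * R) ^ hdim) powr (1 / (s - hdim)))"
      have x: "x > 0" "x \<le> \<delta>" "x \<le> 1"
        using \<delta> e R by (auto simp: x_def)
      have "x powr (s - hdim) \<le> ((e / (8 * R) ^ hdim) powr (1 / (s - hdim))) powr (s - hdim)"
        using s x by (intro powr_mono2) (auto simp: x_def)
      also have "\<dots> = e / (8 * R) ^ hdim"
        using s e R by (simp add: powr_powr)
      finally have xs: "(8 * R) ^ hdim * x powr (s - hdim) \<le> e"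
        using R by (simp add: field_simps)
      have "cover_content ?w d UNIV \<delta> (M \<inter> gball 0 R) \<le> ennreal ((4 * R / (x / 2)) ^ hdim * x powr s)"
      proof (rule cover_content_net_le[OF gauge_axioms \<delta>])
        show "ennpowr (ediam d (gball c (x / 2))) s \<le> ennreal (x powr s)" for c
          using ennpowr_mono[OF ediam_gball_le[of c "x / 2"], of s] \<open>s > 0\<close> x by (simp add: ennpowr_ennreal)
      qed (use x R in auto)
      also have "(4 * R / (x / 2)) ^ hdim * x powr s = (8 * R) ^ hdim * (x powr s / x ^ hdim)"
        by (simp add: power_divide)
      also have "x powr s / x ^ hdim = x powr (s - hdim)"
        using x by (simp add: powr_diff powr_realpow)
      also have "ennreal ((8 * R) ^ hdim * x powr (s - hdim)) \<le> 0 + ennreal e"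
        using xs by (simp add: ennreal_leI)
      finally show ?thesis .
    qed
    then have "cover_content ?w d UNIV \<delta> (M \<inter> gball 0 R) \<le> 0"
      by (rule ennreal_le_epsilon)
    then show ?thesis
      by simp
  qed
  have M: "M = (\<Union>n. M \<inter> gball 0 (real (Suc n)))"
  proof -
    have "\<exists>n. p \<in> gball 0 (real (Suc n))" for p
    proof -
      obtain n where "N p < real n"
        using reals_Archimedean2 by blast
      then show ?thesis
        by (intro exI[of _ n]) (simp add: mem_gball)
    qed
    then show ?thesis
      by blast
  qed
  have "hausdorff_measure d s M \<le> 0"
    unfolding hausdorff_measure_gauge
  proof (rule gauge_measure_le_small_scales[of 1])
    fix \<delta> :: real assume "0 < \<delta>"
    then have "cover_content ?w d UNIV \<delta> (\<Union>n. M \<inter> gball 0 (real (Suc n)))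
        \<le> (\<Sum>n. cover_content ?w d UNIV \<delta> (M \<inter> gball 0 (real (Suc n))))"
      by (rule cover_content_UN)
    also have "\<dots> = 0"
      using ball[OF \<open>0 < \<delta>\<close>] by simp
    finally show "cover_content ?w d UNIV \<delta> M \<le> 0"
      unfolding M[symmetric] .
  qed simp
  then show ?thesis
    by simp
qed

lemma emeasure_\<nu>_gball_0:
  assumes "hdim \<ge> 1" "m \<in> M"
  shows "emeasure \<nu> (gball m 0) = 0"
proof (rule ennreal_le_0_if_le_all[OF emeasure_\<nu>_gball_finite assms(1)])
  fix r :: real assume "r > 0"
  have "emeasure \<nu> (gball m 0) \<le> emeasure \<nu> (gball m r)"
    using \<open>r > 0\<close> by (intro emeasure_mono gball_mono) auto
  then show "emeasure \<nu> (gball m 0) \<le> ennreal (r ^ hdim) * emeasure \<nu> (gball 0 1)"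
    using emeasure_\<nu>_gball[OF assms(2) \<open>r > 0\<close>] by simp
qed

text \<open>Mass distribution principle: a covering set that meets \<open>M\<close> is replaced by a
  ball about one of its points in \<open>M\<close> whose radius is its diameter. As this radius is
  at most 1, its \<open>\<nu>\<close>-measure is at most \<open>?\<kappa>\<close> times the weight,
  and the positive finite factor \<open>?\<kappa>\<close> cancels.\<close>

lemma hausdorff_measure_pos:
  assumes s: "0 < s" "s \<le> real hdim" and hdim: "hdim \<ge> 1"
  shows "hausdorff_measure d s M \<noteq> 0"
proof -
  let ?w = "\<lambda>B. ennpowr (ediam d B) s"
  let ?\<kappa> = "emeasure \<nu> (gball 0 1)"
  have "1 \<le> cover_content ?w d UNIV 1 M"
    unfolding cover_content_def
  proof (rule INF_greatest)
    fix A assume "A \<in> {A::nat \<Rightarrow> ('a \<times> 'b) set. (\<forall>i. A i \<in> UNIV \<and> ediam d (A i) \<le> ennreal 1) \<and> M \<subseteq> (\<Union>i. A i)}"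
    then have A: "\<And>i. ediam d (A i) \<le> 1" "M \<subseteq> (\<Union>i. A i)"
      by auto
    define r where "r i = enn2real (ediam d (A i))" for i
    have r: "ediam d (A i) = ennreal (r i)" "0 \<le> r i" "r i \<le> 1" for i
      using A(1)[of i] unfolding r_def by (cases "ediam d (A i)"; auto simp: top_unique)+
    define a where "a i = (SOME p. p \<in> A i \<and> p \<in> M)" for i
    define B where "B i = (if A i \<inter> M = {} then {} else gball (a i) (r i))" for i
    have a: "a i \<in> A i" "a i \<in> M" if "A i \<inter> M \<noteq> {}" for i
      using that someI_ex[of "\<lambda>p. p \<in> A i \<and> p \<in> M"] unfolding a_def by blast+
    have B: "B i \<in> sets borel" for i
      by (simp add: B_def)
    have AB: "A i \<inter> M \<subseteq> B i" for i
    proof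
      fix p assume p: "p \<in> A i \<inter> M"
      then have "ennreal (d p (a i)) \<le> ennreal (r i)"
        unfolding r(1)[symmetric] using a[of i] by (intro ediam_ge) auto
      then show "p \<in> B i"
        using p r(2)[of i] by (auto simp: B_def gball_def)
    qed
    have \<nu>B: "emeasure \<nu> (B i) \<le> ?\<kappa> * ?w (A i)" for i
    \<comment> \<open>A covering set of diameter 0 has weight 0, so its ball of radius 0 has to be
      shown \<open>\<nu>\<close>-null.\<close>
    proof (cases "A i \<inter> M = {} \<or> r i = 0")
      case True
      then have "emeasure \<nu> (B i) = 0"
        using emeasure_\<nu>_gball_0[OF hdim a(2)[of i]] by (cases "A i \<inter> M = {}") (simp_all add: B_def)
      then show ?thesis
        by simp
    next
      case False
      then have "r i > 0"
        using r(2)[of i] by simp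
      have "emeasure \<nu> (B i) = ennreal (r i ^ hdim) * ?\<kappa>"
        using False a(2)[of i] \<open>r i > 0\<close> by (simp add: B_def emeasure_\<nu>_gball)
      also have "\<dots> \<le> ennreal (r i powr s) * ?\<kappa>"
        using powr_mono'[of s "real hdim" "r i"] s r[of i] \<open>r i > 0\<close>
        by (intro mult_right_mono ennreal_leI) (simp_all add: powr_realpow)
      finally show ?thesis
        using r[of i] by (simp add: ennpowr_ennreal mult.commute)
    qed
    have "?\<kappa> \<le> emeasure \<nu> (\<Union>i. B i)"
    proof (rule emeasure_\<nu>_mono)
      show "gball 0 1 \<inter> M \<subseteq> (\<Union>i. B i)"
        using A(2) AB by blast
    qed (use B in auto)
    also have "\<dots> \<le> (\<Sum>i. emeasure \<nu> (B i))"
      using B by (intro emeasure_subadditive_countably) auto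
    also have "\<dots> \<le> (\<Sum>i. ?\<kappa> * ?w (A i))"
      by (intro suminf_le \<nu>B) auto
    also have "\<dots> = ?\<kappa> * (\<Sum>i. ?w (A i))"
      by simp
    finally have "?\<kappa> * 1 \<le> ?\<kappa> * (\<Sum>i. ?w (A i))"
      by simp
    then show "1 \<le> (\<Sum>i. ?w (A i))"
      using emeasure_\<nu>_gball_pos emeasure_\<nu>_gball_finite[of 0 1]
      by (subst (asm) ennreal_mult_le_mult_iff) auto
  qed
  also have "\<dots> \<le> hausdorff_measure d s M"
    unfolding hausdorff_measure_gauge by (rule cover_content_le_gauge_measure) simp
  finally show ?thesis
    by auto
qed

theorem hausdorff_dim_eq:
  assumes "hdim \<ge> 1"
  shows "hausdorff_dim d M = of_nat hdim"
proof -
  have "{s. 0 < s \<and> hausdorff_measure d s M = 0} = {real hdim<..}"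
  proof (intro Set.set_eqI iffI)
    fix s assume "s \<in> {s. 0 < s \<and> hausdorff_measure d s M = 0}"
    then show "s \<in> {real hdim<..}"
      using hausdorff_measure_pos[of s] assms by force
  next
    fix s assume "s \<in> {real hdim<..}"
    then have "s > real hdim"
      by simp
    then show "s \<in> {s. 0 < s \<and> hausdorff_measure d s M = 0}"
      using hausdorff_measure_eq_0[of s] by (simp add: le_less_trans[OF of_nat_0_le_iff])
  qed
  then have eq: "hausdorff_dim d M = Inf (ennreal ` {real hdim<..})"
    by (simp add: hausdorff_dim_def)
  show ?thesis
    unfolding eq ennreal_of_nat_eq_real_of_nat
  proof (rule antisym)
    show "Inf (ennreal ` {real hdim<..}) \<le> ennreal (real hdim)"
    proof (rule ennreal_le_epsilon)
      fix e :: real assume "0 < e"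
      then show "Inf (ennreal ` {real hdim<..}) \<le> ennreal (real hdim) + ennreal e"
        by (simp add: INF_lower flip: ennreal_plus)
    qed
    show "ennreal (real hdim) \<le> Inf (ennreal ` {real hdim<..})"
      by (intro INF_greatest ennreal_leI) simp
  qed
qed

lemma dims_subgroup_M:
  assumes "dims_subgroup (carnot_group br) d dt dm M" "dt \<ge> 1"
  shows "dt = dim M1 + dim M2" "dm = hdim"
proof -
  have "dim M = dim M1 + dim M2"
    by (subst M_layers(1)) (rule dim_Times[OF M_layers(2,3)])
  then show dt: "dt = dim M1 + dim M2"
    using assms(1) by (simp add: dims_subgroup_def)
  then have "hdim \<ge> 1"
    using assms(2) by (simp add: hdim_def)
  then have "(of_nat dm :: ennreal) = of_nat hdim"
    using hausdorff_dim_eq assms(1) by (simp add: dims_subgroup_def)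
  then show "dm = hdim"
    by simp
qed

section \<open>Lower regularity of intrinsic Lipschitz graphs\<close>

lemma spherical_measure_lower_bound:
  assumes "hdim \<ge> 1" "r > 0" and sub: "M \<inter> gball 0 r \<subseteq> PM ` (\<lambda>p. g \<star> p) ` E"
  shows "ennreal (r ^ hdim) * emeasure \<nu> (gball 0 1)
    \<le> emeasure \<nu> (PM ` gball 0 1) * spherical_measure d hdim E"
proof -
  let ?w = "\<lambda>B. ediam d B ^ hdim" and ?K = "emeasure \<nu> (PM ` gball 0 1)"
  have Kpos: "?K > 0"
  proof -
    have "emeasure \<nu> (gball 0 1) \<le> ?K"
      by (rule emeasure_\<nu>_mono) (auto intro: image_eqI[of _ PM, OF PM_M[symmetric]])
    then show ?thesis
      using emeasure_\<nu>_gball_pos by simp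
  qed
  have "emeasure \<nu> (gball 0 r) \<le> ?K * cover_content ?w d (closed_balls d) 1 E"
  proof -
    have "emeasure \<nu> (gball 0 r) / ?K \<le> cover_content ?w d (closed_balls d) 1 E"
      unfolding cover_content_def
    proof (rule INF_greatest)
      fix B assume "B \<in> {B::nat \<Rightarrow> _. (\<forall>i. B i \<in> closed_balls d \<and> ediam d (B i) \<le> ennreal 1) \<and> E \<subseteq> (\<Union>i. B i)}"
      then have B: "\<And>i. B i \<in> closed_balls d" "E \<subseteq> (\<Union>i. B i)"
        by auto
      have "\<exists>c \<rho>. B i = gball c \<rho> \<and> 0 < \<rho>" for i
        using B(1)[of i] unfolding closed_balls_eq by blast
      then obtain c \<rho> where c: "\<And>i. B i = gball (c i) (\<rho> i)" "\<And>i. 0 < \<rho> i"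
        by metis
      have \<nu>: "emeasure \<nu> (PM ` gball (g \<star> c i) (\<rho> i)) \<le> ?K * ?w (B i)" for i
      proof -
        have "emeasure \<nu> (PM ` gball (g \<star> c i) (\<rho> i)) \<le> ennreal (\<rho> i ^ hdim) * ?K"
          by (rule emeasure_\<nu>_PM_gball[OF c(2)])
        also have "\<dots> \<le> ?w (B i) * ?K"
          using power_mono[OF ediam_gball_ge[of "\<rho> i" "c i"], of hdim] c(2)[of i]
          by (intro mult_right_mono) (simp_all add: c(1) ennreal_power)
        finally show ?thesis
          by (simp add: mult.commute)
      qed
      have "emeasure \<nu> (gball 0 r) \<le> emeasure \<nu> (\<Union>i. PM ` gball (g \<star> c i) (\<rho> i))"
      proof (rule emeasure_\<nu>_mono)
        have "PM ` (\<lambda>p. g \<star> p) ` E \<subseteq> (\<Union>i. PM ` (\<lambda>p. g \<star> p) ` B i)"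
          using B(2) by blast
        then show "gball 0 r \<inter> M \<subseteq> (\<Union>i. PM ` gball (g \<star> c i) (\<rho> i))"
          using sub unfolding c(1) image_gmult_gball by (simp only: Int_commute)
      qed auto
      also have "\<dots> \<le> (\<Sum>i. emeasure \<nu> (PM ` gball (g \<star> c i) (\<rho> i)))"
        by (intro emeasure_subadditive_countably) auto
      also have "\<dots> \<le> (\<Sum>i. ?K * ?w (B i))"
        by (intro suminf_le \<nu>) auto
      also have "\<dots> = (\<Sum>i. ?w (B i)) * ?K"
        by (simp add: mult.commute)
      finally show "emeasure \<nu> (gball 0 r) / ?K \<le> (\<Sum>i. ?w (B i))"
        using Kpos emeasure_\<nu>_PM_gball_finite[of 0 1] by (intro divide_le_posI_ennreal) (auto simp: mult.commute)
    qed
    then have "emeasure \<nu> (gball 0 r) / ?K * ?K \<le> cover_content ?w d (closed_balls d) 1 E * ?K"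
      by (rule mult_right_mono) simp
    moreover have "emeasure \<nu> (gball 0 r) / ?K * ?K = emeasure \<nu> (gball 0 r)"
    proof -
      have "emeasure \<nu> (gball 0 r) / ?K * ?K = emeasure \<nu> (gball 0 r) * ?K / ?K"
        by (simp only: mult.commute[of _ ?K] ennreal_times_divide)
      also have "\<dots> = emeasure \<nu> (gball 0 r)"
        using Kpos emeasure_\<nu>_PM_gball_finite[of 0 1] by (intro ennreal_mult_divide_eq) auto
      finally show ?thesis .
    qed
    ultimately show ?thesis
      by (simp only: mult.commute[of _ ?K])
  qed
  also have "\<dots> \<le> ?K * spherical_measure d hdim E"
    unfolding spherical_measure_gauge by (intro mult_left_mono cover_content_le_gauge_measure) auto
  finally show ?thesis
    using emeasure_\<nu>_gball[OF M_closed(1) assms(2)] by simp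
qed

lemma openin_M_gmult_twist:
  assumes "openin (top_of_set M) \<Omega>" "m0 \<in> \<Omega>"
  obtains e where "e > 0" "\<And>z. z \<in> M \<Longrightarrow> N z < e \<Longrightarrow> m0 \<star> twist h z \<in> \<Omega>"
proof -
  obtain V where V: "open V" "\<Omega> = M \<inter> V"
    using assms(1) unfolding openin_open by blast
  have "m0 \<in> M" "m0 \<in> V"
    using assms(2) V(2) by auto
  have cont: "continuous_on UNIV (\<lambda>z. m0 \<star> twist h z)"
    by (intro continuous_intros continuous_on_twist)
  have "open ((\<lambda>z. m0 \<star> twist h z) -` V)"
    by (rule open_vimage[OF V(1) cont])
  moreover have "twist h 0 = 0"
    by (simp add: twist_def \<pi>1_linear \<pi>2_linear br.zero_right prod_eq_iff)
  then have "0 \<in> (\<lambda>z. m0 \<star> twist h z) -` V"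
    using \<open>m0 \<in> V\<close> by simp
  ultimately obtain e where e: "e > 0" "\<And>z. N z < e \<Longrightarrow> z \<in> (\<lambda>z. m0 \<star> twist h z) -` V"
    using open_contains_N_ball by metis
  show ?thesis
  proof (rule that[OF e(1)])
    fix z assume "z \<in> M" "N z < e"
    then show "m0 \<star> twist h z \<in> \<Omega>"
      using e(2)[of z] V(2) \<open>m0 \<in> M\<close> M_closed(2)[OF _ twist_in] by auto
  qed
qed

text \<open>If the inequality failed, \<open>q\<close> would lie in the cone at \<open>p\<close>,
  hence equal \<open>p\<close>; but then both sides are 0.\<close>

lemma intrinsic_lipschitz_cone:
  assumes "intrinsic_lipschitz (carnot_group br) d M H \<Omega> f"
  obtains L where "L > 0"
    "\<And>p q. p \<in> intrinsic_graph (carnot_group br) \<Omega> f \<Longrightarrow> q \<in> intrinsic_graph (carnot_group br) \<Omega> f \<Longrightarrow>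
       N (PH (- p \<star> q)) \<le> L * N (PM (- p \<star> q))"
proof -
  obtain L where L: "L > 0" "\<forall>p\<in>intrinsic_graph (carnot_group br) \<Omega> f.
      intrinsic_cone (carnot_group br) d M H p (1 / L) \<inter> intrinsic_graph (carnot_group br) \<Omega> f = {p}"
    using assms unfolding intrinsic_lipschitz_def by blast
  have "N (PH (- p \<star> q)) \<le> L * N (PM (- p \<star> q))"
    if pq: "p \<in> intrinsic_graph (carnot_group br) \<Omega> f" "q \<in> intrinsic_graph (carnot_group br) \<Omega> f" for p q
  proof (rule ccontr)
    assume "\<not> ?thesis"
    then have *: "N (PM (- p \<star> q)) \<le> 1 / L * N (PH (- p \<star> q))"
      using L(1) by (simp add: field_simps)
    have "q \<in> intrinsic_cone (carnot_group br) d M H p (1 / L)"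
      unfolding intrinsic_cone_def l_coset_def assoc_norm_def proj_left_eq proj_right_eq
      using * by (intro UN_I[of "- p \<star> q"]) simp_all
    then have "q = p"
      using L(2) pq by blast
    then show False
      using \<open>\<not> _\<close> M_closed(1) by simp
  qed
  then show ?thesis
    using that L(1) by blast
qed

text \<open>Seen from \<open>g0\<close>, the part of the graph within distance \<open>\<rho>\<close>
  projects onto the whole ball of radius \<open>\<rho> / (1 + L)\<close> in \<open>M\<close>: the
  cone condition bounds the \<open>H\<close>-part of a point by \<open>L\<close> times its
  \<open>M\<close>-part, so the triangle inequality costs the factor \<open>1 + L\<close>.\<close>

theorem lipschitz_graph_lower_regular:
  assumes hdim: "hdim \<ge> 1" and \<Omega>: "openin (top_of_set M) \<Omega>" and f: "f \<in> \<Omega> \<rightarrow> H"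
    and lip: "intrinsic_lipschitz (carnot_group br) d M H \<Omega> f"
    and g0: "g0 \<in> intrinsic_graph (carnot_group br) \<Omega> f" and U: "open U" "g0 \<in> U"
  obtains c \<rho>0 where "c > 0" "\<rho>0 > 0"
    "\<And>\<rho>. 0 < \<rho> \<Longrightarrow> \<rho> < \<rho>0 \<Longrightarrow>
      ennreal (c * \<rho> ^ hdim) \<le> spherical_measure d hdim (intrinsic_graph (carnot_group br) \<Omega> f \<inter> U \<inter> gball g0 \<rho>)"
proof -
  let ?\<Gamma> = "intrinsic_graph (carnot_group br) \<Omega> f"
  obtain L where L: "L > 0" "\<And>p q. p \<in> ?\<Gamma> \<Longrightarrow> q \<in> ?\<Gamma> \<Longrightarrow> N (PH (- p \<star> q)) \<le> L * N (PM (- p \<star> q))"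
    using intrinsic_lipschitz_cone[OF lip] by blast
  obtain m0 where m0: "m0 \<in> \<Omega>" "g0 = m0 \<star> f m0"
    using g0 unfolding intrinsic_graph_def by auto
  have \<Omega>M: "\<Omega> \<subseteq> M"
    using \<Omega> openin_imp_subset by blast
  define h0 where "h0 = f m0"
  have h0: "h0 \<in> H" "m0 \<in> M"
    using f m0 \<Omega>M by (auto simp: h0_def)
  obtain e where e: "e > 0" "\<And>z. z \<in> M \<Longrightarrow> N z < e \<Longrightarrow> m0 \<star> twist h0 z \<in> \<Omega>"
    using openin_M_gmult_twist[OF \<Omega> m0(1)] by blast
  obtain e' where e': "e' > 0" "\<And>p. d p g0 < e' \<Longrightarrow> p \<in> U"
    using open_contains_d_ball[OF U] by blast
  have key: "\<exists>p\<in>?\<Gamma> \<inter> U \<inter> gball g0 \<rho>. z = PM (- g0 \<star> p)"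
    if \<rho>: "0 < \<rho>" "\<rho> < min e e'" and z: "z \<in> M" "N z \<le> \<rho> / (1 + L)" for \<rho> z
  proof -
    have Nz: "(1 + L) * N z \<le> \<rho>" "N z < e"
    proof -
      show *: "(1 + L) * N z \<le> \<rho>"
        using z(2) L(1) by (simp add: field_simps)
      have "N z \<le> (1 + L) * N z"
        using L(1) mult_nonneg_nonneg[of L "N z"] by (simp add: algebra_simps)
      then show "N z < e"
        using * \<rho> by simp
    qed
    \<comment> \<open>The parameter whose graph point projects to \<open>z\<close> after translation
      by \<open>- g0\<close>: the shear by \<open>h0\<close> undoes the one that this translation
      causes.\<close>
    define w where "w = m0 \<star> twist h0 z"
    have w: "w \<in> \<Omega>"
      unfolding w_def by (rule e(2)[OF z(1) Nz(2)])
    define p where "p = w \<star> f w"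
    have p: "p \<in> ?\<Gamma>"
      using w unfolding p_def intrinsic_graph_def by auto
    have "PM (- g0 \<star> p) = PM ((- g0 \<star> w) \<star> f w)"
      by (simp add: p_def gmult_assoc)
    also have "\<dots> = PM (- g0 \<star> w)"
      using f w by (intro PM_gmult_right) auto
    also have "- g0 \<star> w = - h0 \<star> twist h0 z"
      by (simp add: m0(2) w_def minus_gmult gmult_assoc h0_def)
    also have "PM (- h0 \<star> twist h0 z) = z"
      using PM_gmult_H[OF H_closed(3)[OF h0(1)] twist_in[OF z(1)]] by simp
    finally have PM: "PM (- g0 \<star> p) = z" .
    have "N (- g0 \<star> p) \<le> N z + N (PH (- g0 \<star> p))"
      using N_triangle[of "PM (- g0 \<star> p)" "PH (- g0 \<star> p)"] unfolding PM_PH unfolding PM .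
    also have "\<dots> \<le> N z + L * N z"
      using L(2)[OF g0 p] by (simp add: PM)
    also have "\<dots> \<le> \<rho>"
      using Nz(1) by (simp add: algebra_simps)
    finally have "d p g0 \<le> \<rho>"
      by (simp add: d_eq)
    moreover from this have "p \<in> U"
      using \<rho> by (intro e'(2)) simp
    ultimately show ?thesis
      using p PM by (intro bexI[of _ p]) (auto simp: gball_def)
  qed
  let ?\<kappa> = "emeasure \<nu> (gball 0 1)" and ?K = "emeasure \<nu> (PM ` gball 0 1)"
  obtain k where k: "?\<kappa> = ennreal k" "k > 0"
    using emeasure_\<nu>_gball_pos emeasure_\<nu>_gball_finite[of 0 1] by (cases ?\<kappa>) auto
  obtain K where K: "?K = ennreal K" "K \<ge> 0"
    using emeasure_\<nu>_PM_gball_finite[of 0 1] by (cases ?K) auto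
  \<comment> \<open>Collects the measure \<open>k\<close> of the unit ball of \<open>M\<close>, the
    shrinking factor \<open>1 + L\<close> and the projection constant \<open>K\<close>;
    \<open>K + 1\<close> keeps the denominator positive.\<close>
  define c where "c = k / ((1 + L) ^ hdim * (K + 1))"
  have c: "c > 0"
    using k K L by (simp add: c_def)
  have low: "ennreal (c * \<rho> ^ hdim) \<le> spherical_measure d hdim (?\<Gamma> \<inter> U \<inter> gball g0 \<rho>)"
    if \<rho>: "0 < \<rho>" "\<rho> < min e e'" for \<rho>
  proof -
    let ?S = "spherical_measure d hdim (?\<Gamma> \<inter> U \<inter> gball g0 \<rho>)"
    have "M \<inter> gball 0 (\<rho> / (1 + L)) \<subseteq> PM ` (\<lambda>p. - g0 \<star> p) ` (?\<Gamma> \<inter> U \<inter> gball g0 \<rho>)"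
    proof
      fix z assume "z \<in> M \<inter> gball 0 (\<rho> / (1 + L))"
      then have "z \<in> M" "N z \<le> \<rho> / (1 + L)"
        by (auto simp: mem_gball)
      from key[OF \<rho> this] show "z \<in> PM ` (\<lambda>p. - g0 \<star> p) ` (?\<Gamma> \<inter> U \<inter> gball g0 \<rho>)"
        by blast
    qed
    then have "ennreal ((\<rho> / (1 + L)) ^ hdim) * ennreal k \<le> ennreal K * ?S"
      using spherical_measure_lower_bound[OF hdim, of "\<rho> / (1 + L)" "- g0"] \<rho> L(1) k K by simp
    also have "\<dots> \<le> ennreal (K + 1) * ?S"
      by (intro mult_right_mono ennreal_leI) auto
    finally have "ennreal ((\<rho> / (1 + L)) ^ hdim * k) \<le> ennreal (K + 1) * ?S"
      using \<rho> L k by (simp add: ennreal_mult)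
    then show ?thesis
    proof (cases ?S)
      case (real s)
      then have "(\<rho> / (1 + L)) ^ hdim * k \<le> (K + 1) * s"
        using \<open>ennreal _ \<le> ennreal (K + 1) * ?S\<close> K(2) by (simp add: ennreal_le_iff del: ennreal_plus flip: ennreal_mult)
      moreover have "(\<rho> / (1 + L)) ^ hdim * k = c * \<rho> ^ hdim * (K + 1)"
        using K(2) L(1) by (simp add: c_def power_divide)
      ultimately have "c * \<rho> ^ hdim \<le> s"
        using K(2) by (simp add: mult.commute)
      then show ?thesis
        using real by (simp add: ennreal_leI)
    qed simp
  qed
  show ?thesis
    using that[OF c _ low, of "min e e'"] e(1) e'(1) by simp
qed

end

section \<open>The module of families of graphs\<close>

lemma borel_measurable_ennpowr [measurable]: "(\<lambda>x. ennpowr x p) \<in> borel_measurable borel"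
  unfolding ennpowr_def by measurable

lemma ennpowr_cmult: "t > 0 \<Longrightarrow> ennpowr (ennreal t * x) p = ennreal (t powr p) * ennpowr x p"
proof (cases x)
  case (real r)
  assume "t > 0"
  then show ?thesis
    using real by (simp add: ennpowr_ennreal powr_mult flip: ennreal_mult)
next
  case top
  assume "t > 0"
  then show ?thesis
    using top by (simp add: ennpowr_def ennreal_mult_top)
qed

text \<open>
  This replaces Hoelder's inequality: on \<open>{x > t}\<close> one has \<open>x \<le> t powr (1 - p) * x powr p\<close>.
\<close>

lemma ennreal_le_add_ennpowr:
  assumes "t > 0" "p > 1"
  shows "x \<le> ennreal t + ennreal (t powr (1 - p)) * ennpowr x p"
proof (cases x)
  case (real r)
  have "r \<le> t + t powr (1 - p) * r powr p"
  proof (cases "r \<le> t")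
    case False
    then have r: "r > 0" "t \<le> r"
      using assms(1) by auto
    have "r = r powr (1 - p) * r powr p"
      using r(1) by (simp flip: powr_add)
    also have "\<dots> \<le> t powr (1 - p) * r powr p"
      using powr_mono2'[of "1 - p" t r] assms r by (intro mult_right_mono) auto
    finally show ?thesis
      using assms(1) by linarith
  qed (simp add: add_increasing2)
  then show ?thesis
    using real assms(1) by (simp add: ennpowr_ennreal ennreal_leI flip: ennreal_mult ennreal_plus)
next
  case top
  then show ?thesis
    using assms(1) by (simp add: ennpowr_def ennreal_mult_top)
qed

text \<open>Absorbs a small finite term without subtracting in \<open>ennreal\<close>.\<close>

lemma ennreal_half_le:
  assumes "1 \<le> ennreal a + X" "a \<le> 1/2"
  shows "ennreal (1/2) \<le> X"
proof (cases X)
  case (real x)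
  have "ennreal a \<le> ennreal (1/2)"
    using assms(2) by (rule ennreal_leI)
  then have le: "1 \<le> ennreal (1/2) + X"
    using assms(1) by (meson add_right_mono order_trans)
  have eq: "ennreal (1/2) + X = ennreal (1/2 + x)"
    unfolding real(2) using real(1) by (intro ennreal_plus[symmetric]) auto
  have "ennreal 1 \<le> ennreal (1/2 + x)"
    using le unfolding eq by (simp only: ennreal_1)
  then have "(1 :: real) \<le> 1/2 + x"
    using real(1) by (subst (asm) ennreal_le_iff) auto
  then show ?thesis
    unfolding real(2) by (intro ennreal_leI) simp
qed simp

lemma summable_shift_powr: "p > 1 \<Longrightarrow> summable (\<lambda>k. real (k + 2) powr - p)"
  using summable_iff_shift[of "\<lambda>k. real k powr - p" 2] by (simp add: summable_real_powr_iff)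

lemma not_summable_shift_inverse: "\<not> summable (\<lambda>k. 1 / real (k + 2 + k0))"
proof -
  have "\<not> summable (\<lambda>k. real (k + (2 + k0)) powr - 1)"
    by (subst summable_iff_shift[of "\<lambda>k. real k powr - 1" "2 + k0"], subst summable_real_powr_iff) simp
  then show ?thesis
    by (simp add: powr_minus divide_inverse add.assoc)
qed

section \<open>Dyadic weights of the test function\<close>

definition dyadic_weight :: "nat \<Rightarrow> nat \<Rightarrow> real" where
  "dyadic_weight m k = 2 ^ (k * m) / real (k + 2)"

lemma dyadic_weight_pos: "dyadic_weight m k > 0"
  by (simp add: dyadic_weight_def)

text \<open>The shift by 2 in the denominator makes consecutive weights grow at least by the factor
  2 * 2/3 = 4/3. This is the growth that keeps the constant 4 in the induction, since
  \<open>4 * w k + w (k + 1)\<close> is at most \<open>4 * w (k + 1)\<close> exactly if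
  \<open>w (k + 1)\<close> is at least 4/3 of \<open>w k\<close>.\<close>

lemma sum_dyadic_weight_le:
  assumes m: "m \<ge> 1"
  shows "(\<Sum>j\<le>k. dyadic_weight m j) \<le> 4 * dyadic_weight m k"
proof (induction k)
  case 0
  then show ?case
    by (simp add: dyadic_weight_def)
next
  case (Suc k)
  have "dyadic_weight m (Suc k) = dyadic_weight m k * (2 ^ m * (real (k + 2) / real (k + 3)))"
    by (simp add: dyadic_weight_def power_add add.commute)
  moreover have "2 * (2 / 3) \<le> 2 ^ m * (real (k + 2) / real (k + 3))"
    using m self_le_power[of 2 m] by (intro mult_mono) (auto simp: field_simps)
  then have "dyadic_weight m k * (2 * (2 / 3)) \<le> dyadic_weight m k * (2 ^ m * (real (k + 2) / real (k + 3)))"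
    by (rule mult_left_mono[OF _ less_imp_le[OF dyadic_weight_pos]])
  ultimately have "dyadic_weight m k * (2 * (2 / 3)) \<le> dyadic_weight m (Suc k)"
    by (simp only:)
  then show ?case
    using Suc by simp
qed
text \<open>The energy of one dyadic ball, up to constants: the exponential growth of the weight is
  cancelled by the volume \<open>(1/2) ^ (k * Q)\<close> as soon as \<open>m * p\<close> is at most
  \<open>Q\<close>, and the logarithmic factor is what remains.\<close>

lemma dyadic_weight_powr_le:
  assumes mp: "real m * p \<le> real Q"
  shows "(4 * dyadic_weight m k) powr p * (1/2) ^ (k * Q) \<le> 4 powr p * real (k + 2) powr - p"
proof -
  have split: "(4 * dyadic_weight m k) powr p = 4 powr p * (2 powr (real k * (real m * p))) * real (k + 2) powr - p"
    by (simp add: dyadic_weight_def powr_mult powr_divide powr_minus inverse_powr divide_inverse powr_powr mult.assoc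
        flip: powr_realpow)
  have mono: "2 powr (real k * (real m * p)) \<le> 2 powr (real k * real Q)"
    using mp by (intro powr_mono mult_left_mono) auto
  have one: "2 powr (real k * real Q) * (1/2) ^ (k * Q) = 1"
    by (simp add: powr_realpow power_divide flip: of_nat_mult of_nat_add)
  have "(4 * dyadic_weight m k) powr p * (1/2) ^ (k * Q)
      = 4 powr p * real (k + 2) powr - p * (2 powr (real k * (real m * p)) * (1/2) ^ (k * Q))"
    unfolding split by (simp only: mult_ac)
  also have "\<dots> \<le> 4 powr p * real (k + 2) powr - p * (2 powr (real k * real Q) * (1/2) ^ (k * Q))"
    by (intro mult_left_mono mult_right_mono mono) simp_all
  also have "\<dots> = 4 powr p * real (k + 2) powr - p"
    unfolding one by simp
  finally show ?thesis .
qed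

context homogeneous_group
begin

lemma spherical_measure_mono: "A \<subseteq> B \<Longrightarrow> spherical_measure d m A \<le> spherical_measure d m B"
  unfolding spherical_measure_gauge by (rule gauge_measure_mono)

text \<open>
  The test function is \<open>\<Sum>\<^sub>k 2\<^sup>k\<^sup>m / (k + 2)\<close> times the indicator of the ball of radius \<open>2\<^sup>-\<^sup>k\<close> about the common
  point, comparable to \<open>r\<^sup>-\<^sup>m / log (1 / r)\<close>. A decreasing radial function needs only lower bounds
  on the measures of balls, not of annuli.
\<close>

theorem surface_module_common_point:
  assumes haar: "haar_measure (carnot_group br) \<mu>" and m: "m \<ge> 1" and p: "p > 1"
    and mp: "real m * p \<le> real (DIM('a) + 2 * DIM('b))"
    and low: "\<And>S. S \<in> F \<Longrightarrow> \<exists>c \<rho>0. c > 0 \<and> \<rho>0 > 0 \<and>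
      (\<forall>\<rho>. 0 < \<rho> \<longrightarrow> \<rho> < \<rho>0 \<longrightarrow> ennreal (c * \<rho> ^ m) \<le> spherical_measure d m (S \<inter> gball g0 \<rho>))"
  shows "surface_module \<mu> d m p F = 0"
proof -
  let ?Q = "DIM('a) + 2 * DIM('b)"
  have s\<mu> [measurable_cong]: "sets \<mu> = sets borel"
    using haar by (simp add: haar_measure_def)
  obtain c0 where c0: "0 < c0" "\<And>A. A \<in> sets borel \<Longrightarrow> emeasure \<mu> A = ennreal c0 * emeasure lborel A"
    using haar_measure_eq_lborel[OF haar] by blast
  define w where "w = dyadic_weight m"
  define b where "b k = gball g0 ((1/2) ^ k)" for k
  define f where "f x = (\<Sum>k. ennreal (w k) * indicator (b k) x)" for x
  have b [measurable]: "b k \<in> sets borel" for k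
    by (simp add: b_def)
  have f [measurable]: "f \<in> borel_measurable borel"
    unfolding f_def by measurable
  have w: "w k > 0" for k
    by (simp add: w_def dyadic_weight_pos)
  have inf: "(\<integral>\<^sup>+x. f x \<partial>spherical_restrict d m S) = \<infinity>" if S: "S \<in> F" for S
  proof -
    obtain c \<rho>0 where c: "c > 0" "\<rho>0 > 0"
      "\<And>\<rho>. 0 < \<rho> \<Longrightarrow> \<rho> < \<rho>0 \<Longrightarrow> ennreal (c * \<rho> ^ m) \<le> spherical_measure d m (S \<inter> gball g0 \<rho>)"
      using low[OF S] by blast
    obtain k0 where k0: "(1/2) ^ k0 < \<rho>0"
      using real_arch_pow_inv[of \<rho>0 "1/2"] c(2) by auto
    \<comment> \<open>The growth \<open>2 ^ (k * m)\<close> of the weight cancels the lower bound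
      for the ball of radius \<open>(1/2) ^ k\<close>, so each ball contributes a term of the
      harmonic series.\<close>
    have layer: "ennreal (c * (1 / real (k + 2 + k0))) \<le> ennreal (w (k + k0)) * spherical_measure d m (b (k + k0) \<inter> S)" for k
    proof -
      have "(1/2) ^ (k + k0) < \<rho>0"
        by (rule le_less_trans[OF power_decreasing k0]) simp_all
      then have "ennreal (c * ((1/2) ^ (k + k0)) ^ m) \<le> spherical_measure d m (b (k + k0) \<inter> S)"
        using c(3)[of "(1/2) ^ (k + k0)"] by (simp add: b_def Int_commute)
      then have "ennreal (w (k + k0)) * ennreal (c * ((1/2) ^ (k + k0)) ^ m)
          \<le> ennreal (w (k + k0)) * spherical_measure d m (b (k + k0) \<inter> S)"
        by (rule mult_left_mono) simp
      moreover have "w (k + k0) * (c * ((1/2) ^ (k + k0)) ^ m) = c * (1 / real (k + 2 + k0))"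
        by (simp add: w_def dyadic_weight_def power_mult[symmetric] power_divide add_ac)
      ultimately show ?thesis
        using w[of "k + k0"] c(1) by (simp flip: ennreal_mult)
    qed
    have "(\<integral>\<^sup>+x. f x \<partial>spherical_restrict d m S) = (\<Sum>k. ennreal (w k) * spherical_measure d m (b k \<inter> S))"
      unfolding f_def using m
      by (subst nn_integral_suminf) (simp_all add: nn_integral_cmult_indicator emeasure_spherical_restrict)
    also have "\<dots> = (\<Sum>k. ennreal (w (k + k0)) * spherical_measure d m (b (k + k0) \<inter> S))
        + (\<Sum>k<k0. ennreal (w k) * spherical_measure d m (b k \<inter> S))"
      by (rule suminf_offset) simp
    also have "\<dots> \<ge> (\<Sum>k. ennreal (c * (1 / real (k + 2 + k0))))"
      by (rule add_increasing2[OF _ suminf_le[OF layer]]) simp_all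
    finally have "(\<Sum>k. ennreal (c * (1 / real (k + 2 + k0)))) \<le> (\<integral>\<^sup>+x. f x \<partial>spherical_restrict d m S)" .
    moreover have "(\<Sum>k. ennreal (c * (1 / real (k + 2 + k0)))) = \<infinity>"
    proof (rule ccontr)
      assume "\<not> ?thesis"
      then have "summable (\<lambda>k. c * (1 / real (k + 2 + k0)))"
        using c(1) by (intro summable_suminf_not_top) auto
      then have "summable (\<lambda>k. 1 / c * (c * (1 / real (k + 2 + k0))))"
        by (rule summable_mult)
      moreover have "1 / c * (c * y) = y" for y
        using c(1) by simp
      ultimately show False
        using not_summable_shift_inverse[of k0] by (simp only:)
    qed
    ultimately show ?thesis
      by (simp add: top_unique)
  qed
  have nested: "b j \<subseteq> b k" if "k \<le> j" for j k
    unfolding b_def using power_decreasing[OF that, of "1/2 :: real"] by (intro gball_mono) simp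
  \<comment> \<open>If \<open>k\<close> is the last index with \<open>x\<close> in
    \<open>b k\<close>, then \<open>f x\<close> is the partial sum of the weights up to
    \<open>k\<close>, comparable to its last term; the power can then be taken of that single
    term.\<close>
  have point: "ennpowr (f x) p \<le> (\<Sum>k. ennreal ((4 * w k) powr p) * indicator (b k) x)" if x: "x \<noteq> g0" for x
  proof (cases "x \<in> b 0")
    case False
    then have "x \<notin> b k" for k
      using nested[of 0 k] by blast
    then show ?thesis
      by (simp add: f_def ennpowr_def)
  next
    case True
    have "d x g0 \<noteq> 0"
      using x by (metis N_eq_0 d_eq gmult_0(2) gmult_cancel(2))
    then have "d x g0 > 0"
      using d_nonneg[of x g0] by linarith
    then obtain n where "(1/2) ^ n < d x g0"
      using real_arch_pow_inv[of "d x g0" "1/2"] by auto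
    then have n: "x \<notin> b n"
      by (simp add: b_def gball_def)
    define l where "l = (LEAST n. x \<notin> b n)"
    have l: "x \<notin> b l"
      unfolding l_def using n by (rule LeastI)
    then obtain k where k: "l = Suc k"
      using True by (cases l) auto
    have xk: "x \<in> b k"
      using not_less_Least[of k "\<lambda>n. x \<notin> b n"] k unfolding l_def by auto
    have "x \<in> b j \<longleftrightarrow> j \<le> k" for j
      using nested[of j k] nested[of l j] xk l k by (cases "j \<le> k") auto
    then have "f x = (\<Sum>j. if j \<le> k then ennreal (w j) else 0)"
      unfolding f_def by (intro suminf_cong) simp
    also have "\<dots> = (\<Sum>j\<le>k. ennreal (w j))"
      by (subst suminf_finite[of "{..k}"]) auto
    also have "\<dots> = ennreal (\<Sum>j\<le>k. w j)"
      using w by (intro sum_ennreal less_imp_le)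
    also have "\<dots> \<le> ennreal (4 * w k)"
      unfolding w_def by (intro ennreal_leI sum_dyadic_weight_le m)
    finally have "ennpowr (f x) p \<le> ennpowr (ennreal (4 * w k)) p"
      using p by (intro ennpowr_mono) auto
    also have "\<dots> = ennreal ((4 * w k) powr p) * indicator (b k) x"
      using w[of k] xk by (simp add: ennpowr_ennreal)
    also have "\<dots> \<le> (\<Sum>j. ennreal ((4 * w j) powr p) * indicator (b j) x)"
    proof -
      have "h k \<le> (\<Sum>j. h j)" for h :: "nat \<Rightarrow> ennreal"
        using sum_le_suminf[of h "{k}"] by simp
      then show ?thesis .
    qed
    finally show ?thesis .
  qed
  \<comment> \<open>At the common point every weight contributes and \<open>f\<close> is infinite,
    but a single point is null.\<close>
  have "emeasure \<mu> {g0} = 0"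
    by (simp add: c0(2))
  then have "AE x in \<mu>. x \<noteq> g0"
    by (intro AE_I[of _ _ "{g0}"]) (auto simp: s\<mu>)
  then have "(\<integral>\<^sup>+x. ennpowr (f x) p \<partial>\<mu>)
      \<le> (\<integral>\<^sup>+x. (\<Sum>k. ennreal ((4 * w k) powr p) * indicator (b k) x) \<partial>\<mu>)"
    by (intro nn_integral_mono_AE) (auto intro: point)
  also have "\<dots> = (\<Sum>k. ennreal ((4 * w k) powr p) * emeasure \<mu> (b k))"
    by (subst nn_integral_suminf) (simp_all add: nn_integral_cmult_indicator s\<mu>)
  also have "\<dots> < \<infinity>"
  proof -
    obtain \<kappa> where \<kappa>: "emeasure lborel (gball 0 1) = ennreal \<kappa>" "\<kappa> \<ge> 0"
      using emeasure_lborel_gball_finite[of 0 1] by (cases "emeasure lborel (gball 0 1)") auto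
    have "emeasure \<mu> (b k) = ennreal (c0 * ((1/2) ^ (k * ?Q) * \<kappa>))" for k
      using c0 \<kappa> emeasure_lborel_gball[of "(1/2) ^ k" g0]
      by (simp add: b_def ennreal_mult power_mult)
    then have "(\<Sum>k. ennreal ((4 * w k) powr p) * emeasure \<mu> (b k))
        = (\<Sum>k. ennreal ((4 * w k) powr p * (c0 * ((1/2) ^ (k * ?Q) * \<kappa>))))"
      using c0(1) \<kappa>(2) by (simp add: ennreal_mult)
    also have "\<dots> \<le> (\<Sum>k. ennreal ((4 powr p * c0 * \<kappa>) * real (k + 2) powr - p))"
    proof (intro suminf_le ennreal_leI)
      fix k
      have "(4 * w k) powr p * (1/2) ^ (k * ?Q)
          \<le> 4 powr p * real (k + 2) powr - p"
        unfolding w_def by (rule dyadic_weight_powr_le[OF mp])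
      then have "(4 * w k) powr p * (1/2) ^ (k * ?Q) * (c0 * \<kappa>) \<le> 4 powr p * real (k + 2) powr - p * (c0 * \<kappa>)"
        using c0(1) \<kappa>(2) by (intro mult_right_mono) auto
      then show "(4 * w k) powr p * (c0 * ((1/2) ^ (k * ?Q) * \<kappa>)) \<le> 4 powr p * c0 * \<kappa> * real (k + 2) powr - p"
        by (simp only: mult_ac)
    qed auto
    also have "\<dots> = ennreal (\<Sum>k. (4 powr p * c0 * \<kappa>) * real (k + 2) powr - p)"
      using c0(1) \<kappa>(2) summable_shift_powr[OF p] by (intro suminf_ennreal2 summable_mult) auto
    also have "\<dots> < \<infinity>"
      by simp
    finally show ?thesis .
  qed
  finally obtain I where I: "(\<integral>\<^sup>+x. ennpowr (f x) p \<partial>\<mu>) = ennreal I" "I \<ge> 0"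
    by (cases "\<integral>\<^sup>+x. ennpowr (f x) p \<partial>\<mu>") auto
  have "surface_module \<mu> d m p F \<le> 0 + ennreal e" if e: "e > 0" for e
  proof -
    \<comment> \<open>Every multiple of \<open>f\<close> is admissible, since the surface integrals
      are infinite; this one has energy at most \<open>e\<close>.\<close>
    define t where "t = (e / (I + 1)) powr (1 / p)"
    have t: "t > 0" "t powr p = e / (I + 1)"
      using e I(2) p by (simp_all add: t_def powr_powr)
    have adm: "1 \<le> (\<integral>\<^sup>+x. ennreal t * f x \<partial>\<nu>)" if \<nu>: "\<nu> \<in> spherical_restrict d m ` F" for \<nu>
    proof -
      obtain S where S: "S \<in> F" "\<nu> = spherical_restrict d m S"
        using \<nu> by blast
      have "(\<integral>\<^sup>+x. ennreal t * f x \<partial>\<nu>) = ennreal t * (\<integral>\<^sup>+x. f x \<partial>\<nu>)"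
        unfolding S(2) by (intro nn_integral_cmult) measurable
      then show ?thesis
        using t(1) inf[OF S(1)] by (simp add: S(2) ennreal_mult_top)
    qed
    have "surface_module \<mu> d m p F \<le> (\<integral>\<^sup>+x. ennpowr (ennreal t * f x) p \<partial>\<mu>)"
      unfolding surface_module_def p_module_def
    proof (rule INF_lower)
      have "(\<lambda>x. ennreal t * f x) \<in> borel_measurable borel"
        by measurable
      then show "(\<lambda>x. ennreal t * f x) \<in> {f \<in> borel_measurable borel.
          \<forall>\<nu>\<in>spherical_restrict d m ` F. 1 \<le> (\<integral>\<^sup>+x. f x \<partial>\<nu>)}"
        using adm by simp
    qed
    also have "\<dots> = ennreal (t powr p) * (\<integral>\<^sup>+x. ennpowr (f x) p \<partial>\<mu>)"
      unfolding ennpowr_cmult[OF t(1)] by (intro nn_integral_cmult) measurable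
    also have "\<dots> = ennreal (e / (I + 1) * I)"
      unfolding I(1) t(2) using e I(2) by (intro ennreal_mult[symmetric]) simp_all
    also have "\<dots> \<le> 0 + ennreal e"
      using e I(2) by (simp add: ennreal_leI field_simps)
    finally show ?thesis .
  qed
  then have "surface_module \<mu> d m p F \<le> 0"
    by (rule ennreal_le_epsilon)
  then show ?thesis
    by simp
qed

end

context splitting
begin

text \<open>Relatively open in \<open>M\<close>, so that its translates are graphs over open sets,
  and bounded, so that its spherical measure is finite.\<close>

definition unit_piece :: "('a \<times> 'b) set" where "unit_piece = {z \<in> M. N z < 1}"

lemma spherical_measure_unit_piece_finite:
  assumes "m \<ge> 1" "m \<ge> hdim"
  shows "spherical_measure d m unit_piece < \<infinity>"
proof -
  have "unit_piece \<subseteq> M \<inter> gball 0 1"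
    by (auto simp: unit_piece_def mem_gball)
  then show ?thesis
    using spherical_measure_finite[OF assms] spherical_measure_mono le_less_trans by blast
qed

text \<open>
  Integrating the admissibility condition over all translates and using Tonelli and right invariance of
  Haar measure shows that no admissible function has finite energy.
\<close>

theorem surface_module_translates:
  assumes haar: "haar_measure (carnot_group br) \<mu>" and m: "m \<ge> 1" "m \<ge> hdim" and p: "p > 1"
  shows "surface_module \<mu> d m p (range (\<lambda>g. (\<lambda>z. g \<star> z) ` unit_piece)) = \<infinity>"
proof -
  let ?\<sigma> = "spherical_restrict d m unit_piece"
  obtain c0 where c0: "0 < c0" "\<And>A. A \<in> sets borel \<Longrightarrow> emeasure \<mu> A = ennreal c0 * emeasure lborel A"
    using haar_measure_eq_lborel[OF haar] by blast
  have s\<mu> [measurable_cong]: "sets \<mu> = sets borel"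
    using haar by (simp add: haar_measure_def)
  have \<mu>: "\<mu> = density lborel (\<lambda>_. ennreal c0)"
    by (rule measure_eqI) (simp_all add: s\<mu> c0 emeasure_density nn_integral_cmult_indicator)
  have tot: "emeasure ?\<sigma> UNIV < \<infinity>"
    using spherical_measure_unit_piece_finite[OF m] m(1) by (simp add: emeasure_spherical_restrict)
  then obtain s where s: "emeasure ?\<sigma> UNIV = ennreal s" "s \<ge> 0"
    by (cases "emeasure ?\<sigma> UNIV") auto
  interpret \<sigma>: finite_measure ?\<sigma>
    using tot by (intro finite_measureI) simp
  interpret pair_sigma_finite lborel ?\<sigma> ..
  have "(\<integral>\<^sup>+x. ennpowr (f x) p \<partial>\<mu>) = \<infinity>"
    if f [measurable]: "f \<in> borel_measurable borel"
      and adm: "\<forall>\<nu>\<in>spherical_restrict d m ` range (\<lambda>g. (\<lambda>z. g \<star> z) ` unit_piece). 1 \<le> (\<integral>\<^sup>+x. f x \<partial>\<nu>)" for f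
  proof -
    \<comment> \<open>The constant term contributes \<open>t * s\<close> to the integral over the
      piece; at most one half of the required 1 is lost to it.\<close>
    define t where "t = 1 / (2 * (s + 1))"
    have t: "t > 0" "t * s \<le> 1/2"
      using s(2) by (simp_all add: t_def field_simps)
    define C where "C = t powr (1 - p)"
    have C: "C > 0"
      using t(1) by (simp add: C_def)
    have lower: "ennreal (1/2) \<le> ennreal C * (\<integral>\<^sup>+z. ennpowr (f (g \<star> z)) p \<partial>?\<sigma>)" for g
    proof -
      have "1 \<le> (\<integral>\<^sup>+x. f x \<partial>spherical_restrict d m ((\<lambda>z. g \<star> z) ` unit_piece))"
        using adm by blast
      also have "\<dots> = (\<integral>\<^sup>+z. f (g \<star> z) \<partial>?\<sigma>)"
        unfolding spherical_restrict_translate[OF m(1)] by (subst nn_integral_distr) auto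
      also have "\<dots> \<le> (\<integral>\<^sup>+z. ennreal t + ennreal C * ennpowr (f (g \<star> z)) p \<partial>?\<sigma>)"
        unfolding C_def by (intro nn_integral_mono ennreal_le_add_ennpowr t(1) p)
      also have "\<dots> = ennreal t * emeasure ?\<sigma> UNIV + ennreal C * (\<integral>\<^sup>+z. ennpowr (f (g \<star> z)) p \<partial>?\<sigma>)"
        by (subst nn_integral_add) (auto simp: nn_integral_cmult)
      also have "ennreal t * emeasure ?\<sigma> UNIV = ennreal (t * s)"
        using t(1) s by (simp add: ennreal_mult)
      finally show ?thesis
        using t(2) by (rule ennreal_half_le)
    qed
    \<comment> \<open>For a fixed point \<open>z\<close> of the piece, varying the translation
      \<open>g\<close> is a right translation by \<open>z\<close>, so every \<open>z\<close> sees
      the same total energy.\<close>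
    have right: "(\<integral>\<^sup>+g. ennpowr (f (g \<star> z)) p \<partial>lborel) = (\<integral>\<^sup>+x. ennpowr (f x) p \<partial>lborel)" for z
    proof -
      have "distr lborel borel (\<lambda>g. g \<star> z) = lborel"
      proof (rule measure_eqI)
        fix A assume "A \<in> sets (distr lborel borel (\<lambda>g. g \<star> z))"
        then show "emeasure (distr lborel borel (\<lambda>g. g \<star> z)) A = emeasure lborel A"
          by (subst emeasure_distr) (auto simp: emeasure_lborel_gmult_right)
      qed simp
      then have "(\<integral>\<^sup>+x. ennpowr (f x) p \<partial>lborel) = (\<integral>\<^sup>+x. ennpowr (f x) p \<partial>distr lborel borel (\<lambda>g. g \<star> z))"
        by simp
      also have "\<dots> = (\<integral>\<^sup>+g. ennpowr (f (g \<star> z)) p \<partial>lborel)"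
        by (subst nn_integral_distr) auto
      finally show ?thesis ..
    qed
    \<comment> \<open>The lower bound is uniform in \<open>g\<close>, and the group has infinite
      volume.\<close>
    have "\<infinity> = (\<integral>\<^sup>+g. ennreal (1/2) \<partial>(lborel :: ('a \<times> 'b) measure))"
      by (simp add: emeasure_lborel_UNIV ennreal_mult_top del: ennreal_half)
    also have "\<dots> \<le> (\<integral>\<^sup>+g. ennreal C * (\<integral>\<^sup>+z. ennpowr (f (g \<star> z)) p \<partial>?\<sigma>) \<partial>lborel)"
      by (intro nn_integral_mono lower)
    also have "\<dots> = ennreal C * (\<integral>\<^sup>+g. \<integral>\<^sup>+z. ennpowr (f (g \<star> z)) p \<partial>?\<sigma> \<partial>lborel)"
      by (intro nn_integral_cmult) measurable
    also have "(\<integral>\<^sup>+g. \<integral>\<^sup>+z. ennpowr (f (g \<star> z)) p \<partial>?\<sigma> \<partial>lborel)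
        = (\<integral>\<^sup>+z. \<integral>\<^sup>+g. ennpowr (f (g \<star> z)) p \<partial>lborel \<partial>?\<sigma>)"
      by (rule Fubini'[symmetric]) measurable
    also have "\<dots> = (\<integral>\<^sup>+x. ennpowr (f x) p \<partial>lborel) * ennreal s"
      unfolding right by (simp add: s)
    finally have "ennreal C * ((\<integral>\<^sup>+x. ennpowr (f x) p \<partial>lborel) * ennreal s) = \<infinity>"
      by (simp add: top_unique)
    then have "(\<integral>\<^sup>+x. ennpowr (f x) p \<partial>lborel) = \<infinity>"
      by (auto simp: ennreal_mult_eq_top_iff)
    then show ?thesis
      unfolding \<mu> using c0(1) by (subst nn_integral_density) (auto simp: nn_integral_cmult ennreal_mult_top)
  qed
  then show ?thesis
    unfolding surface_module_def p_module_def
    by (intro antisym INF_greatest) auto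
qed

text \<open>A translate \<open>g \<star> z\<close> with \<open>z\<close> in \<open>M\<close> is
  determined by its projection to \<open>M\<close>, because \<open>z\<close> enters there through a
  shear and a translation of \<open>M\<close>, both invertible.\<close>

lemma lipschitz_graph_translate:
  assumes "dims_subgroup (carnot_group br) d dt dm M"
  shows "lipschitz_graph (carnot_group br) d dt dm ((\<lambda>z. g \<star> z) ` unit_piece)"
proof -
  define h where "h = PH g"
  \<comment> \<open>The inverse on \<open>M\<close> of the map taking \<open>z\<close> to
    \<open>PM (g \<star> z)\<close>.\<close>
  define \<Psi> where "\<Psi> w = twist (- h) (- PM g \<star> w)" for w
  define \<Omega> where "\<Omega> = {w \<in> M. N (\<Psi> w) < 1}"
  define f where "f w = PH (g \<star> \<Psi> w)" for w
  have \<Psi>_M: "\<Psi> w \<in> M" if "w \<in> M" for w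
    using that by (simp add: \<Psi>_def M_closed)
  have PM_\<Psi>: "PM (g \<star> \<Psi> w) = w" if "w \<in> M" for w
    using \<Psi>_M[OF that] by (simp add: PM_gmult_decomp) (simp add: \<Psi>_def h_def)
  have \<Psi>_PM: "\<Psi> (PM (g \<star> z)) = z" if "z \<in> M" for z
    using that by (simp add: PM_gmult_decomp \<Psi>_def h_def)
  have graph: "intrinsic_graph (carnot_group br) \<Omega> f = (\<lambda>z. g \<star> z) ` unit_piece"
  proof (rule subset_antisym; rule subsetI)
    fix q assume "q \<in> intrinsic_graph (carnot_group br) \<Omega> f"
    then obtain w where w: "w \<in> \<Omega>" "q = w \<star> f w"
      unfolding intrinsic_graph_def by auto
    then have "q = g \<star> \<Psi> w"
      using PM_PH[of "g \<star> \<Psi> w"] by (simp add: f_def \<Omega>_def PM_\<Psi>)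
    then show "q \<in> (\<lambda>z. g \<star> z) ` unit_piece"
      using w(1) \<Psi>_M by (simp add: \<Omega>_def unit_piece_def)
  next
    fix q assume "q \<in> (\<lambda>z. g \<star> z) ` unit_piece"
    then obtain z where z: "z \<in> M" "N z < 1" "q = g \<star> z"
      unfolding unit_piece_def by auto
    then have "PM (g \<star> z) \<in> \<Omega>" "q = PM (g \<star> z) \<star> f (PM (g \<star> z))"
      by (simp_all add: \<Omega>_def f_def \<Psi>_PM)
    then show "q \<in> intrinsic_graph (carnot_group br) \<Omega> f"
      unfolding intrinsic_graph_def mult_carnot by blast
  qed
  have "openin (top_of_set M) \<Omega>"
  proof -
    have "open {w. N (\<Psi> w) < 1}"
      unfolding \<Psi>_def
      by (intro open_Collect_less continuous_on_N' continuous_on_compose2[OF continuous_on_twist] continuous_intros) simp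
    moreover have "\<Omega> = M \<inter> {w. N (\<Psi> w) < 1}"
      by (auto simp: \<Omega>_def)
    ultimately show ?thesis
      unfolding openin_open by blast
  qed
  moreover have "f \<in> \<Omega> \<rightarrow> H"
    by (simp add: f_def)
  moreover have "intrinsic_lipschitz (carnot_group br) d M H \<Omega> f"
    unfolding intrinsic_lipschitz_def
  proof (intro exI[of _ 1] conjI ballI)
    fix q assume q: "q \<in> intrinsic_graph (carnot_group br) \<Omega> f"
    then obtain z where z: "z \<in> M" "q = g \<star> z"
      unfolding graph unit_piece_def by blast
    \<comment> \<open>Two points of the translate differ by an element of \<open>M\<close>, whose
      \<open>H\<close>-part is trivial; inside the cone its \<open>M\<close>-part must vanish as
      well.\<close>
    have "q' = q" if q': "q' \<in> intrinsic_cone (carnot_group br) d M H q (1 / 1)"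
      "q' \<in> intrinsic_graph (carnot_group br) \<Omega> f" for q'
    proof -
      obtain z' where z': "z' \<in> M" "q' = g \<star> z'"
        using q'(2) unfolding graph unit_piece_def by blast
      obtain v where v: "q' = q \<star> v" "N (PM v) \<le> N (PH v)"
        using q'(1) unfolding intrinsic_cone_def l_coset_def assoc_norm_def proj_left_eq proj_right_eq by auto
      have "v = - z \<star> z'"
        using v(1) unfolding z(2) z'(2) by (metis gmult_assoc gmult_cancel(1))
      then have "v \<in> M"
        using z(1) z'(1) by (simp add: M_closed)
      then have "v = 0"
        using v(2) N_nonneg[of v] by (simp add: order_antisym)
      then show ?thesis
        using v(1) by simp
    qed
    moreover have "q \<in> intrinsic_cone (carnot_group br) d M H q (1 / 1)"
      unfolding intrinsic_cone_def l_coset_def assoc_norm_def proj_left_eq proj_right_eq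
      by (intro UN_I[of 0]) (simp_all add: M_closed(1))
    ultimately show "intrinsic_cone (carnot_group br) d M H q (1 / 1) \<inter> intrinsic_graph (carnot_group br) \<Omega> f = {q}"
      using q by blast
  qed simp
  ultimately show ?thesis
    unfolding lipschitz_graph_def using dec assms graph by blast
qed

end

section \<open>Conclusion for the Heisenberg groups\<close>

theorem corollary7:
  fixes K :: scalars and n :: nat
    and br :: "'a::euclidean_space \<Rightarrow> 'a \<Rightarrow> 'b::euclidean_space"
    and G :: "('a \<times> 'b) monoid"
    and d :: "'a \<times> 'b \<Rightarrow> 'a \<times> 'b \<Rightarrow> real"
    and \<mu> :: "('a \<times> 'b) measure"
    and m1 m2 N Q dt dm :: nat
  assumes "n > 1"
    and "heisenberg_algebra K n br"
    and "G = carnot_group br"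
    and "haar_measure G \<mu>"
    and "admissible_dist br d"
    and "m1 = DIM('a)" and "m2 = DIM('b)"
    and "N = m1 + m2" and "Q = m1 + 2 * m2"
    and "1 \<le> dt" and "dt \<le> N - 1"
    and "1 \<le> dm" and "dm \<le> Q - 1"
  shows "(\<forall>F g0 p. F \<subseteq> lipschitz_surfaces G d dt dm \<and> (\<forall>S\<in>F. g0 \<in> S) \<and>
             real dm * p \<le> real Q \<and> p > 1 \<longrightarrow> surface_module \<mu> d dm p F = 0) \<and>
         (\<forall>p>0. dt = dm \<and> lipschitz_surfaces G d dt dm \<noteq> {} \<and> p * real dt > real m1 \<longrightarrow>
             (\<exists>F. F \<subseteq> lipschitz_surfaces G d dt dm \<and> (\<forall>S\<in>F. lipschitz_graph G d dt dm S) \<and>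
                surface_module \<mu> d dm p F \<noteq> 0))"
proof -
  have G: "G = carnot_group br" and haar: "haar_measure (carnot_group br) \<mu>"
    using assms(3,4) by simp_all
  have n: "n \<ge> 1"
    using assms(1) by simp
  obtain \<N> where \<N>: "homogeneous_norm (carnot_group br) \<N>" "d = norm_dist (carnot_group br) \<N>"
    using admissible_dist_homogeneous_norm[OF assms(2) n assms(5)] by blast
  have "skew_bilinear br"
    using heisenberg_algebra_generated[OF assms(2) n] by blast
  then interpret homogeneous_group br \<N>
    using \<N>(1) by unfold_locales
  have split: "splitting br \<N> M H" if "decomposition (carnot_group br) M H" for M H
    using that by unfold_locales
  show ?thesis
  proof (intro conjI allI impI)
    fix F g0 and p :: real
    assume *: "F \<subseteq> lipschitz_surfaces G d dt dm \<and> (\<forall>S\<in>F. g0 \<in> S) \<and> real dm * p \<le> real Q \<and> p > 1"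
    show "surface_module \<mu> d dm p F = 0"
      unfolding \<N>(2)
    proof (rule surface_module_common_point[OF haar \<open>1 \<le> dm\<close>])
      show "p > 1" "real dm * p \<le> real (DIM('a) + 2 * DIM('b))"
        using * assms(6,7,9) by simp_all
      fix S assume "S \<in> F"
      then have S: "S \<in> lipschitz_surfaces G d dt dm" "g0 \<in> S"
        using * by blast+
      obtain U \<Gamma> where U: "open U" "g0 \<in> U" "lipschitz_graph G d dt dm \<Gamma>" "S \<inter> U = \<Gamma> \<inter> U"
        using S unfolding lipschitz_surfaces_def by blast
      obtain M H \<Omega> f where g: "decomposition G M H" "dims_subgroup G d dt dm M"
        "openin (top_of_set M) \<Omega>" "f \<in> \<Omega> \<rightarrow> H" "intrinsic_lipschitz G d M H \<Omega> f"
        "\<Gamma> = intrinsic_graph G \<Omega> f"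
        using U(3) unfolding lipschitz_graph_def by blast
      interpret splitting br \<N> M H
        using g(1) unfolding G by (rule split)
      have dm: "dm = hdim"
        using dims_subgroup_M(2) g(2) \<open>1 \<le> dt\<close> unfolding G \<N>(2) by blast
      have "g0 \<in> intrinsic_graph (carnot_group br) \<Omega> f"
        using S(2) U(2,4) g(6) G by blast
      then obtain c \<rho>0 where c: "c > 0" "\<rho>0 > 0"
        "\<And>\<rho>. 0 < \<rho> \<Longrightarrow> \<rho> < \<rho>0 \<Longrightarrow> ennreal (c * \<rho> ^ hdim)
          \<le> spherical_measure (norm_dist (carnot_group br) \<N>) hdim
              (intrinsic_graph (carnot_group br) \<Omega> f \<inter> U \<inter> gball g0 \<rho>)"
        using lipschitz_graph_lower_regular[of \<Omega> f g0 U] g(3-5) U(1,2) \<open>1 \<le> dm\<close> dm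
        unfolding G \<N>(2) by blast
      have "intrinsic_graph (carnot_group br) \<Omega> f \<inter> U \<inter> gball g0 \<rho> \<subseteq> S \<inter> gball g0 \<rho>" for \<rho>
        using U(4) g(6) G by blast
      then show "\<exists>c \<rho>0. c > 0 \<and> \<rho>0 > 0 \<and> (\<forall>\<rho>. 0 < \<rho> \<longrightarrow> \<rho> < \<rho>0 \<longrightarrow>
          ennreal (c * \<rho> ^ dm) \<le> spherical_measure (norm_dist (carnot_group br) \<N>) dm (S \<inter> gball g0 \<rho>))"
        unfolding dm using c by (meson order_trans spherical_measure_mono)
    qed
  next
    fix p :: real
    assume "p > 0" and *: "dt = dm \<and> lipschitz_surfaces G d dt dm \<noteq> {} \<and> p * real dt > real m1"
    \<comment> \<open>Any surface of the given type is locally a graph, and this graph supplies a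
      decomposition whose \<open>M\<close> has the given dimensions.\<close>
    then obtain S q where "S \<in> lipschitz_surfaces G d dt dm" "q \<in> S"
      unfolding lipschitz_surfaces_def by blast
    then obtain \<Gamma> where "lipschitz_graph G d dt dm \<Gamma>"
      unfolding lipschitz_surfaces_def by blast
    then obtain M H where g: "decomposition G M H" "dims_subgroup G d dt dm M"
      unfolding lipschitz_graph_def by blast
    interpret splitting br \<N> M H
      using g(1) unfolding G by (rule split)
    have dims: "dims_subgroup (carnot_group br) (norm_dist (carnot_group br) \<N>) dt dm M"
      using g(2) unfolding G \<N>(2) .
    have dt: "dt = dim M1 + dim M2" and dm: "dm = hdim"
      using dims_subgroup_M[OF dims \<open>1 \<le> dt\<close>] by simp_all
    then have "dt = dim M1"
      using * by (simp add: hdim_def)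
    then have "dt \<le> m1"
      using dim_subset_UNIV[of M1] assms(6) by simp
    then have "1 * real dt < p * real dt"
      using * by linarith
    then have p: "p > 1"
      using \<open>1 \<le> dt\<close> by (simp only: mult_less_cancel_right_pos)
    let ?F = "range (\<lambda>g. (\<lambda>z. g \<star> z) ` unit_piece)"
    have graphs: "lipschitz_graph G d dt dm S" if "S \<in> ?F" for S
      using that lipschitz_graph_translate[OF dims] unfolding G \<N>(2) by blast
    moreover have "S \<in> lipschitz_surfaces G d dt dm" if "S \<in> ?F" for S
    proof -
      have "0 \<in> unit_piece"
        by (simp add: unit_piece_def M_closed(1))
      then have "S \<noteq> {}"
        using that by blast
      then show ?thesis
        unfolding lipschitz_surfaces_def using graphs[OF that] by blast
    qed
    moreover have "surface_module \<mu> d dm p ?F = \<infinity>"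
      unfolding \<N>(2) using surface_module_translates[OF haar \<open>1 \<le> dm\<close> _ p] dm by simp
    ultimately show "\<exists>F. F \<subseteq> lipschitz_surfaces G d dt dm \<and> (\<forall>S\<in>F. lipschitz_graph G d dt dm S) \<and>
        surface_module \<mu> d dm p F \<noteq> 0"
      by (intro exI[of _ ?F]) auto
  qed
qed

end
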